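(* Let $-1<\alpha<0$, and let $\varphi$ be a nonconstant analytic self-map of $\mathbb{D}$ satisfying $\varphi(0)=0$. Suppose that $\varphi$ satisfies the Uniform Tail Condition. Then the following statements are equivalent: (i) $C_\varphi$ has closed range on $\mathcal{D}_\alpha$. (ii) There exist constants $\delta>0$ and $r>0$ such that $\mu_{\varphi,\alpha}(D(z,r))\ge\delta A_\alpha(D(z,r))$ for all $z\in\mathbb{D}$. (iii) There exist constants $\delta>0$ and $r>0$ such that $A_\alpha(\varphi(\mathbb{D})\cap D(z,r))\ge\delta A_\alpha(D(z,r))$ for all $z\in\mathbb{D}$. (iv) $\mu_{\varphi,\alpha}$ is a Reverse Carleson measure for $A_\alpha^2$.
   Context: $\mathbb{D}$ is the open unit disk and $dA$ is normalized area measure on $\mathbb{D}$. For $\alpha>-1$, $dA_\alpha(z)=(1+\alpha)(1-|z|^2)^\alpha dA(z)$ and $A_\alpha(E)=\int_E dA_\alpha$. The weighted Bergman space $A_\alpha^2$ consists of analytic $g$ on $\mathbb{D}$ with $\|g\|_{A_\alpha^2}^2=\int_{\mathbb{D}}|g|^2dA_\alpha<\infty$. The weighted Dirichlet space $\mathcal{D}_\alpha$ consists of analytic $f$ on $\mathbb{D}$ with $\|f\|_{\mathcal{D}_\alpha}^2=|f(0)|^2+\int_{\mathbb{D}}|f'|^2dA_\alpha<\infty$, and $\mathcal{D}_{\alpha,0}=\{f\in\mathcal{D}_\alpha:f(0)=0\}$. $C_\varphi f=f\circ\varphi$. Counting function: $N_{\varphi,\alpha}(w)=\sum_{\varphi(z)=w}(1-|z|^2)^\alpha\in[0,+\infty]$,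 preimages counted with multiplicity, and $N_{\varphi,\alpha}(w)=0$ if $w\notin\varphi(\mathbb{D})$. The measure $\mu_{\varphi,\alpha}$ on $\mathbb{D}$ is $d\mu_{\varphi,\alpha}(w)=N_{\varphi,\alpha}(w)\,dA(w)$. Bergman disks: $\rho(z,w)=\left|\frac{z-w}{1-\overline z w}\right|$, $\beta(z,w)=\operatorname{arctanh}\rho(z,w)$, and $D(z,r)=\{w\in\mathbb{D}:\beta(z,w)<r\}$ for $r>0$. A positive Borel measure $\mu$ on $\mathbb{D}$ is a Reverse Carleson measure for $A_\alpha^2$ if there is $c>0$ with $\int_{\mathbb{D}}|g|^2d\mu\ge c\|g\|_{A_\alpha^2}^2$ for all $g\in A_\alpha^2$. Uniform Tail Condition: for $M>0$ put $E_M=\{w\in\varphi(\mathbb{D}): N_{\varphi,\alpha}(w)/(1-|w|^2)^\alpha>M\}$. Then $\varphi$ satisfies the Uniform Tail Condition if $$\lim_{M\to\infty}\ \sup_{f\in\mathcal{D}_{\alpha,0},\ \|f\|_{\mathcal{D}_\alpha}=1}\ \int_{E_M}|f'(w)|^2N_{\varphi,\alpha}(w)\,dA(w)=0,$$ integrals and supremum being understood in $[0,+\infty]$. (Under this condition $C_\varphi$ is a bounded operator on $\mathcal{D}_\alpha$, so that (i) is meaningful.) *)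

theory Defs
  imports "HOL-Complex_Analysis.Complex_Analysis"
begin

abbreviation unit_disk :: "complex set" (\<open>\<bbbD>\<close>)
  where "\<bbbD> \<equiv> ball 0 1"

definition disk_area :: "complex measure"
  where "disk_area = scale_measure (ennreal (1 / pi)) (restrict_space lborel \<bbbD>)"

definition weighted_area :: "real \<Rightarrow> complex measure"
  where "weighted_area \<alpha> = density disk_area (\<lambda>z. ennreal ((1 + \<alpha>) * (1 - (cmod z)\<^sup>2) powr \<alpha>))"

text \<open>
  Functions on the disk are represented by their extensional versions (\<open>undefined\<close> outside the
  disk), so that equality of functions on the disk is equality in HOL and the Dirichlet norm
  below induces a genuine metric.  Norms are defined through their squares in \<open>[0, \<infinity>]\<close>.
\<close>

definition bergman_normsq :: "real \<Rightarrow> (complex \<Rightarrow> complex) \<Rightarrow> ennreal"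
  where "bergman_normsq \<alpha> g = (\<integral>\<^sup>+ z. ennreal ((cmod (g z))\<^sup>2) \<partial>weighted_area \<alpha>)"

definition bergman_space :: "real \<Rightarrow> (complex \<Rightarrow> complex) set"
  where "bergman_space \<alpha> = {g \<in> extensional \<bbbD>. g holomorphic_on \<bbbD> \<and> bergman_normsq \<alpha> g < \<infinity>}"

definition dirichlet_normsq :: "real \<Rightarrow> (complex \<Rightarrow> complex) \<Rightarrow> ennreal"
  where "dirichlet_normsq \<alpha> f =
    ennreal ((cmod (f 0))\<^sup>2) + (\<integral>\<^sup>+ z. ennreal ((cmod (deriv f z))\<^sup>2) \<partial>weighted_area \<alpha>)"

definition dirichlet_norm :: "real \<Rightarrow> (complex \<Rightarrow> complex) \<Rightarrow> real"
  where "dirichlet_norm \<alpha> f = sqrt (enn2real (dirichlet_normsq \<alpha> f))"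

definition dirichlet_space :: "real \<Rightarrow> (complex \<Rightarrow> complex) set"
  where "dirichlet_space \<alpha> = {f \<in> extensional \<bbbD>. f holomorphic_on \<bbbD> \<and> dirichlet_normsq \<alpha> f < \<infinity>}"

definition dirichlet_space0 :: "real \<Rightarrow> (complex \<Rightarrow> complex) set"
  where "dirichlet_space0 \<alpha> = {f \<in> dirichlet_space \<alpha>. f 0 = 0}"

definition dirichlet_dist :: "real \<Rightarrow> (complex \<Rightarrow> complex) \<Rightarrow> (complex \<Rightarrow> complex) \<Rightarrow> real"
  where "dirichlet_dist \<alpha> f g = dirichlet_norm \<alpha> (\<lambda>z. f z - g z)"

abbreviation dirichlet_topology :: "real \<Rightarrow> (complex \<Rightarrow> complex) topology"
  where "dirichlet_topology \<alpha> \<equiv> Metric_space.mtopology (dirichlet_space \<alpha>) (dirichlet_dist \<alpha>)"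

definition composition_op :: "(complex \<Rightarrow> complex) \<Rightarrow> (complex \<Rightarrow> complex) \<Rightarrow> complex \<Rightarrow> complex"
  where "composition_op \<phi> f = compose \<bbbD> f \<phi>"

text \<open>
  \<^const>\<open>closedin\<close> includes that the range lies in the Dirichlet space, i.e. that the composition
  operator maps this space into itself.
\<close>

definition has_closed_range :: "(complex \<Rightarrow> complex) \<Rightarrow> real \<Rightarrow> bool"
  where "has_closed_range \<phi> \<alpha> \<longleftrightarrow>
    closedin (dirichlet_topology \<alpha>) (composition_op \<phi> ` dirichlet_space \<alpha>)"

text \<open>
  The multiplicity of a preimage \<open>z\<close> of \<open>w\<close> is the order of the zero of \<open>\<phi> - w\<close> at \<open>z\<close>; it is
  positive, and \<^const>\<open>zorder\<close> is meaningful, because \<open>\<phi>\<close> is holomorphic and nonconstant.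
\<close>

definition counting_fun :: "(complex \<Rightarrow> complex) \<Rightarrow> real \<Rightarrow> complex \<Rightarrow> ennreal"
  where "counting_fun \<phi> \<alpha> w =
    (\<Sum>\<^sub>\<infinity>z\<in>{z \<in> \<bbbD>. \<phi> z = w}.
       ennreal (of_int (zorder (\<lambda>u. \<phi> u - w) z) * (1 - (cmod z)\<^sup>2) powr \<alpha>))"

definition counting_measure :: "(complex \<Rightarrow> complex) \<Rightarrow> real \<Rightarrow> complex measure"
  where "counting_measure \<phi> \<alpha> = density disk_area (counting_fun \<phi> \<alpha>)"

definition pseudohyp_dist :: "complex \<Rightarrow> complex \<Rightarrow> real"
  where "pseudohyp_dist z w = cmod ((z - w) / (1 - cnj z * w))"

definition bergman_dist :: "complex \<Rightarrow> complex \<Rightarrow> real"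
  where "bergman_dist z w = artanh (pseudohyp_dist z w)"

definition bergman_disk :: "complex \<Rightarrow> real \<Rightarrow> complex set"
  where "bergman_disk z r = {w \<in> \<bbbD>. bergman_dist z w < r}"

definition reverse_carleson :: "real \<Rightarrow> complex measure \<Rightarrow> bool"
  where "reverse_carleson \<alpha> \<mu> \<longleftrightarrow>
    sets \<mu> = sets (restrict_space borel \<bbbD>) \<and>
    (\<exists>c>0. \<forall>g\<in>bergman_space \<alpha>.
       (\<integral>\<^sup>+ z. ennreal ((cmod (g z))\<^sup>2) \<partial>\<mu>) \<ge> ennreal c * bergman_normsq \<alpha> g)"

definition tail_set :: "(complex \<Rightarrow> complex) \<Rightarrow> real \<Rightarrow> real \<Rightarrow> complex set"
  where "tail_set \<phi> \<alpha> M =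
    {w \<in> \<phi> ` \<bbbD>. counting_fun \<phi> \<alpha> w / ennreal ((1 - (cmod w)\<^sup>2) powr \<alpha>) > ennreal M}"

definition uniform_tail_condition :: "(complex \<Rightarrow> complex) \<Rightarrow> real \<Rightarrow> bool"
  where "uniform_tail_condition \<phi> \<alpha> \<longleftrightarrow>
    ((\<lambda>M. SUP f\<in>{f \<in> dirichlet_space0 \<alpha>. dirichlet_norm \<alpha> f = 1}.
        \<integral>\<^sup>+ w\<in>tail_set \<phi> \<alpha> M. (ennreal ((cmod (deriv f w))\<^sup>2) * counting_fun \<phi> \<alpha> w) \<partial>disk_area)
      \<longlongrightarrow> 0) at_top"

text \<open>
  \<^const>\<open>Metric_space.mtopology\<close> is the metric topology only for a genuine metric; this holds for
  \<^const>\<open>dirichlet_dist\<close>.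
\<close>

lemma space_disk_area [simp]: "space disk_area = \<bbbD>"
  by (simp add: disk_area_def space_scale_measure space_restrict_space)

lemma sets_disk_area [simp, measurable_cong]: "sets disk_area = sets (restrict_space borel \<bbbD>)"
  by (simp add: disk_area_def sets_restrict_space)

lemma space_weighted_area [simp]: "space (weighted_area \<alpha>) = \<bbbD>"
  by (simp add: weighted_area_def)

lemma sets_weighted_area [simp, measurable_cong]:
  "sets (weighted_area \<alpha>) = sets (restrict_space borel \<bbbD>)"
  by (simp add: weighted_area_def)

lemma borel_measurable_disk_continuous:
  "continuous_on \<bbbD> h \<Longrightarrow> h \<in> borel_measurable (restrict_space borel \<bbbD>)"
  by (rule borel_measurable_continuous_on_restrict)

lemma measurable_deriv_sq:
  assumes "f holomorphic_on \<bbbD>"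
  shows "(\<lambda>z. ennreal ((cmod (deriv f z))\<^sup>2)) \<in> borel_measurable (weighted_area \<alpha>)"
proof -
  have "continuous_on \<bbbD> (deriv f)"
    using assms by (intro holomorphic_on_imp_continuous_on holomorphic_deriv) auto
  then have "(\<lambda>z. (cmod (deriv f z))\<^sup>2) \<in> borel_measurable (restrict_space borel \<bbbD>)"
    by (intro borel_measurable_disk_continuous continuous_intros)
  then have "(\<lambda>z. ennreal ((cmod (deriv f z))\<^sup>2)) \<in> borel_measurable (restrict_space borel \<bbbD>)"
    by measurable
  then show ?thesis
    using measurable_cong_sets[OF sets_weighted_area refl] by blast
qed

lemma cmod_add_sq_le:
  assumes "t > 0"
  shows "(cmod (a + b))\<^sup>2 \<le> (1 + t) * (cmod a)\<^sup>2 + (1 + 1 / t) * (cmod b)\<^sup>2"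
proof -
  have "0 \<le> (t * cmod a - cmod b)\<^sup>2 / t"
    using assms by simp
  also have "\<dots> = t * (cmod a)\<^sup>2 + (1 / t) * (cmod b)\<^sup>2 - 2 * cmod a * cmod b"
    using assms by (simp add: field_simps power2_eq_square)
  finally have "(cmod a + cmod b)\<^sup>2 \<le> (1 + t) * (cmod a)\<^sup>2 + (1 + 1 / t) * (cmod b)\<^sup>2"
    by (simp add: power2_eq_square algebra_simps)
  moreover have "(cmod (a + b))\<^sup>2 \<le> (cmod a + cmod b)\<^sup>2"
    by (intro power_mono norm_triangle_ineq) auto
  ultimately show ?thesis by linarith
qed

lemma dirichlet_normsq_add_le:
  assumes f: "f holomorphic_on \<bbbD>" and g: "g holomorphic_on \<bbbD>" and t: "t > 0"
  shows "dirichlet_normsq \<alpha> (\<lambda>z. f z + g z)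
    \<le> ennreal (1 + t) * dirichlet_normsq \<alpha> f + ennreal (1 + 1 / t) * dirichlet_normsq \<alpha> g"
proof -
  have *: "ennreal ((cmod (a + b))\<^sup>2)
      \<le> ennreal (1 + t) * ennreal ((cmod a)\<^sup>2) + ennreal (1 + 1 / t) * ennreal ((cmod b)\<^sup>2)" for a b
    using cmod_add_sq_le[OF t, of a b] t
    by (simp add: ennreal_mult[symmetric] ennreal_plus[symmetric] ennreal_leI del: ennreal_plus)
  have "(\<integral>\<^sup>+ z. ennreal ((cmod (deriv (\<lambda>z. f z + g z) z))\<^sup>2) \<partial>weighted_area \<alpha>)
      \<le> (\<integral>\<^sup>+ z. ennreal (1 + t) * ennreal ((cmod (deriv f z))\<^sup>2)
             + ennreal (1 + 1 / t) * ennreal ((cmod (deriv g z))\<^sup>2) \<partial>weighted_area \<alpha>)"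
  proof (rule nn_integral_mono)
    fix z assume "z \<in> space (weighted_area \<alpha>)"
    then have "z \<in> \<bbbD>" by simp
    then have "deriv (\<lambda>z. f z + g z) z = deriv f z + deriv g z"
      using f g by (intro deriv_add) (auto intro: holomorphic_on_imp_differentiable_at)
    then show "ennreal ((cmod (deriv (\<lambda>z. f z + g z) z))\<^sup>2)
        \<le> ennreal (1 + t) * ennreal ((cmod (deriv f z))\<^sup>2)
          + ennreal (1 + 1 / t) * ennreal ((cmod (deriv g z))\<^sup>2)"
      using * by simp
  qed
  also have "\<dots> = ennreal (1 + t) * (\<integral>\<^sup>+ z. ennreal ((cmod (deriv f z))\<^sup>2) \<partial>weighted_area \<alpha>)
      + ennreal (1 + 1 / t) * (\<integral>\<^sup>+ z. ennreal ((cmod (deriv g z))\<^sup>2) \<partial>weighted_area \<alpha>)"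
    using measurable_deriv_sq[OF f, of \<alpha>] measurable_deriv_sq[OF g, of \<alpha>]
    by (simp add: nn_integral_add nn_integral_cmult)
  finally have "dirichlet_normsq \<alpha> (\<lambda>z. f z + g z)
      \<le> (ennreal (1 + t) * ennreal ((cmod (f 0))\<^sup>2) + ennreal (1 + 1 / t) * ennreal ((cmod (g 0))\<^sup>2))
        + (ennreal (1 + t) * (\<integral>\<^sup>+ z. ennreal ((cmod (deriv f z))\<^sup>2) \<partial>weighted_area \<alpha>)
          + ennreal (1 + 1 / t) * (\<integral>\<^sup>+ z. ennreal ((cmod (deriv g z))\<^sup>2) \<partial>weighted_area \<alpha>))"
    unfolding dirichlet_normsq_def by (intro add_mono *)
  then show ?thesis
    unfolding dirichlet_normsq_def distrib_left by (simp only: add_ac)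
qed

lemma cmod_deriv_uminus: "cmod (deriv (\<lambda>z. - h z) z) = cmod (deriv h z)"
proof (cases "h field_differentiable at z")
  case True
  then show ?thesis by simp
next
  case False
  have "\<not> ((\<lambda>z. - h z) has_field_derivative D) (at z)"
    and "\<not> (h has_field_derivative D) (at z)" for D
    using False DERIV_minus[of "\<lambda>z. - h z" D z UNIV] by (auto simp: field_differentiable_def)
  then show ?thesis by (simp add: deriv_def)
qed

lemma dirichlet_normsq_uminus: "dirichlet_normsq \<alpha> (\<lambda>z. - h z) = dirichlet_normsq \<alpha> h"
  by (simp add: dirichlet_normsq_def cmod_deriv_uminus)

lemma dirichlet_normsq_diff_finite:
  assumes "f \<in> dirichlet_space \<alpha>" "g \<in> dirichlet_space \<alpha>"
  shows "dirichlet_normsq \<alpha> (\<lambda>z. f z - g z) < \<infinity>"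
proof -
  have fg: "f holomorphic_on \<bbbD>" "(\<lambda>z. - g z) holomorphic_on \<bbbD>"
    and fin: "dirichlet_normsq \<alpha> f < \<infinity>" "dirichlet_normsq \<alpha> g < \<infinity>"
    using assms by (auto simp: dirichlet_space_def intro!: holomorphic_intros)
  have "dirichlet_normsq \<alpha> (\<lambda>z. f z + - g z)
      \<le> ennreal (1 + 1) * dirichlet_normsq \<alpha> f + ennreal (1 + 1 / 1) * dirichlet_normsq \<alpha> (\<lambda>z. - g z)"
    by (rule dirichlet_normsq_add_le[OF fg(1,2)]) simp
  also have "\<dots> < \<infinity>"
    using fin by (simp add: dirichlet_normsq_uminus ennreal_mult_less_top)
  finally show ?thesis by simp
qed

lemma dirichlet_normsq_eq_0D:
  assumes h: "h holomorphic_on \<bbbD>" and 0: "dirichlet_normsq \<alpha> h = 0" and \<alpha>: "\<alpha> > -1"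
    and z: "z \<in> \<bbbD>"
  shows "h z = 0"
proof -
  have h0: "h 0 = 0"
    and int0: "(\<integral>\<^sup>+ z. ennreal ((cmod (deriv h z))\<^sup>2) \<partial>weighted_area \<alpha>) = 0"
    using 0 by (auto simp: dirichlet_normsq_def)
  have cont: "continuous_on \<bbbD> (deriv h)"
    using h by (intro holomorphic_on_imp_continuous_on holomorphic_deriv) auto
  have w: "(\<lambda>z. ennreal ((1 + \<alpha>) * (1 - (cmod z)\<^sup>2) powr \<alpha>)) \<in> borel_measurable disk_area"
  proof -
    have "(\<lambda>z. (1 + \<alpha>) * (1 - (cmod z)\<^sup>2) powr \<alpha>) \<in> borel_measurable (restrict_space borel \<bbbD>)"
      by (intro borel_measurable_disk_continuous continuous_intros)
        (auto simp: power2_eq_1_iff, smt (verit) norm_ge_zero)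
    then have "(\<lambda>z. ennreal ((1 + \<alpha>) * (1 - (cmod z)\<^sup>2) powr \<alpha>))
        \<in> borel_measurable (restrict_space borel \<bbbD>)"
      by measurable
    then show ?thesis
      using measurable_cong_sets[OF sets_disk_area refl] by blast
  qed
  have "AE z in weighted_area \<alpha>. ennreal ((cmod (deriv h z))\<^sup>2) = 0"
    using int0 nn_integral_0_iff_AE[OF measurable_deriv_sq[OF h, of \<alpha>]] by simp
  then have "AE z in disk_area. 0 < ennreal ((1 + \<alpha>) * (1 - (cmod z)\<^sup>2) powr \<alpha>)
      \<longrightarrow> ennreal ((cmod (deriv h z))\<^sup>2) = 0"
    unfolding weighted_area_def using AE_density[OF w] by simp
  then have "AE z in disk_area. deriv h z = 0"
  proof (rule AE_mp, intro AE_I2 impI)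
    fix z assume "z \<in> space disk_area"
      "0 < ennreal ((1 + \<alpha>) * (1 - (cmod z)\<^sup>2) powr \<alpha>) \<longrightarrow> ennreal ((cmod (deriv h z))\<^sup>2) = 0"
    then show "deriv h z = 0"
      using \<alpha> abs_norm_cancel[of z] by (auto simp: abs_square_eq_1 zero_less_mult_iff)
  qed
  then have "AE z in restrict_space lborel \<bbbD>. deriv h z = 0"
    by (auto simp: disk_area_def eventually_ae_filter null_sets_def space_scale_measure)
  then have "AE z in lborel. z \<in> \<bbbD> \<longrightarrow> deriv h z = 0"
    by (simp add: AE_restrict_space_iff)
  then have ae: "AE z in lebesgue. z \<in> \<bbbD> \<longrightarrow> deriv h z = 0"
    by (rule AE_completion)
  have d0: "deriv h u = 0" if "u \<in> \<bbbD>" for u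
  proof (rule ccontr)
    assume "deriv h u \<noteq> 0"
    have op: "open {z \<in> \<bbbD>. deriv h z \<noteq> 0}"
    proof -
      have "open (\<bbbD> \<inter> deriv h -` (- {0}))"
        using cont by (intro continuous_open_preimage) auto
      moreover have "\<bbbD> \<inter> deriv h -` (- {0}) = {z \<in> \<bbbD>. deriv h z \<noteq> 0}" by auto
      ultimately show ?thesis by simp
    qed
    have "{z \<in> \<bbbD>. deriv h z \<noteq> 0} \<in> null_sets lebesgue"
    proof (subst AE_iff_null_sets)
      show "{z \<in> \<bbbD>. deriv h z \<noteq> 0} \<in> sets lebesgue"
        using op by (intro sets_completionI_sets) auto
      show "AE z in lebesgue. z \<notin> {z \<in> \<bbbD>. deriv h z \<noteq> 0}"
        using ae by simp
    qed
    then have "negligible {z \<in> \<bbbD>. deriv h z \<noteq> 0}"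
      by (simp add: negligible_iff_null_sets)
    with open_not_negligible[OF op] \<open>deriv h u \<noteq> 0\<close> that show False by blast
  qed
  have "h constant_on \<bbbD>"
  proof (rule has_field_derivative_0_imp_constant_on)
    fix u assume "u \<in> \<bbbD>"
    then show "(h has_field_derivative 0) (at u)"
      using holomorphic_derivI[OF h open_ball] d0 by metis
  qed auto
  then show ?thesis
    using h0 z by (force simp: constant_on_def)
qed

lemma Metric_space_dirichlet:
  assumes "\<alpha> > -1"
  shows "Metric_space (dirichlet_space \<alpha>) (dirichlet_dist \<alpha>)"
proof (rule Metric_space.intro)
  show nonneg: "0 \<le> dirichlet_dist \<alpha> f g" for f g
    by (simp add: dirichlet_dist_def dirichlet_norm_def)
  show "dirichlet_dist \<alpha> f g = dirichlet_dist \<alpha> g f" for f g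
    using dirichlet_normsq_uminus[of \<alpha> "\<lambda>z. f z - g z"]
    by (simp add: dirichlet_dist_def dirichlet_norm_def)
  have sq: "dirichlet_normsq \<alpha> (\<lambda>z. f z - g z) = ennreal ((dirichlet_dist \<alpha> f g)\<^sup>2)"
    if "f \<in> dirichlet_space \<alpha>" "g \<in> dirichlet_space \<alpha>" for f g
    using dirichlet_normsq_diff_finite[OF that]
    by (simp add: dirichlet_dist_def dirichlet_norm_def)
  have hol: "(\<lambda>z. f z - g z) holomorphic_on \<bbbD>"
    if "f \<in> dirichlet_space \<alpha>" "g \<in> dirichlet_space \<alpha>" for f g
    using that by (auto simp: dirichlet_space_def intro!: holomorphic_intros)
  show "dirichlet_dist \<alpha> f g = 0 \<longleftrightarrow> f = g"
    if fg: "f \<in> dirichlet_space \<alpha>" "g \<in> dirichlet_space \<alpha>" for f g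
  proof
    assume "dirichlet_dist \<alpha> f g = 0"
    then have "f z - g z = 0" if "z \<in> \<bbbD>" for z
      using dirichlet_normsq_eq_0D[OF hol[OF fg] _ assms that] sq[OF fg] by simp
    then show "f = g"
      using fg by (intro extensionalityI[of f \<bbbD> g]) (auto simp: dirichlet_space_def)
  next
    assume "f = g"
    then show "dirichlet_dist \<alpha> f g = 0"
      by (simp add: dirichlet_dist_def dirichlet_norm_def dirichlet_normsq_def)
  qed
  show "dirichlet_dist \<alpha> f h \<le> dirichlet_dist \<alpha> f g + dirichlet_dist \<alpha> g h"
    if f: "f \<in> dirichlet_space \<alpha>" and g: "g \<in> dirichlet_space \<alpha>" and h: "h \<in> dirichlet_space \<alpha>"
    for f g h
  proof (rule field_le_epsilon)
    fix e :: real assume e: "e > 0"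
    define a where "a = dirichlet_dist \<alpha> f g + e / 2"
    define b where "b = dirichlet_dist \<alpha> g h + e / 2"
    have pos: "a > 0" "b > 0"
      using e nonneg[of f g] nonneg[of g h] by (auto simp: a_def b_def)
    have "dirichlet_normsq \<alpha> (\<lambda>z. (f z - g z) + (g z - h z))
        \<le> ennreal (1 + b / a) * dirichlet_normsq \<alpha> (\<lambda>z. f z - g z)
          + ennreal (1 + 1 / (b / a)) * dirichlet_normsq \<alpha> (\<lambda>z. g z - h z)"
      using pos by (intro dirichlet_normsq_add_le hol f g h) auto
    then have "ennreal ((dirichlet_dist \<alpha> f h)\<^sup>2)
        \<le> ennreal ((1 + b / a) * (dirichlet_dist \<alpha> f g)\<^sup>2 + (1 + a / b) * (dirichlet_dist \<alpha> g h)\<^sup>2)"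
      using pos by (simp add: sq f g h ennreal_mult)
    then have "(dirichlet_dist \<alpha> f h)\<^sup>2
        \<le> (1 + b / a) * (dirichlet_dist \<alpha> f g)\<^sup>2 + (1 + a / b) * (dirichlet_dist \<alpha> g h)\<^sup>2"
      using pos by (subst (asm) ennreal_le_iff) auto
    also have "\<dots> \<le> (1 + b / a) * a\<^sup>2 + (1 + a / b) * b\<^sup>2"
      using pos e nonneg[of f g] nonneg[of g h]
      by (intro add_mono mult_left_mono power_mono) (auto simp: a_def b_def)
    also have "\<dots> = (a + b)\<^sup>2"
      using pos by (simp add: field_simps power2_eq_square)
    finally have "dirichlet_dist \<alpha> f h \<le> a + b"
      by (rule power2_le_imp_le) (use pos in simp)
    then show "dirichlet_dist \<alpha> f h \<le> dirichlet_dist \<alpha> f g + dirichlet_dist \<alpha> g h + e"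
      by (simp add: a_def b_def)
  qed
qed

end

theory Submission
  imports Defs
begin

text \<open>
  For holomorphic \<open>f\<close> on the disk write \<open>E(f)\<close> for the integral of \<open>|f'|\<^sup>2 (1 - |z|\<^sup>2)\<^sup>\<alpha>\<close>
  (\<open>weighted_energy\<close>) and \<open>E\<^sub>\<phi>(f)\<close> for the integral of \<open>|f'|\<^sup>2\<close> against the counting function
  (\<open>counting_energy\<close>).  The substitution \<open>w = \<phi>(z)\<close>, with multiplicities, turns \<open>E(f \<circ> \<phi>)\<close> into \<open>E\<^sub>\<phi>(f)\<close>,
  and \<open>\<phi>(0) = 0\<close> preserves the value at the origin.  So the composition operator is bounded below on
  the Dirichlet space exactly when \<open>E\<^sub>\<phi>(f) \<ge> c E(f)\<close> for some \<open>c > 0\<close>, and since every Bergman function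
  is some \<open>f'\<close>, this is also the reverse Carleson inequality.

  The tail condition is used through one estimate (\<open>tail_energy_small\<close>): for each \<open>\<epsilon>\<close> there is an \<open>M\<close>
  such that the tail set, where the counting function exceeds \<open>M (1 - |w|\<^sup>2)\<^sup>\<alpha>\<close>, contributes at most
  \<open>\<epsilon> E(f)\<close> to \<open>E\<^sub>\<phi>(f)\<close>.  Off the tail set the counting function is at most \<open>M (1 - |w|\<^sup>2)\<^sup>\<alpha>\<close>, so the
  operator is bounded.  A bounded injective operator between Banach spaces has closed range if and only
  if it is bounded below.  The backward implication is completeness of the Dirichlet space.  For the
  forward one, the images of the balls of radius \<open>n\<close> are closed in the range, by normal families and
  Fatou's lemma, and Baire's theorem gives one of them an interior point.

  The density conditions are tested on \<open>f\<^sub>a = \<phi>\<^sub>a - a\<close>, where \<open>\<phi>\<^sub>a\<close> is the Moebius involution exchanging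
  \<open>0\<close> and \<open>a\<close>: its derivative is of order \<open>1 / (1 - |a|\<^sup>2)\<close> on a pseudohyperbolic disk about \<open>a\<close>, and
  \<open>E(f\<^sub>a)\<close> is comparable to \<open>(1 - |a|\<^sup>2)\<^sup>\<alpha>\<close>.  If \<open>E\<^sub>\<phi>(f\<^sub>a) \<ge> c E(f\<^sub>a)\<close>, then a fixed part of \<open>E\<^sub>\<phi>(f\<^sub>a)\<close> must come
  from a large pseudohyperbolic disk about \<open>a\<close>, because outside it the tail set is negligible and the
  rest is at most \<open>M\<close> times a small part of \<open>E(f\<^sub>a)\<close>; this gives density of the counting measure.
  Density of the counting measure gives density of the range \<open>\<phi>(D)\<close>, because the counting function
  vanishes off the range, is at most \<open>M (1 - |w|\<^sup>2)\<^sup>\<alpha>\<close> off the tail set, and the tail set is negligible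
  in the same scale.

  Finally, density of the range gives \<open>E\<^sub>\<phi>(f) \<ge> c E(f)\<close>.  By Schwarz's lemma \<open>|\<phi>(z)| \<le> |z|\<close>, and since
  \<open>\<alpha> < 0\<close> the counting function is at least \<open>(1 - |w|\<^sup>2)\<^sup>\<alpha>\<close> on the range.  It remains to see that a set
  which fills a fixed part of every pseudohyperbolic disk of some fixed radius carries a fixed part of
  every Bergman norm (Luecking's theorem, \<open>dominating_set_if_hyperbolically_dense\<close>).  Call a point good
  for \<open>g\<close> if the mass of \<open>|g|\<^sup>2\<close> on a slightly larger disk about it is at most a large multiple of the
  mass on the given disk.  At good points a normal family argument shows that the dense set carries a
  fixed part of the local mass (\<open>local_mass_on_dense_subset\<close>).  Averaging over all centres with respect
  to the invariant area shows that the bad points matter for at most half of the norm.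
\<close>

section \<open>Change of variables for injective holomorphic maps\<close>

abbreviation sqnorm :: "complex \<Rightarrow> ennreal"
  where "sqnorm z \<equiv> ennreal ((cmod z)\<^sup>2)"

text \<open>
  The change of variables theorem for real vectors is transported to the complex plane along the
  coordinate isomorphism, which preserves Lebesgue measure because it maps boxes to boxes of the same
  area.
\<close>

lemma lborel_complex_eq_distr:
  "(lborel :: complex measure) = distr lborel borel (\<lambda>v::real^2. Complex (v $ 1) (v $ 2))"
proof (rule lborel_eqI)
  show "sets (distr lborel borel (\<lambda>v::real^2. Complex (v $ 1) (v $ 2))) = sets borel"
    by simp
  fix l u :: complex
  assume lu: "\<And>b. b \<in> Basis \<Longrightarrow> l \<bullet> b \<le> u \<bullet> b"
  then have le: "Re l \<le> Re u" "Im l \<le> Im u"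
    using lu[of 1] lu[of \<i>] by (auto simp: Basis_complex_def)
  have "continuous_on UNIV (\<lambda>v::real^2. Complex (v $ 1) (v $ 2))"
    unfolding Complex_eq by (intro continuous_intros)
  then have meas: "(\<lambda>v::real^2. Complex (v $ 1) (v $ 2)) \<in> borel_measurable lborel"
    by (simp add: borel_measurable_continuous_onI)
  have pre: "(\<lambda>v::real^2. Complex (v $ 1) (v $ 2)) -` box l u = box (vector [Re l, Im l]) (vector [Re u, Im u])"
    by (auto simp: box_def Basis_complex_def Basis_vec_def inner_axis exhaust_2 forall_2 inner_axis)
  have B: "Basis = {axis 1 1 :: real^2, axis 2 1}"
    by (auto simp: Basis_vec_def UNIV_2)
  have ne: "axis 1 1 \<noteq> (axis 2 1 :: real^2)"
    by (simp add: axis_eq_axis)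
  have "emeasure (distr lborel borel (\<lambda>v::real^2. Complex (v $ 1) (v $ 2))) (box l u)
      = emeasure lborel (box (vector [Re l, Im l]) (vector [Re u, Im u] :: real^2))"
    using meas by (simp add: emeasure_distr pre)
  also have "\<dots> = ennreal (\<Prod>b\<in>Basis. (vector [Re u, Im u] - vector [Re l, Im l] :: real^2) \<bullet> b)"
    using le by (intro emeasure_lborel_box) (auto simp: B inner_axis)
  also have "\<dots> = ennreal (\<Prod>b\<in>Basis. (u - l) \<bullet> b)"
    using ne by (simp add: B Basis_complex_def inner_axis complex_eq_iff)
  finally show "emeasure (distr lborel borel (\<lambda>v::real^2. Complex (v $ 1) (v $ 2))) (box l u)
      = (\<Prod>b\<in>Basis. (u - l) \<bullet> b)" .
qed

text \<open>
  The image is the preimage of \<open>B\<close> under the inverse map, which is holomorphic on the open set \<open>f ` S\<close>.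
\<close>

lemma borel_image_holomorphic_inj:
  assumes S: "open S" and f: "f holomorphic_on S" and inj: "inj_on f S"
    and B: "B \<subseteq> S" "B \<in> sets borel"
  shows "f ` B \<in> sets borel"
proof -
  obtain g where g: "g holomorphic_on (f ` S)" and gf: "\<And>z. z \<in> S \<Longrightarrow> g (f z) = z"
    using holomorphic_has_inverse[OF f S inj] by metis
  have op: "open (f ` S)"
    by (rule open_mapping_thm3[OF f S inj])
  have "g \<in> borel_measurable (restrict_space borel (f ` S))"
    using g by (intro borel_measurable_continuous_on_restrict holomorphic_on_imp_continuous_on)
  then have "g -` B \<inter> space (restrict_space borel (f ` S)) \<in> sets (restrict_space borel (f ` S))"
    using B by (rule_tac measurable_sets)
  then have "g -` B \<inter> f ` S \<in> sets borel"
    using op by (simp add: space_restrict_space sets_restrict_space_iff)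
  moreover have "g -` B \<inter> f ` S = f ` B"
    using B gf by auto
  ultimately show ?thesis by simp
qed

text \<open>
  In real coordinates the derivative of \<open>f\<close> is multiplication by \<open>f'(z)\<close>, whose determinant is
  \<open>|f'(z)|\<^sup>2\<close>.  Both sides may be infinite, and finiteness of either one implies finiteness of the other.
\<close>

lemma emeasure_holomorphic_image:
  assumes S: "open S" and f: "f holomorphic_on S" and inj: "inj_on f S"
    and B: "B \<subseteq> S" "B \<in> sets borel"
  shows "emeasure lborel (f ` B) = (\<integral>\<^sup>+z\<in>B. sqnorm (deriv f z) \<partial>lborel)"
proof -
  define T where "T = (\<lambda>v::real^2. Complex (v $ 1) (v $ 2))"
  define T' where "T' = (\<lambda>z. vector [Re z, Im z] :: real^2)"
  have TT': "T (T' z) = z" for z by (simp add: T_def T'_def)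
  have T'T: "T' (T v) = v" for v by (simp add: T_def T'_def vec_eq_iff forall_2)
  have linT: "bounded_linear T"
    by (rule linear_conv_bounded_linear[THEN iffD1], rule linearI) (auto simp: T_def complex_eq_iff)
  have linT': "bounded_linear T'"
    by (rule linear_conv_bounded_linear[THEN iffD1], rule linearI)
       (auto simp: T'_def vec_eq_iff forall_2)
  have contT: "continuous_on UNIV T"
    by (rule bounded_linear.continuous_on[OF linT continuous_on_id])
  have measT[measurable]: "T \<in> borel_measurable borel"
    using contT by (simp add: borel_measurable_continuous_onI)
  have lb: "(lborel :: complex measure) = distr lborel borel T"
    unfolding T_def by (rule lborel_complex_eq_distr)
  define B' where "B' = T -` B"
  define g where "g = (\<lambda>v. T' (f (T v)))"
  have B'[measurable]: "B' \<in> sets borel"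
    unfolding B'_def using measurable_sets[OF measT, of B] B by simp
  have fB[measurable]: "f ` B \<in> sets borel"
    by (rule borel_image_holomorphic_inj[OF assms])
  have gB: "g ` B' = T -` (f ` B)"
  proof (intro equalityI subsetI)
    fix v assume "v \<in> T -` (f ` B)"
    then obtain z where "z \<in> B" "T v = f z" by auto
    then have "v = g (T' z)" "T' z \<in> B'"
      by (auto simp: g_def B'_def TT' simp flip: \<open>T v = f z\<close> simp: T'T)
    then show "v \<in> g ` B'" by blast
  qed (auto simp: g_def B'_def TT')
  have gB_borel[measurable]: "g ` B' \<in> sets borel"
    unfolding gB using measurable_sets[OF measT fB] by simp
  define g' where "g' = (\<lambda>v h. T' (deriv f (T v) * T h))"
  have der: "(g has_derivative g' v) (at v within B')" if "v \<in> B'" for v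
  proof -
    have "T v \<in> S" using that B by (auto simp: B'_def)
    then have "(f has_derivative (\<lambda>h. deriv f (T v) * h)) (at (T v))"
      using holomorphic_derivI[OF f S] by (simp add: has_field_derivative_def)
    moreover have "(T has_derivative T) (at v)"
      by (rule bounded_linear_imp_has_derivative[OF linT])
    ultimately have "(f \<circ> T has_derivative (\<lambda>h. deriv f (T v) * h) \<circ> T) (at v)"
      by (rule diff_chain_at[rotated])
    then have "(T' \<circ> (f \<circ> T) has_derivative T' \<circ> ((\<lambda>h. deriv f (T v) * h) \<circ> T)) (at v)"
      by (rule diff_chain_at) (rule bounded_linear_imp_has_derivative[OF linT'])
    then show ?thesis
      unfolding g_def g'_def o_def by (rule has_derivative_at_withinI)
  qed
  have det: "\<bar>det (matrix (g' v))\<bar> = (cmod (deriv f (T v)))\<^sup>2" for v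
  proof -
    have "det (matrix (g' v)) = (cmod (deriv f (T v)))\<^sup>2"
      by (simp add: det_2 matrix_def g'_def T'_def T_def axis_def cmod_power2 flip: power2_eq_square)
    then show ?thesis by simp
  qed
  have injg: "inj_on g B'"
  proof (rule inj_onI)
    fix v w assume "v \<in> B'" "w \<in> B'" "g v = g w"
    then have "f (T v) = f (T w)" using TT' unfolding g_def by metis
    with \<open>v \<in> B'\<close> \<open>w \<in> B'\<close> inj B have "T v = T w"
      unfolding B'_def inj_on_def by blast
    then show "v = w" using T'T by metis
  qed
  have B'leb: "B' \<in> sets lebesgue"
    using B' by simp
  note key = has_measure_differentiable_image[OF B'leb der injg, unfolded det]
  have "deriv f \<in> borel_measurable (restrict_space borel B)"
    using f S B
    by (intro borel_measurable_continuous_on_restrict holomorphic_on_imp_continuous_on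
        holomorphic_on_subset[OF holomorphic_deriv])
  then have "(\<lambda>z. if z \<in> B then deriv f z else 0) \<in> borel_measurable borel"
    using B by (subst measurable_restrict_space_iff[symmetric]) auto
  then have m0: "(\<lambda>z. (cmod (if z \<in> B then deriv f z else 0))\<^sup>2) \<in> borel_measurable borel"
    by measurable
  define h where "h = (\<lambda>z. indicator B z * (cmod (deriv f z))\<^sup>2)"
  have h_eq: "h = (\<lambda>z. (cmod (if z \<in> B then deriv f z else 0))\<^sup>2)"
    by (auto simp: h_def fun_eq_iff)
  have h_meas[measurable]: "h \<in> borel_measurable borel"
    unfolding h_eq by (rule m0)
  have RHS: "(\<integral>\<^sup>+z\<in>B. sqnorm (deriv f z) \<partial>lborel) = (\<integral>\<^sup>+v. ennreal (h (T v)) \<partial>lborel)"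
  proof -
    have "(\<integral>\<^sup>+z\<in>B. sqnorm (deriv f z) \<partial>lborel) = (\<integral>\<^sup>+z. ennreal (h z) \<partial>lborel)"
      by (intro nn_integral_cong) (auto simp: h_def indicator_def)
    also have "\<dots> = (\<integral>\<^sup>+v. ennreal (h (T v)) \<partial>lborel)"
      by (subst lb) (simp add: nn_integral_distr)
    finally show ?thesis .
  qed
  have hT: "h (T v) = indicator B' v * (cmod (deriv f (T v)))\<^sup>2" for v
    by (auto simp: h_def B'_def indicator_def)
  have LHS: "emeasure lborel (f ` B) = emeasure lborel (g ` B')"
    by (subst lb) (simp add: emeasure_distr gB)
  \<comment> \<open>The theorem for real vectors equates a finite measure with a convergent integral; the infinite case follows by contraposition.\<close>
  show ?thesis
  proof (cases "emeasure lborel (g ` B') < \<infinity>")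
    case True
    then have "g ` B' \<in> lmeasurable"
      by (intro fmeasurableI) auto
    then have "((\<lambda>v. (cmod (deriv f (T v)))\<^sup>2) has_integral measure lebesgue (g ` B')) B'"
      using key by blast
    from nn_integral_has_integral_lebesgue[OF _ this]
    have "(\<integral>\<^sup>+v. ennreal (h (T v)) \<partial>lborel) = ennreal (measure lebesgue (g ` B'))"
      unfolding hT by simp
    also have "\<dots> = emeasure lborel (g ` B')"
      using True by (simp add: emeasure_eq_ennreal_measure less_top)
    finally show ?thesis using LHS RHS by simp
  next
    case False
    have "(\<integral>\<^sup>+v. ennreal (h (T v)) \<partial>lborel) = \<infinity>"
    proof (rule ccontr)
      assume "(\<integral>\<^sup>+v. ennreal (h (T v)) \<partial>lborel) \<noteq> \<infinity>"
      then obtain r where r: "0 \<le> r" "(\<integral>\<^sup>+v. ennreal (h (T v)) \<partial>lborel) = ennreal r"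
        by (cases "(\<integral>\<^sup>+v. ennreal (h (T v)) \<partial>lborel)") auto
      have "((\<lambda>v. h (T v)) has_integral r) UNIV"
        by (rule nn_integral_has_integral[OF _ _ r(2,1)]) (measurable, simp add: h_def)
      then have "((\<lambda>v. if v \<in> B' then (cmod (deriv f (T v)))\<^sup>2 else 0) has_integral r) UNIV"
        by (rule has_integral_eq[rotated]) (simp add: hT)
      then have "((\<lambda>v. (cmod (deriv f (T v)))\<^sup>2) has_integral r) B'"
        by (simp add: has_integral_restrict_UNIV)
      then have "g ` B' \<in> lmeasurable" using key by blast
      then have "emeasure lebesgue (g ` B') < \<infinity>" by (simp add: fmeasurable_def)
      then show False using False by simp
    qed
    moreover have "emeasure lborel (g ` B') = \<infinity>"
      using False by (auto simp: less_top[symmetric])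
    ultimately show ?thesis using LHS RHS by simp
  qed
qed

lemma nn_integral_holomorphic_image:
  assumes S: "open S" and f: "f holomorphic_on S" and inj: "inj_on f S"
    and B: "B \<subseteq> S" "B \<in> sets borel" and F: "F \<in> borel_measurable borel"
  shows "(\<integral>\<^sup>+w\<in>f ` B. F w \<partial>lborel)
    = (\<integral>\<^sup>+z\<in>B. F (f z) * sqnorm (deriv f z) \<partial>lborel)"
proof -
  note fB = borel_image_holomorphic_inj[OF S f inj B]
  have meas: "(\<lambda>z. if z \<in> B then deriv f z else 0) \<in> borel_measurable borel"
    "(\<lambda>z. if z \<in> B then f z else 0) \<in> borel_measurable borel"
    using f S B
    by (auto intro!: measurable_restrict_space_iff[THEN iffD1]
        borel_measurable_continuous_on_restrict holomorphic_on_imp_continuous_on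
        holomorphic_on_subset[OF holomorphic_deriv] holomorphic_on_subset[OF f])
  define f0 where "f0 = (\<lambda>z. if z \<in> B then f z else 0)"
  define d0 where "d0 = (\<lambda>z. if z \<in> B then deriv f z else 0)"
  have [measurable]: "f0 \<in> borel_measurable borel" "d0 \<in> borel_measurable borel" "B \<in> sets borel"
    "F \<in> borel_measurable borel" "f ` B \<in> sets borel"
    using meas B F fB by (auto simp: f0_def d0_def)
  define \<nu> where "\<nu> = distr (density lborel (\<lambda>z. sqnorm (d0 z))) borel f0"
  have "density lborel (indicator (f ` B)) = density \<nu> (indicator (f ` B))"
  proof (rule measure_eqI)
    fix A assume "A \<in> sets (density lborel (indicator (f ` B)) :: complex measure)"
    then have A[measurable]: "A \<in> sets borel" by simp
    have AB: "f0 -` A \<inter> B \<in> sets borel" "f0 -` A \<inter> B \<subseteq> S"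
      using B measurable_sets[of f0 borel borel A] by auto
    have "emeasure (density lborel (indicator (f ` B))) A = emeasure lborel (f ` B \<inter> A)"
      by (simp add: emeasure_density flip: indicator_inter_arith)
    also have "f ` B \<inter> A = f ` (f0 -` A \<inter> B)"
      by (auto simp: f0_def)
    also have "emeasure lborel \<dots> = (\<integral>\<^sup>+z\<in>f0 -` A \<inter> B. sqnorm (deriv f z) \<partial>lborel)"
      by (rule emeasure_holomorphic_image[OF S f inj AB(2,1)])
    also have "\<dots> = (\<integral>\<^sup>+z. sqnorm (d0 z) * indicator (f ` B) (f0 z) * indicator A (f0 z) \<partial>lborel)"
      by (intro nn_integral_cong) (auto simp: d0_def f0_def indicator_def)
    also have "\<dots> = emeasure (density \<nu> (indicator (f ` B))) A"
      by (simp add: emeasure_density \<nu>_def nn_integral_distr nn_integral_density mult_ac)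
    finally show "emeasure (density lborel (indicator (f ` B))) A
        = emeasure (density \<nu> (indicator (f ` B))) A" .
  qed (simp add: \<nu>_def)
  then have "(\<integral>\<^sup>+w. F w \<partial>density lborel (indicator (f ` B))) = (\<integral>\<^sup>+w. F w \<partial>density \<nu> (indicator (f ` B)))"
    by simp
  then have "(\<integral>\<^sup>+w. indicator (f ` B) w * F w \<partial>lborel)
      = (\<integral>\<^sup>+z. sqnorm (d0 z) * (indicator (f ` B) (f0 z) * F (f0 z)) \<partial>lborel)"
    by (simp add: nn_integral_density \<nu>_def nn_integral_distr)
  also have "\<dots> = (\<integral>\<^sup>+z\<in>B. F (f z) * sqnorm (deriv f z) \<partial>lborel)"
    by (intro nn_integral_cong) (auto simp: d0_def f0_def indicator_def mult_ac)
  finally show ?thesis by (simp add: mult.commute)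
qed

section \<open>The area formula with multiplicities\<close>

lemma zorder_minus_value_eq_1:
  assumes "open S" "f holomorphic_on S" "z \<in> S" "f z = w" "deriv f z \<noteq> 0"
  shows "zorder (\<lambda>u. f u - w) z = 1"
proof (rule zorder_zero_eqI'[where n = 1])
  show "(\<lambda>u. f u - w) analytic_on {z}"
    using assms by (intro analytic_intros) (auto simp: analytic_at)
  have "f field_differentiable at z"
    using assms holomorphic_on_imp_differentiable_at by blast
  then show "(deriv ^^ nat 1) (\<lambda>u. f u - w) z \<noteq> 0"
    using assms by simp
qed (use assms in auto)

lemma suminf_eq_infsum_ennreal: "(\<Sum>n. f n) = infsum f (UNIV :: nat set)" for f :: "nat \<Rightarrow> ennreal"
proof -
  have "(f has_sum infsum f UNIV) UNIV"
    by (intro has_sum_infsum nonneg_summable_on_complete) simp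
  then show ?thesis
    using has_sum_imp_sums sums_unique by metis
qed

text \<open>
  With the weight \<open>(1 - |z|\<^sup>2)\<^sup>\<alpha>\<close> on the unit disk this is the counting function.
\<close>

definition preimage_sum :: "complex set \<Rightarrow> (complex \<Rightarrow> complex) \<Rightarrow> (complex \<Rightarrow> real) \<Rightarrow> complex \<Rightarrow> ennreal"
  where "preimage_sum S f \<omega> w =
    (\<Sum>\<^sub>\<infinity>z\<in>{z \<in> S. f z = w}. ennreal (of_int (zorder (\<lambda>u. f u - w) z) * \<omega> z))"

lemma countable_zeros_holomorphic:
  assumes "open S" "connected S" "f holomorphic_on S" "w \<in> S" "f w \<noteq> 0"
  shows "countable {z \<in> S. f z = 0}"
proof -
  obtain C where C: "\<And>n::nat. compact (C n)" "\<Union>(range C) = S"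
    using open_Union_compact_subsets[OF assms(1)] by metis
  then have "fsigma S"
    using fsigma.intros[of C] compact_imp_closed by metis
  show ?thesis
  proof (cases "f constant_on S")
    case True
    with assms have "{z \<in> S. f z = 0} = {}"
      by (force simp: constant_on_def)
    then show ?thesis by (metis countable_empty)
  next
    case False
    then show ?thesis
      using assms \<open>fsigma S\<close> by (intro holomorphic_countable_zeros)
  qed
qed

lemma countable_critical_points:
  assumes "open S" "connected S" "f holomorphic_on S" "\<not> f constant_on S"
  shows "countable {z \<in> S. deriv f z = 0}"
proof -
  have "\<exists>z\<in>S. deriv f z \<noteq> 0"
  proof (rule ccontr)
    assume "\<not> ?thesis"
    then have "f constant_on S"
      using assms by (intro has_field_derivative_0_imp_constant_on[of S f])
        (metis holomorphic_derivI)+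
    with assms show False by simp
  qed
  then show ?thesis
    using countable_zeros_holomorphic[OF assms(1,2) holomorphic_deriv[OF assms(3,1)]] by blast
qed

text \<open>
  Off the countable set \<open>Z\<close> of critical points the map is locally injective, so \<open>S - Z\<close> is a countable
  disjoint union of Borel sets \<open>V n\<close> on each of which \<open>f\<close> is injective.  The change of variables applies
  to each piece, and for a value that is not critical the contributions of the pieces are exactly the
  terms of the sum over the preimages, all of multiplicity one.  Critical values are countable, so they
  affect neither the integral nor Borel measurability.
\<close>

lemma
  fixes F :: "complex \<Rightarrow> ennreal"
  assumes S: "open S" "connected S" and f: "f holomorphic_on S" and nc: "\<not> f constant_on S"
    and \<omega>: "continuous_on S \<omega>" "\<And>z. z \<in> S \<Longrightarrow> 0 \<le> \<omega> z"
  shows borel_measurable_preimage_sum: "preimage_sum S f \<omega> \<in> borel_measurable borel" (is ?meas)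
    and nn_integral_area_formula: "F \<in> borel_measurable borel \<Longrightarrow>
      (\<integral>\<^sup>+z\<in>S. F (f z) * ennreal (\<omega> z) * sqnorm (deriv f z) \<partial>lborel)
      = (\<integral>\<^sup>+w. F w * preimage_sum S f \<omega> w \<partial>lborel)" (is "PROP ?area")
proof -
  define Z where "Z = {z \<in> S. deriv f z = 0}"
  have cZ: "countable Z" and cfZ: "countable (f ` Z)"
    using countable_critical_points[OF S f nc] by (auto simp: Z_def)
  \<comment> \<open>The empty set belongs to this family, so that the countable subfamily below can be enumerated even if it is empty.\<close>
  define \<U> where "\<U> = {U. open U \<and> U \<subseteq> S \<and> inj_on f U \<and> (\<forall>z\<in>U. deriv f z \<noteq> 0)}"
  have op: "open {z \<in> S. deriv f z \<noteq> 0}"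
  proof -
    have "open (S \<inter> deriv f -` (- {0}))"
      using f S by (intro continuous_open_preimage holomorphic_on_imp_continuous_on holomorphic_deriv) auto
    moreover have "S \<inter> deriv f -` (- {0}) = {z \<in> S. deriv f z \<noteq> 0}" by auto
    ultimately show ?thesis by simp
  qed
  have cover: "\<Union>\<U> = S - Z"
  proof (intro equalityI subsetI)
    fix z assume z: "z \<in> S - Z"
    then obtain r where r: "r > 0" "ball z r \<subseteq> S" "inj_on f (ball z r)"
      using has_complex_derivative_locally_injective[OF f _ S(1), of z] by (auto simp: Z_def)
    have "ball z r \<inter> {z \<in> S. deriv f z \<noteq> 0} \<in> \<U>"
      using r op by (auto simp: \<U>_def inj_on_def)
    moreover have "z \<in> ball z r \<inter> {z \<in> S. deriv f z \<noteq> 0}"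
      using z r by (auto simp: Z_def)
    ultimately show "z \<in> \<Union>\<U>" by blast
  qed (auto simp: \<U>_def Z_def)
  obtain \<V> where \<V>: "\<V> \<subseteq> \<U>" "countable \<V>" "\<Union>\<V> = \<Union>\<U>"
    using Lindelof[of \<U>] unfolding \<U>_def by blast
  define U where "U = from_nat_into (insert {} \<V>)"
  have rU: "range U = insert {} \<V>"
    using \<V> by (simp add: U_def range_from_nat_into)
  have UU: "U n \<in> \<U>" for n
  proof -
    have "U n \<in> insert {} \<V>" unfolding rU[symmetric] by (rule rangeI)
    moreover have "insert {} \<V> \<subseteq> \<U>"
      using \<V>(1) by (simp add: \<U>_def)
    ultimately show ?thesis by (rule subsetD[rotated])
  qed
  have U: "open (U n)" "U n \<subseteq> S" "inj_on f (U n)" for n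
    using UU[of n] unfolding \<U>_def by blast+
  have Unz: "deriv f z \<noteq> 0" if "z \<in> U n" for z n
    using UU[of n] that unfolding \<U>_def by blast
  have UN: "(\<Union>n. U n) = S - Z"
    unfolding rU using \<V>(3) cover by simp
  define V where "V = disjointed U"
  have VU: "V n \<subseteq> U n" for n
    unfolding V_def by (rule disjointed_subset)
  have VN: "(\<Union>n. V n) = S - Z"
    unfolding V_def using UN UN_disjointed_eq[of U] by simp
  have dV: "disjoint_family V"
    unfolding V_def by (rule disjoint_family_disjointed)
  have VB[measurable]: "V n \<in> sets borel" for n
    unfolding V_def disjointed_def using U(1) by (intro sets.Diff sets.finite_UN) auto
  have fU: "f holomorphic_on U n" for n
    using f U holomorphic_on_subset by blast
  define h where "h = (\<lambda>n. inv_into (U n) f)"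
  have hf: "h n (f z) = z" if "z \<in> U n" for n z
    unfolding h_def using U(3) that by simp
  have opf: "open (f ` U n)" for n
    by (rule open_mapping_thm3[OF fU U(1,3)])
  have conth: "continuous_on (f ` U n) (\<lambda>y. \<omega> (h n y))" for n
  proof -
    obtain g where g: "g holomorphic_on (f ` U n)" "\<And>z. z \<in> U n \<Longrightarrow> g (f z) = z"
      using holomorphic_has_inverse[OF fU U(1,3)] by metis
    have "continuous_on (f ` U n) (h n)"
      by (rule continuous_on_eq[OF holomorphic_on_imp_continuous_on[OF g(1)]]) (use g hf in auto)
    moreover have "h n ` f ` U n \<subseteq> S"
      using U(2)[of n] by (auto simp: image_subset_iff hf)
    ultimately show ?thesis
      using continuous_on_compose2[OF \<omega>(1)] by blast
  qed
  define g where "g = (\<lambda>n y. if y \<in> f ` U n then ennreal (\<omega> (h n y)) else 0)"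
  have g[measurable]: "g n \<in> borel_measurable borel" for n
  proof -
    have "(\<lambda>y. ennreal (\<omega> (h n y))) \<in> borel_measurable (restrict_space borel (f ` U n))"
      by (intro measurable_compose[OF borel_measurable_continuous_on_restrict[OF conth]]) simp
    then show ?thesis
      unfolding g_def using opf by (subst measurable_restrict_space_iff[symmetric]) auto
  qed
  have fVB[measurable]: "f ` V n \<in> sets borel" for n
    by (rule borel_image_holomorphic_inj[OF U(1) fU U(3) VU VB])
  define t where "t = (\<lambda>n y. g n y * indicator (f ` V n) y)"
  have t[measurable]: "t n \<in> borel_measurable borel" for n
    unfolding t_def by measurable
  have sum_eq: "preimage_sum S f \<omega> y = (\<Sum>n. t n y)" if y: "y \<notin> f ` Z" for y
  proof -
    let ?A = "{z \<in> S. f z = y}"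
    have ex: "\<exists>n. z \<in> V n" if "z \<in> ?A" for z
      using VN y that by blast
    define i where "i = (\<lambda>z. SOME n. z \<in> V n)"
    have i: "z \<in> V (i z)" if "z \<in> ?A" for z
      unfolding i_def using ex[OF that] by (rule someI_ex)
    have inji: "inj_on i ?A"
    proof (rule inj_onI)
      fix z w assume zw: "z \<in> ?A" "w \<in> ?A" "i z = i w"
      then have "z \<in> U (i z)" "w \<in> U (i z)" using i[of z] i[of w] VU by auto
      then show "z = w" using U(3)[of "i z"] zw by (auto dest: inj_onD)
    qed
    have val: "t (i z) y = ennreal (of_int (zorder (\<lambda>u. f u - y) z) * \<omega> z)" if z: "z \<in> ?A" for z
    proof -
      have "z \<in> U (i z)" using i[OF z] VU by auto
      then have "deriv f z \<noteq> 0" using Unz by blast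
      then have "zorder (\<lambda>u. f u - y) z = 1"
        using zorder_minus_value_eq_1[OF S(1) f] z by blast
      moreover have "h (i z) y = z" "y \<in> f ` U (i z)" "y \<in> f ` V (i z)"
        using hf[OF \<open>z \<in> U (i z)\<close>] z \<open>z \<in> U (i z)\<close> i[OF z] by auto
      ultimately show ?thesis by (simp add: t_def g_def)
    qed
    have zero: "t n y = 0" if "n \<notin> i ` ?A" for n
    proof (rule ccontr)
      assume "t n y \<noteq> 0"
      then have "y \<in> f ` V n" by (auto simp: t_def indicator_def)
      then obtain z where z: "z \<in> V n" "y = f z" by auto
      then have "z \<in> ?A" using VU U by blast
      then have "i z = n" using i[of z] z dV by (auto simp: disjoint_family_on_def)
      with that \<open>z \<in> ?A\<close> show False by blast
    qed
    have "preimage_sum S f \<omega> y = infsum (\<lambda>z. t (i z) y) ?A"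
      unfolding preimage_sum_def by (intro infsum_cong) (simp add: val)
    also have "\<dots> = infsum (\<lambda>n. t n y) (i ` ?A)"
      using infsum_reindex[OF inji, of "\<lambda>n. t n y"] by (simp add: o_def)
    also have "\<dots> = infsum (\<lambda>n. t n y) UNIV"
      by (rule infsum_cong_neutral) (use zero in auto)
    finally show ?thesis by (simp add: suminf_eq_infsum_ennreal)
  qed
  have sumt[measurable]: "(\<lambda>y. \<Sum>n. t n y) \<in> borel_measurable borel"
    by measurable
  show meas: ?meas
    by (rule measurable_discrete_difference[OF sumt cfZ]) (auto simp: sum_eq)
  show "PROP ?area"
  proof -
    assume F[measurable]: "F \<in> borel_measurable borel"
    define w where "w = (\<lambda>z. if z \<in> S then F (f z) * ennreal (\<omega> z) * sqnorm (deriv f z) else 0)"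
    have piece: "(\<integral>\<^sup>+z\<in>V n. w z \<partial>lborel) = (\<integral>\<^sup>+y. F y * t n y \<partial>lborel)" for n
    proof -
      have "(\<integral>\<^sup>+z\<in>V n. w z \<partial>lborel)
          = (\<integral>\<^sup>+z\<in>V n. (F (f z) * g n (f z)) * sqnorm (deriv f z) \<partial>lborel)"
      proof (intro nn_integral_cong)
        fix z
        have "z \<in> S" "f z \<in> f ` U n" "h n (f z) = z" if "z \<in> V n"
          using that VU U hf by blast+
        then show "w z * indicator (V n) z
            = (F (f z) * g n (f z)) * sqnorm (deriv f z) * indicator (V n) z"
          by (cases "z \<in> V n") (auto simp: w_def g_def)
      qed
      also have "\<dots> = (\<integral>\<^sup>+y\<in>f ` V n. (F y * g n y) \<partial>lborel)"
        by (rule nn_integral_holomorphic_image[OF U(1) fU U(3) VU VB, symmetric]) measurable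
      finally show ?thesis by (simp add: t_def mult.assoc)
    qed
    have cont: "continuous_on S (deriv f)" "continuous_on S f"
      using f S by (auto intro!: holomorphic_on_imp_continuous_on holomorphic_deriv)
    have mS: "(\<lambda>z. F (f z) * ennreal (\<omega> z) * sqnorm (deriv f z))
        \<in> borel_measurable (restrict_space borel S)"
      using borel_measurable_continuous_on_restrict[OF cont(1)]
        borel_measurable_continuous_on_restrict[OF cont(2)]
        borel_measurable_continuous_on_restrict[OF \<omega>(1)]
      by measurable
    have wm[measurable]: "w \<in> borel_measurable borel"
      unfolding w_def using mS S(1) by (subst measurable_restrict_space_iff[symmetric]) auto
    have "(\<integral>\<^sup>+z\<in>S. F (f z) * ennreal (\<omega> z) * sqnorm (deriv f z) \<partial>lborel)
        = (\<integral>\<^sup>+z. w z \<partial>lborel)"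
      by (intro nn_integral_cong) (simp add: w_def)
    also have "\<dots> = (\<integral>\<^sup>+z. (\<Sum>n. w z * indicator (V n) z) \<partial>lborel)"
    proof (rule nn_integral_cong_AE)
      have "AE z in lborel. z \<notin> Z"
        using cZ countable_imp_null_set_lborel AE_not_in by blast
      then show "AE z in lborel. w z = (\<Sum>n. w z * indicator (V n) z)"
      proof eventually_elim
        case (elim z)
        have "(\<Sum>n. w z * indicator (V n) z) = w z * indicator (S - Z) z"
          using suminf_indicator[OF dV, of z] by (simp add: VN)
        with elim show ?case by (auto simp: w_def)
      qed
    qed
    also have "\<dots> = (\<Sum>n. \<integral>\<^sup>+z\<in>V n. w z \<partial>lborel)"
      by (rule nn_integral_suminf) measurable
    also have "\<dots> = (\<Sum>n. \<integral>\<^sup>+y. F y * t n y \<partial>lborel)"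
      by (simp add: piece)
    also have "\<dots> = (\<integral>\<^sup>+y. (\<Sum>n. F y * t n y) \<partial>lborel)"
      by (rule nn_integral_suminf[symmetric]) measurable
    also have "\<dots> = (\<integral>\<^sup>+y. F y * preimage_sum S f \<omega> y \<partial>lborel)"
    proof (rule nn_integral_cong_AE)
      have "AE y in lborel. y \<notin> f ` Z"
        using cfZ countable_imp_null_set_lborel AE_not_in by blast
      then show "AE y in lborel. (\<Sum>n. F y * t n y) = F y * preimage_sum S f \<omega> y"
        by eventually_elim (simp add: sum_eq)
    qed
    finally show ?thesis .
  qed
qed

section \<open>Moebius involutions and pseudohyperbolic disks\<close>

text \<open>
  The Moebius involution of the disk that exchanges \<open>0\<close> and \<open>a\<close>.
\<close>

definition disk_swap :: "complex \<Rightarrow> complex \<Rightarrow> complex"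
  where "disk_swap a u = (a - u) / (1 - cnj a * u)"

lemma cmod_sq_lt_1: "u \<in> \<bbbD> \<Longrightarrow> (cmod u)\<^sup>2 < 1"
  by (simp add: abs_square_less_1)

lemma cmod_disk_swap_commute: "cmod (disk_swap a w) = cmod (disk_swap w a)"
proof -
  have "cmod (1 - cnj a * w) = cmod (1 - cnj w * a)"
    using complex_mod_cnj[of "1 - cnj a * w"] by (simp add: mult.commute)
  then show ?thesis by (simp add: disk_swap_def norm_divide norm_minus_commute)
qed

context
  fixes a :: complex
  assumes a: "a \<in> \<bbbD>"
begin

lemma disk_swap_denom_bounds:
  assumes "u \<in> \<bbbD>"
  shows "1 - cmod u \<le> cmod (1 - cnj a * u)" "cmod (1 - cnj a * u) \<le> 2"
proof -
  have *: "cmod (cnj a * u) \<le> 1 * cmod u"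
    unfolding norm_mult using a by (intro mult_right_mono) auto
  show "1 - cmod u \<le> cmod (1 - cnj a * u)"
    using * norm_triangle_ineq2[of 1 "cnj a * u"] by simp
  show "cmod (1 - cnj a * u) \<le> 2"
    using * assms norm_triangle_ineq4[of 1 "cnj a * u"] by simp
qed

lemma disk_swap_denom_nz: "u \<in> \<bbbD> \<Longrightarrow> 1 - cnj a * u \<noteq> 0"
  using disk_swap_denom_bounds(1)[of u] by auto

lemma one_minus_disk_swap_sq:
  assumes u: "u \<in> \<bbbD>"
  shows "1 - (cmod (disk_swap a u))\<^sup>2
    = (1 - (cmod a)\<^sup>2) * ((1 - (cmod u)\<^sup>2) / (cmod (1 - cnj a * u))\<^sup>2)"
proof -
  have "(cmod (1 - cnj a * u))\<^sup>2 - (cmod (a - u))\<^sup>2 = (1 - (cmod a)\<^sup>2) * (1 - (cmod u)\<^sup>2)"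
    unfolding cmod_power2 by (simp add: power2_eq_square algebra_simps)
  then show ?thesis
    using disk_swap_denom_nz[OF u]
    by (simp add: disk_swap_def norm_divide power_divide field_simps)
qed

lemma disk_swap_in_disk: "u \<in> \<bbbD> \<Longrightarrow> disk_swap a u \<in> \<bbbD>"
proof -
  assume u: "u \<in> \<bbbD>"
  have "0 < (1 - (cmod a)\<^sup>2) * ((1 - (cmod u)\<^sup>2) / (cmod (1 - cnj a * u))\<^sup>2)"
    using cmod_sq_lt_1[OF a] cmod_sq_lt_1[OF u] disk_swap_denom_nz[OF u] by simp
  then show ?thesis
    using one_minus_disk_swap_sq[OF u] abs_square_less_1[of "cmod (disk_swap a u)"] by simp
qed

text \<open>
  This makes the derivative at the image point the reciprocal of the derivative at \<open>u\<close>, as it must be for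
  an involution.
\<close>

lemma one_minus_cnj_disk_swap:
  assumes u: "u \<in> \<bbbD>"
  shows "1 - cnj a * disk_swap a u = of_real (1 - (cmod a)\<^sup>2) / (1 - cnj a * u)"
proof -
  have "1 - cnj a * disk_swap a u = (1 - cnj a * u - cnj a * (a - u)) / (1 - cnj a * u)"
    using disk_swap_denom_nz[OF u] by (simp add: disk_swap_def field_simps)
  also have "1 - cnj a * u - cnj a * (a - u) = of_real (1 - (cmod a)\<^sup>2)"
    using complex_norm_square[of a] by (simp add: algebra_simps)
  finally show ?thesis .
qed

lemma disk_swap_involution [simp]:
  assumes u: "u \<in> \<bbbD>"
  shows "disk_swap a (disk_swap a u) = u"
proof -
  have nz: "1 - (cmod a)\<^sup>2 \<noteq> 0" using cmod_sq_lt_1[OF a] by simp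
  have "a - disk_swap a u = (u * of_real (1 - (cmod a)\<^sup>2)) / (1 - cnj a * u)"
    using disk_swap_denom_nz[OF u] complex_norm_square[of a]
    by (simp add: disk_swap_def field_simps)
  then show ?thesis
    unfolding disk_swap_def[of a "disk_swap a u"] one_minus_cnj_disk_swap[OF u]
    using disk_swap_denom_nz[OF u] nz by (simp del: of_real_diff of_real_power)
qed

lemma inj_on_disk_swap: "inj_on (disk_swap a) \<bbbD>"
  by (rule inj_on_inverseI[of _ "disk_swap a"]) simp

lemma DERIV_disk_swap:
  assumes u: "u \<in> \<bbbD>"
  shows "(disk_swap a has_field_derivative - of_real (1 - (cmod a)\<^sup>2) / (1 - cnj a * u)\<^sup>2) (at u)"
  unfolding disk_swap_def[abs_def]
  using disk_swap_denom_nz[OF u] complex_norm_square[of a]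
  by (auto intro!: derivative_eq_intros simp: power2_eq_square algebra_simps)

lemma holomorphic_disk_swap: "disk_swap a holomorphic_on \<bbbD>"
  unfolding holomorphic_on_def field_differentiable_def
  using DERIV_disk_swap has_field_derivative_at_within by blast

lemma cmod_deriv_disk_swap:
  assumes u: "u \<in> \<bbbD>"
  shows "cmod (deriv (disk_swap a) u) = (1 - (cmod a)\<^sup>2) / (cmod (1 - cnj a * u))\<^sup>2"
  using cmod_sq_lt_1[OF a] unfolding DERIV_imp_deriv[OF DERIV_disk_swap[OF u]]
  by (simp add: norm_divide norm_power del: of_real_diff)

lemma cmod_deriv_disk_swap_at_image:
  assumes u: "u \<in> \<bbbD>"
  shows "cmod (deriv (disk_swap a) (disk_swap a u)) = (cmod (1 - cnj a * u))\<^sup>2 / (1 - (cmod a)\<^sup>2)"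
  using cmod_sq_lt_1[OF a] unfolding cmod_deriv_disk_swap[OF disk_swap_in_disk[OF u]]
    one_minus_cnj_disk_swap[OF u]
  by (simp add: norm_divide power_divide power2_eq_square del: of_real_diff)

lemma disk_swap_deriv_bounds:
  assumes u: "u \<in> \<bbbD>" "cmod u \<le> \<rho>" and \<rho>: "\<rho> < 1"
  shows "(1 - (cmod a)\<^sup>2) / 4 \<le> cmod (deriv (disk_swap a) u)"
    and "cmod (deriv (disk_swap a) u) \<le> (1 - (cmod a)\<^sup>2) / (1 - \<rho>)\<^sup>2"
    and "(1 - \<rho>)\<^sup>2 / (1 - (cmod a)\<^sup>2) \<le> cmod (deriv (disk_swap a) (disk_swap a u))"
    and "cmod (deriv (disk_swap a) (disk_swap a u)) \<le> 4 / (1 - (cmod a)\<^sup>2)"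
proof -
  have le: "(1 - \<rho>)\<^sup>2 \<le> (cmod (1 - cnj a * u))\<^sup>2" "(cmod (1 - cnj a * u))\<^sup>2 \<le> 4"
    using disk_swap_denom_bounds[OF u(1)] u(2) \<rho> power_mono[of "cmod (1 - cnj a * u)" 2 2]
    by (auto intro!: power_mono)
  have pos: "0 < (1 - \<rho>)\<^sup>2" "0 < (cmod (1 - cnj a * u))\<^sup>2" "0 < 1 - (cmod a)\<^sup>2"
    using \<rho> disk_swap_denom_nz[OF u(1)] cmod_sq_lt_1[OF a] by auto
  show "(1 - (cmod a)\<^sup>2) / 4 \<le> cmod (deriv (disk_swap a) u)"
    "cmod (deriv (disk_swap a) u) \<le> (1 - (cmod a)\<^sup>2) / (1 - \<rho>)\<^sup>2"
    unfolding cmod_deriv_disk_swap[OF u(1)] using le pos by (simp_all only: divide_left_mono mult_pos_pos zero_less_numeral less_imp_le)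
  show "(1 - \<rho>)\<^sup>2 / (1 - (cmod a)\<^sup>2) \<le> cmod (deriv (disk_swap a) (disk_swap a u))"
    "cmod (deriv (disk_swap a) (disk_swap a u)) \<le> 4 / (1 - (cmod a)\<^sup>2)"
    unfolding cmod_deriv_disk_swap_at_image[OF u(1)] using le pos
    by (simp_all only: divide_right_mono less_imp_le)
qed

end

lemma tanh_artanh:
  fixes x :: real
  assumes "0 \<le> x" "x < 1"
  shows "tanh (artanh x) = x"
proof -
  have "exp (- 2 * artanh x) = (1 - x) / (1 + x)"
    using assms by (simp add: artanh_def exp_minus)
  then have "tanh (artanh x) = (1 - (1 - x) / (1 + x)) / (1 + (1 - x) / (1 + x))"
    by (simp only: tanh_real_altdef)
  also have "\<dots> = x" using assms by (simp add: field_simps)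
  finally show ?thesis .
qed

text \<open>
  Bergman disks reparametrised by \<open>\<rho> = tanh r\<close>, which avoids the inverse hyperbolic tangent.
\<close>

definition pseudo_disk :: "complex \<Rightarrow> real \<Rightarrow> complex set"
  where "pseudo_disk a \<rho> = {w \<in> \<bbbD>. cmod (disk_swap a w) < \<rho>}"

lemma pseudo_disk_eq_image:
  assumes a: "a \<in> \<bbbD>" and "\<rho> \<le> 1"
  shows "pseudo_disk a \<rho> = disk_swap a ` ball 0 \<rho>"
proof (intro equalityI subsetI)
  fix w assume "w \<in> pseudo_disk a \<rho>"
  then show "w \<in> disk_swap a ` ball 0 \<rho>"
    using disk_swap_involution[OF a, of w]
    by (intro image_eqI[of _ _ "disk_swap a w"]) (auto simp: pseudo_disk_def)
next
  fix w assume "w \<in> disk_swap a ` ball 0 \<rho>"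
  then show "w \<in> pseudo_disk a \<rho>"
    using assms disk_swap_in_disk[OF a] by (auto simp: pseudo_disk_def)
qed

lemma bergman_disk_eq_pseudo_disk:
  assumes a: "a \<in> \<bbbD>"
  shows "bergman_disk a r = pseudo_disk a (tanh r)"
proof -
  have "artanh (cmod (disk_swap a w)) < r \<longleftrightarrow> cmod (disk_swap a w) < tanh r" if "w \<in> \<bbbD>" for w
  proof -
    have "cmod (disk_swap a w) < 1"
      using disk_swap_in_disk[OF a that] by simp
    moreover have "0 \<le> cmod (disk_swap a w)" by simp
    ultimately have "tanh (artanh (cmod (disk_swap a w))) = cmod (disk_swap a w)"
      by (intro tanh_artanh)
    then show ?thesis by (metis tanh_real_less_iff)
  qed
  then show ?thesis
    by (auto simp: bergman_disk_def pseudo_disk_def bergman_dist_def pseudohyp_dist_def disk_swap_def)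
qed

abbreviation disk_weight :: "real \<Rightarrow> complex \<Rightarrow> real"
  where "disk_weight \<alpha> z \<equiv> (1 - (cmod z)\<^sup>2) powr \<alpha>"

text \<open>
  By \<open>1 - |\<phi>\<^sub>a(u)|\<^sup>2 = (1 - |a|\<^sup>2) (1 - |u|\<^sup>2) / |1 - cnj a u|\<^sup>2\<close>, the weight at \<open>\<phi>\<^sub>a(u)\<close> is the product of the
  weights at \<open>a\<close> and \<open>u\<close> and of \<open>|1 - cnj a u|\<close> to the power \<open>-2\<alpha>\<close>.  The last exponent lies between \<open>0\<close>
  and \<open>2\<close>, so this factor is at most \<open>4\<close> and is bounded below by \<open>(1 - |u|)\<^sup>2\<close>.
\<close>

lemma disk_weight_swap_bounds:
  assumes \<alpha>: "-1 < \<alpha>" "\<alpha> < 0" and a: "a \<in> \<bbbD>" and u: "u \<in> \<bbbD>"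
  shows "disk_weight \<alpha> (disk_swap a u) \<le> 4 * disk_weight \<alpha> a * disk_weight \<alpha> u"
    and "(1 - cmod u)\<^sup>2 * disk_weight \<alpha> a \<le> disk_weight \<alpha> (disk_swap a u)"
proof -
  define q where "q = (cmod (1 - cnj a * u))\<^sup>2"
  have q0: "0 < q" using disk_swap_denom_nz[OF a u] by (simp add: q_def)
  have q4: "q \<le> 4"
    using disk_swap_denom_bounds(2)[OF a u] power_mono[of "cmod (1 - cnj a * u)" 2 2] by (simp add: q_def)
  have qu: "(1 - cmod u)\<^sup>2 \<le> q"
    unfolding q_def using disk_swap_denom_bounds(1)[OF a u] u by (intro power_mono) auto
  have pos: "0 < 1 - (cmod a)\<^sup>2" "0 < 1 - (cmod u)\<^sup>2" "0 < (1 - cmod u)\<^sup>2"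
    using a u by (auto simp: abs_square_less_1)
  have eq: "disk_weight \<alpha> (disk_swap a u) = disk_weight \<alpha> a * disk_weight \<alpha> u * q powr (- \<alpha>)"
    unfolding one_minus_disk_swap_sq[OF a u] q_def[symmetric]
    using pos q0 by (simp add: powr_mult powr_divide powr_minus_divide)
  have "q powr (- \<alpha>) \<le> 4 powr (- \<alpha>)"
    using q0 q4 \<alpha> by (intro powr_mono2) auto
  also have "\<dots> \<le> 4 powr 1" using \<alpha> by (intro powr_mono) auto
  finally have up: "q powr (- \<alpha>) \<le> 4" by simp
  show "disk_weight \<alpha> (disk_swap a u) \<le> 4 * disk_weight \<alpha> a * disk_weight \<alpha> u"
    unfolding eq using mult_left_mono[OF up, of "disk_weight \<alpha> a * disk_weight \<alpha> u"] by (simp add: mult_ac)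
  have le1: "(1 - cmod u)\<^sup>2 \<le> 1" using u by (simp add: power_le_one)
  have "(1 - cmod u)\<^sup>2 = ((1 - cmod u)\<^sup>2) powr 1" using pos by simp
  also have "\<dots> \<le> ((1 - cmod u)\<^sup>2) powr (- \<alpha>)"
    using \<alpha> pos le1 by (intro powr_mono') auto
  also have "\<dots> \<le> q powr (- \<alpha>)"
    using qu pos \<alpha> by (intro powr_mono2) auto
  finally have lo: "(1 - cmod u)\<^sup>2 \<le> q powr (- \<alpha>)" .
  have "1 = (1 - (cmod u)\<^sup>2) powr 0" using pos by simp
  also have "\<dots> \<le> disk_weight \<alpha> u"
    using \<alpha> pos by (intro powr_mono') auto
  finally have w1: "1 \<le> disk_weight \<alpha> u" .
  have "(1 - cmod u)\<^sup>2 * disk_weight \<alpha> a = disk_weight \<alpha> a * 1 * (1 - cmod u)\<^sup>2" by simp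
  also have "\<dots> \<le> disk_weight \<alpha> a * disk_weight \<alpha> u * q powr (- \<alpha>)"
    using lo w1 by (intro mult_mono mult_left_mono) auto
  finally show "(1 - cmod u)\<^sup>2 * disk_weight \<alpha> a \<le> disk_weight \<alpha> (disk_swap a u)"
    unfolding eq .
qed

lemma disk_weight_le_of_cmod_le:
  assumes \<alpha>: "-1 < \<alpha>" "\<alpha> < 0" and u: "cmod u \<le> \<rho>" and \<rho>: "\<rho> < 1"
  shows "disk_weight \<alpha> u \<le> 1 / (1 - \<rho>)"
proof -
  have "0 \<le> \<rho>" using u norm_ge_zero[of u] by linarith
  have "(cmod u)\<^sup>2 \<le> \<rho>\<^sup>2" using u by (intro power_mono) auto
  moreover have "\<rho>\<^sup>2 \<le> \<rho>" using \<open>0 \<le> \<rho>\<close> \<rho> by (simp add: power2_eq_square mult_left_le)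
  ultimately have "disk_weight \<alpha> u \<le> (1 - \<rho>) powr \<alpha>"
    using \<alpha> \<rho> by (intro powr_mono2') auto
  also have "\<dots> \<le> (1 - \<rho>) powr (-1)"
    using \<alpha> \<rho> \<open>0 \<le> \<rho>\<close> by (intro powr_mono') auto
  also have "\<dots> = 1 / (1 - \<rho>)" using \<rho> by (simp add: powr_minus_divide)
  finally show ?thesis .
qed

text \<open>
  Transporting weighted area from a pseudohyperbolic disk about \<open>a\<close> to a disk about \<open>0\<close> multiplies area by
  a factor comparable to \<open>(1 - |a|\<^sup>2)\<^bsup>2+\<alpha>\<^esup>\<close>, with constants that do not depend on \<open>a\<close>.
\<close>

lemma disk_swap_jacobian_comparable:
  assumes \<alpha>: "-1 < \<alpha>" "\<alpha> < 0" and a: "a \<in> \<bbbD>" and u: "cmod u \<le> \<rho>" and \<rho>: "\<rho> < 1"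
  shows "(1 - \<rho>)\<^sup>2 / 16 * ((1 - (cmod a)\<^sup>2)\<^sup>2 * disk_weight \<alpha> a)
      \<le> disk_weight \<alpha> (disk_swap a u) * (cmod (deriv (disk_swap a) u))\<^sup>2"
    and "disk_weight \<alpha> (disk_swap a u) * (cmod (deriv (disk_swap a) u))\<^sup>2
      \<le> 4 / (1 - \<rho>) ^ 5 * ((1 - (cmod a)\<^sup>2)\<^sup>2 * disk_weight \<alpha> a)"
proof -
  have uD: "u \<in> \<bbbD>" using u \<rho> by simp
  have pa: "0 < 1 - (cmod a)\<^sup>2" using a by (simp add: abs_square_less_1)
  have "(1 - \<rho>)\<^sup>2 * disk_weight \<alpha> a \<le> (1 - cmod u)\<^sup>2 * disk_weight \<alpha> a"
    using u \<rho> by (intro mult_right_mono power_mono) auto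
  then have 1: "(1 - \<rho>)\<^sup>2 * disk_weight \<alpha> a \<le> disk_weight \<alpha> (disk_swap a u)"
    using disk_weight_swap_bounds(2)[OF \<alpha> a uD] by linarith
  have 2: "((1 - (cmod a)\<^sup>2) / 4)\<^sup>2 \<le> (cmod (deriv (disk_swap a) u))\<^sup>2"
    using disk_swap_deriv_bounds(1)[OF a uD u \<rho>] pa by (intro power_mono) auto
  have "(1 - \<rho>)\<^sup>2 / 16 * ((1 - (cmod a)\<^sup>2)\<^sup>2 * disk_weight \<alpha> a)
      = (1 - \<rho>)\<^sup>2 * disk_weight \<alpha> a * ((1 - (cmod a)\<^sup>2) / 4)\<^sup>2"
    by (simp add: power_divide)
  also have "\<dots> \<le> disk_weight \<alpha> (disk_swap a u) * (cmod (deriv (disk_swap a) u))\<^sup>2"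
    using 1 2 by (intro mult_mono) auto
  finally show "(1 - \<rho>)\<^sup>2 / 16 * ((1 - (cmod a)\<^sup>2)\<^sup>2 * disk_weight \<alpha> a)
      \<le> disk_weight \<alpha> (disk_swap a u) * (cmod (deriv (disk_swap a) u))\<^sup>2" .
  have "disk_weight \<alpha> (disk_swap a u) \<le> 4 * disk_weight \<alpha> a * disk_weight \<alpha> u"
    by (rule disk_weight_swap_bounds(1)[OF \<alpha> a uD])
  also have "\<dots> \<le> 4 * disk_weight \<alpha> a * (1 / (1 - \<rho>))"
    using disk_weight_le_of_cmod_le[OF \<alpha> u \<rho>] by (intro mult_left_mono) auto
  finally have 3: "disk_weight \<alpha> (disk_swap a u) \<le> 4 * disk_weight \<alpha> a * (1 / (1 - \<rho>))" .
  have 4: "(cmod (deriv (disk_swap a) u))\<^sup>2 \<le> ((1 - (cmod a)\<^sup>2) / (1 - \<rho>)\<^sup>2)\<^sup>2"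
    using disk_swap_deriv_bounds(2)[OF a uD u \<rho>] by (intro power_mono) auto
  have "disk_weight \<alpha> (disk_swap a u) * (cmod (deriv (disk_swap a) u))\<^sup>2
      \<le> 4 * disk_weight \<alpha> a * (1 / (1 - \<rho>)) * ((1 - (cmod a)\<^sup>2) / (1 - \<rho>)\<^sup>2)\<^sup>2"
    using 3 4 \<rho> by (intro mult_mono) auto
  also have "\<dots> = 4 / (1 - \<rho>) ^ 5 * ((1 - (cmod a)\<^sup>2)\<^sup>2 * disk_weight \<alpha> a)"
    using \<rho> by (simp add: field_simps power_divide flip: power_mult power_Suc)
  finally show "disk_weight \<alpha> (disk_swap a u) * (cmod (deriv (disk_swap a) u))\<^sup>2
      \<le> 4 / (1 - \<rho>) ^ 5 * ((1 - (cmod a)\<^sup>2)\<^sup>2 * disk_weight \<alpha> a)" .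
qed

section \<open>Integration over the weighted disk\<close>

lemma borel_disk [measurable]: "\<bbbD> \<in> sets borel"
  by simp

lemma nn_integral_disk_area:
  assumes "F \<in> borel_measurable (restrict_space borel \<bbbD>)"
  shows "(\<integral>\<^sup>+z. F z \<partial>disk_area) = ennreal (1 / pi) * (\<integral>\<^sup>+z\<in>\<bbbD>. F z \<partial>lborel)"
proof -
  have "F \<in> borel_measurable (restrict_space lborel \<bbbD>)"
    using assms measurable_cong_sets[of "restrict_space borel \<bbbD>" "restrict_space lborel \<bbbD>" borel borel]
    by (simp add: sets_restrict_space)
  then show ?thesis
    by (simp add: disk_area_def nn_integral_scale_measure nn_integral_restrict_space)
qed

lemma disk_measurableI: "F \<in> borel_measurable borel \<Longrightarrow> F \<in> borel_measurable (restrict_space borel \<bbbD>)"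
  by (rule measurable_restrict_space1)

lemma disk_area_measurable_iff:
  "F \<in> borel_measurable disk_area \<longleftrightarrow> F \<in> borel_measurable (restrict_space borel \<bbbD>)"
  using measurable_cong_sets[OF sets_disk_area refl] by blast

lemma nn_integral_weighted_area:
  assumes F: "F \<in> borel_measurable (restrict_space borel \<bbbD>)" and \<alpha>: "-1 < \<alpha>"
  shows "(\<integral>\<^sup>+z. F z \<partial>weighted_area \<alpha>)
    = ennreal ((1 + \<alpha>) / pi) * (\<integral>\<^sup>+z\<in>\<bbbD>. F z * ennreal (disk_weight \<alpha> z) \<partial>lborel)"
proof -
  have w: "(\<lambda>z. ennreal ((1 + \<alpha>) * disk_weight \<alpha> z)) \<in> borel_measurable (restrict_space borel \<bbbD>)"
    by (intro disk_measurableI) measurable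
  define F0 where "F0 = (\<lambda>z. if z \<in> \<bbbD> then F z else 0)"
  have F0[measurable]: "F0 \<in> borel_measurable borel"
    unfolding F0_def using F by (subst measurable_restrict_space_iff[symmetric]) auto
  have "(\<integral>\<^sup>+z. F z \<partial>weighted_area \<alpha>) = (\<integral>\<^sup>+z. ennreal ((1 + \<alpha>) * disk_weight \<alpha> z) * F z \<partial>disk_area)"
    unfolding weighted_area_def using F w
    by (intro nn_integral_density) (simp_all add: disk_area_measurable_iff)
  also have "\<dots> = ennreal (1 / pi) * (\<integral>\<^sup>+z\<in>\<bbbD>. (ennreal ((1 + \<alpha>) * disk_weight \<alpha> z) * F z) \<partial>lborel)"
    by (rule nn_integral_disk_area[OF borel_measurable_times_ennreal[OF w F]])
  also have "(\<integral>\<^sup>+z\<in>\<bbbD>. (ennreal ((1 + \<alpha>) * disk_weight \<alpha> z) * F z) \<partial>lborel)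
      = (\<integral>\<^sup>+z. ennreal (1 + \<alpha>) * (F0 z * ennreal (disk_weight \<alpha> z) * indicator \<bbbD> z) \<partial>lborel)"
    using \<alpha> by (intro nn_integral_cong) (auto simp: F0_def ennreal_mult mult_ac indicator_def)
  also have "\<dots> = ennreal (1 + \<alpha>) * (\<integral>\<^sup>+z\<in>\<bbbD>. (F0 z * ennreal (disk_weight \<alpha> z)) \<partial>lborel)"
    by (intro nn_integral_cmult) measurable
  also have "(\<integral>\<^sup>+z\<in>\<bbbD>. (F0 z * ennreal (disk_weight \<alpha> z)) \<partial>lborel)
      = (\<integral>\<^sup>+z\<in>\<bbbD>. F z * ennreal (disk_weight \<alpha> z) \<partial>lborel)"
    by (intro nn_integral_cong) (auto simp: F0_def indicator_def)
  also have "ennreal (1 / pi) * (ennreal (1 + \<alpha>) * (\<integral>\<^sup>+z\<in>\<bbbD>. F z * ennreal (disk_weight \<alpha> z) \<partial>lborel))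
      = ennreal ((1 + \<alpha>) / pi) * (\<integral>\<^sup>+z\<in>\<bbbD>. F z * ennreal (disk_weight \<alpha> z) \<partial>lborel)"
    using \<alpha> by (simp add: mult.assoc[symmetric] ennreal_mult[symmetric])
  finally show ?thesis .
qed

abbreviation weighted_mass :: "real \<Rightarrow> complex set \<Rightarrow> ennreal"
  where "weighted_mass \<alpha> A \<equiv> (\<integral>\<^sup>+z\<in>A. ennreal (disk_weight \<alpha> z) \<partial>lborel)"

lemma emeasure_weighted_area:
  assumes E: "E \<in> sets borel" "E \<subseteq> \<bbbD>" and \<alpha>: "-1 < \<alpha>"
  shows "emeasure (weighted_area \<alpha>) E
    = ennreal ((1 + \<alpha>) / pi) * weighted_mass \<alpha> E"
proof -
  have "E \<in> sets (weighted_area \<alpha>)"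
    using E by (simp add: sets_restrict_space_iff)
  then have "emeasure (weighted_area \<alpha>) E = (\<integral>\<^sup>+z. indicator E z \<partial>weighted_area \<alpha>)"
    by (simp add: nn_integral_indicator)
  also have "\<dots> = ennreal ((1 + \<alpha>) / pi)
      * (\<integral>\<^sup>+z\<in>\<bbbD>. indicator E z * ennreal (disk_weight \<alpha> z) \<partial>lborel)"
    using E \<alpha> by (intro nn_integral_weighted_area disk_measurableI) auto
  also have "(\<integral>\<^sup>+z\<in>\<bbbD>. indicator E z * ennreal (disk_weight \<alpha> z) \<partial>lborel)
      = weighted_mass \<alpha> E"
    using E by (intro nn_integral_cong) (auto simp: indicator_def)
  finally show ?thesis .
qed

text \<open>
  The shell \<open>1 - |z|\<^sup>2 \<le> 2\<^sup>-\<^sup>n\<close> has area \<open>\<pi> 2\<^sup>-\<^sup>n\<close>, and a point with \<open>2\<^bsup>-n-1\<^esup> < 1 - |z|\<^sup>2 \<le> 2\<^sup>-\<^sup>n\<close> has weight at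
  most \<open>q\<^bsup>n+1\<^esup>\<close> with \<open>q = 2\<^bsup>-\<alpha>\<^esup> < 2\<close>, so the integral is at most a convergent geometric series.
\<close>

lemma disk_weight_finite_mass:
  assumes \<alpha>: "-1 < \<alpha>" "\<alpha> < 0"
  shows "weighted_mass \<alpha> \<bbbD> < \<infinity>"
proof -
  define S where "S = (\<lambda>n::nat. {z::complex. 1 - (1/2) ^ n \<le> (cmod z)\<^sup>2 \<and> (cmod z)\<^sup>2 < 1})"
  have S[measurable]: "S n \<in> sets borel" for n
    unfolding S_def by measurable
  have Sn: "emeasure lborel (S n) = ennreal (pi * (1/2) ^ n)" for n
  proof -
    have le1: "(1/2::real) ^ n \<le> 1" by (simp add: power_le_one)
    have eq: "S n = ball 0 1 - ball 0 (sqrt (1 - (1/2) ^ n))"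
    proof (intro set_eqI)
      fix z :: complex
      have "cmod z < sqrt (1 - (1/2) ^ n) \<longleftrightarrow> (cmod z)\<^sup>2 < 1 - (1/2) ^ n"
        using real_sqrt_less_iff[of "(cmod z)\<^sup>2" "1 - (1/2) ^ n"] by (simp del: real_sqrt_less_iff)
      then show "z \<in> S n \<longleftrightarrow> z \<in> ball 0 1 - ball 0 (sqrt (1 - (1/2) ^ n))"
        by (auto simp: S_def abs_square_less_1)
    qed
    have "emeasure lborel (S n) = emeasure lborel (ball 0 1 :: complex set) - emeasure lborel (ball (0::complex) (sqrt (1 - (1/2) ^ n)))"
      unfolding eq using le1
      by (intro emeasure_Diff subset_ball) (auto simp: emeasure_ball)
    also have "\<dots> = ennreal (pi * 1) - ennreal (pi * (1 - (1/2) ^ n))"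
      using le1 by (simp add: emeasure_ball unit_ball_vol_2)
    also have "\<dots> = ennreal (pi * (1/2) ^ n)"
      using le1 by (subst ennreal_minus) (auto simp: algebra_simps)
    finally show ?thesis .
  qed
  define q where "q = (1/2::real) powr \<alpha>"
  define c where "c = q / 2"
  have q: "1 \<le> q" "q < 2"
  proof -
    have "(1/2::real) powr 0 \<le> q" unfolding q_def using \<alpha> by (intro powr_mono') auto
    then show "1 \<le> q" by simp
    have "q = 2 powr (- \<alpha>)" unfolding q_def by (simp add: powr_divide powr_minus_divide)
    also have "\<dots> < 2 powr 1" using \<alpha> by (intro powr_less_mono) auto
    finally show "q < 2" by simp
  qed
  then have c: "0 < c" "c < 1" by (auto simp: c_def)
  have pt: "ennreal (disk_weight \<alpha> z) * indicator \<bbbD> z \<le> (\<Sum>n. ennreal (q ^ Suc n) * indicator (S n) z)" for z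
  proof (cases "z \<in> \<bbbD>")
    case True
    define t where "t = 1 - (cmod z)\<^sup>2"
    have t: "0 < t" "t \<le> 1" using True by (auto simp: t_def abs_square_less_1)
    obtain N where N: "(1/2) ^ N < t"
      using t real_arch_pow_inv[of t "1/2"] by auto
    define n where "n = (LEAST n. (1/2) ^ n < t)"
    have n: "(1/2) ^ n < t" unfolding n_def by (rule LeastI[of _ N]) (rule N)
    then have "n \<noteq> 0" using t by (intro notI) simp
    then obtain m where m: "n = Suc m" by (cases n) auto
    have "\<not> (1/2) ^ m < t" using not_less_Least[of m "\<lambda>n. (1/2) ^ n < t"] m by (simp add: n_def)
    then have zS: "z \<in> S m" using t by (auto simp: S_def t_def)
    have "t powr \<alpha> \<le> ((1/2) ^ Suc m) powr \<alpha>"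
      using n m \<alpha> by (intro powr_mono2') auto
    also have "\<dots> = q ^ Suc m"
      by (simp add: q_def powr_realpow[symmetric] powr_powr mult.commute powr_power[symmetric] del: power_Suc)
    finally have "ennreal (disk_weight \<alpha> z) * indicator \<bbbD> z \<le> ennreal (q ^ Suc m) * indicator (S m) z"
      using zS True by (simp add: t_def ennreal_leI)
    also have "\<dots> \<le> (\<Sum>n. ennreal (q ^ Suc n) * indicator (S n) z)"
    proof -
      define T where "T = (\<lambda>n. ennreal (q ^ Suc n) * indicator (S n) z)"
      have "T m \<le> (\<Sum>n. T n)" using sum_le_suminf[of T "{m}"] by (simp add: summableI)
      then show ?thesis by (simp only: T_def)
    qed
    finally show ?thesis .
  qed simp
  have "weighted_mass \<alpha> \<bbbD>
      \<le> (\<integral>\<^sup>+z. (\<Sum>n. ennreal (q ^ Suc n) * indicator (S n) z) \<partial>lborel)"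
    by (intro nn_integral_mono pt)
  also have "\<dots> = (\<Sum>n. \<integral>\<^sup>+z. ennreal (q ^ Suc n) * indicator (S n) z \<partial>lborel)"
    by (intro nn_integral_suminf) measurable
  also have "\<dots> = (\<Sum>n. ennreal (pi * q * c ^ n))"
  proof (intro arg_cong[where f = suminf] ext)
    fix n
    have "(\<integral>\<^sup>+z. ennreal (q ^ Suc n) * indicator (S n) z \<partial>lborel) = ennreal (q ^ Suc n) * emeasure lborel (S n)"
      by (intro nn_integral_cmult_indicator) simp
    also have "\<dots> = ennreal (q ^ Suc n * (pi * (1/2) ^ n))"
      unfolding Sn using q by (intro ennreal_mult[symmetric]) auto
    also have "q ^ Suc n * (pi * (1/2) ^ n) = pi * q * c ^ n"
      by (simp add: c_def power_divide)
    finally show "(\<integral>\<^sup>+z. ennreal (q ^ Suc n) * indicator (S n) z \<partial>lborel) = ennreal (pi * q * c ^ n)" .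
  qed
  also have "\<dots> = ennreal (\<Sum>n. pi * q * c ^ n)"
    using c q by (intro suminf_ennreal2 summable_mult summable_geometric) auto
  also have "\<dots> < \<infinity>" by simp
  finally show ?thesis .
qed

lemma borel_measurable_disk_swap [measurable]: "disk_swap a \<in> borel_measurable borel"
  unfolding disk_swap_def[abs_def] by measurable

lemma borel_pseudo_disk [measurable]: "pseudo_disk a \<rho> \<in> sets borel"
proof -
  have "pseudo_disk a \<rho> = \<bbbD> \<inter> {w. cmod (disk_swap a w) < \<rho>}"
    by (auto simp: pseudo_disk_def)
  also have "\<dots> \<in> sets borel" by measurable
  finally show ?thesis .
qed

lemma borel_pseudo_disk_graph:
  "{p. snd p \<in> pseudo_disk (fst p) \<rho>} \<in> sets (lborel \<Otimes>\<^sub>M lborel)"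
proof -
  have [measurable]: "cnj \<in> borel_measurable borel"
    by (intro borel_measurable_continuous_onI continuous_intros)
  have [measurable]: "(\<lambda>p. disk_swap (fst p) (snd p)) \<in> borel_measurable (lborel \<Otimes>\<^sub>M lborel)"
    unfolding disk_swap_def by measurable
  have "{p \<in> space (lborel \<Otimes>\<^sub>M lborel). cmod (snd p) < 1 \<and> cmod (disk_swap (fst p) (snd p)) < \<rho>}
      \<in> sets (lborel \<Otimes>\<^sub>M lborel)"
    by measurable
  then show ?thesis by (simp add: pseudo_disk_def space_pair_measure)
qed

lemma borel_measurable_pseudo_disk_integral:
  fixes u :: "complex \<Rightarrow> ennreal"
  assumes [measurable]: "u \<in> borel_measurable borel"
  shows "(\<lambda>a. \<integral>\<^sup>+w\<in>pseudo_disk a \<rho>. u w \<partial>lborel) \<in> borel_measurable borel"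
proof -
  note [measurable] = borel_pseudo_disk_graph[of \<rho>]
  have "(\<lambda>p. u (snd p) * indicator {p. snd p \<in> pseudo_disk (fst p) \<rho>} p) \<in> borel_measurable (lborel \<Otimes>\<^sub>M lborel)"
    by measurable
  also have "(\<lambda>p. u (snd p) * indicator {p. snd p \<in> pseudo_disk (fst p) \<rho>} p)
      = (\<lambda>(a, w). u w * indicator (pseudo_disk a \<rho>) w)"
    by (auto simp: indicator_def)
  finally have "(\<lambda>a. \<integral>\<^sup>+w. u w * indicator (pseudo_disk a \<rho>) w \<partial>lborel) \<in> borel_measurable lborel"
    by (rule lborel.borel_measurable_nn_integral)
  then show ?thesis by simp
qed

lemma nn_integral_disk_swap_image:
  assumes a: "a \<in> \<bbbD>" and E: "E \<subseteq> \<bbbD>" "E \<in> sets borel" and F: "F \<in> borel_measurable borel"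
  shows "(\<integral>\<^sup>+w\<in>disk_swap a ` E. F w \<partial>lborel)
    = (\<integral>\<^sup>+u\<in>E. F (disk_swap a u) * sqnorm (deriv (disk_swap a) u) \<partial>lborel)"
  by (rule nn_integral_holomorphic_image[OF open_ball holomorphic_disk_swap[OF a] inj_on_disk_swap[OF a] E F])

text \<open>
  The area of a pseudohyperbolic disk of radius \<open>\<rho>\<close> for the Moebius-invariant area element
  \<open>dA / (1 - |u|\<^sup>2)\<^sup>2\<close>; by invariance it does not depend on the centre.
\<close>

definition pseudo_disk_hyp_area :: "real \<Rightarrow> ennreal"
  where "pseudo_disk_hyp_area \<rho> = (\<integral>\<^sup>+u\<in>ball 0 \<rho>. ennreal (1 / (1 - (cmod u)\<^sup>2)\<^sup>2) \<partial>(lborel :: complex measure))"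

lemma nn_integral_pseudo_disk_hyp:
  assumes w: "w \<in> \<bbbD>" and \<rho>: "\<rho> \<le> 1"
  shows "(\<integral>\<^sup>+a\<in>pseudo_disk w \<rho>. ennreal (1 / (1 - (cmod a)\<^sup>2)\<^sup>2) \<partial>lborel) = pseudo_disk_hyp_area \<rho>"
proof -
  have "(\<integral>\<^sup>+a\<in>pseudo_disk w \<rho>. ennreal (1 / (1 - (cmod a)\<^sup>2)\<^sup>2) \<partial>lborel)
     = (\<integral>\<^sup>+u\<in>ball 0 \<rho>. ennreal (1 / (1 - (cmod (disk_swap w u))\<^sup>2)\<^sup>2)
           * sqnorm (deriv (disk_swap w) u) \<partial>lborel)"
    unfolding pseudo_disk_eq_image[OF w \<rho>] using \<rho>
    by (intro nn_integral_disk_swap_image[OF w]) auto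
  also have "\<dots> = pseudo_disk_hyp_area \<rho>"
    unfolding pseudo_disk_hyp_area_def
  proof (intro nn_integral_cong)
    fix u :: complex
    show "ennreal (1 / (1 - (cmod (disk_swap w u))\<^sup>2)\<^sup>2)
        * sqnorm (deriv (disk_swap w) u) * indicator (ball 0 \<rho>) u
      = ennreal (1 / (1 - (cmod u)\<^sup>2)\<^sup>2) * indicator (ball 0 \<rho>) u"
    proof (cases "u \<in> ball 0 \<rho>")
      case True
      then have u: "u \<in> \<bbbD>" using \<rho> by auto
      have nz: "cmod (1 - cnj w * u) \<noteq> 0" "1 - (cmod w)\<^sup>2 \<noteq> 0" "1 - (cmod u)\<^sup>2 \<noteq> 0"
        using disk_swap_denom_nz[OF w u] cmod_sq_lt_1[OF w] cmod_sq_lt_1[OF u] by auto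
      have "1 / (1 - (cmod (disk_swap w u))\<^sup>2)\<^sup>2 * (cmod (deriv (disk_swap w) u))\<^sup>2
          = 1 / (1 - (cmod u)\<^sup>2)\<^sup>2"
        unfolding one_minus_disk_swap_sq[OF w u] cmod_deriv_disk_swap[OF w u]
        using nz by (simp add: power_divide power_mult_distrib)
      then show ?thesis by (simp add: ennreal_mult[symmetric])
    qed simp
  qed
  finally show ?thesis .
qed

text \<open>
  Since \<open>w\<close> lies in the disk about \<open>a\<close> exactly when \<open>a\<close> lies in the disk about \<open>w\<close>, exchanging the order of
  integration leaves the invariant area of a disk about \<open>w\<close>.
\<close>

lemma nn_integral_pseudo_disk_average:
  fixes u :: "complex \<Rightarrow> ennreal"
  assumes \<rho>: "\<rho> \<le> 1" and u[measurable]: "u \<in> borel_measurable borel"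
  shows "(\<integral>\<^sup>+a\<in>\<bbbD>. ennreal (1 / (1 - (cmod a)\<^sup>2)\<^sup>2) * (\<integral>\<^sup>+w\<in>pseudo_disk a \<rho>. u w \<partial>lborel) \<partial>lborel)
    = pseudo_disk_hyp_area \<rho> * (\<integral>\<^sup>+w\<in>\<bbbD>. u w \<partial>lborel)"
proof -
  define k where "k = (\<lambda>a w :: complex. ennreal (1 / (1 - (cmod a)\<^sup>2)\<^sup>2) * u w
      * (if cmod a < 1 \<and> cmod w < 1 \<and> cmod (disk_swap a w) < \<rho> then 1 else 0))"
  note [measurable] = borel_pseudo_disk_graph[of \<rho>]
  have "(\<lambda>p. ennreal (1 / (1 - (cmod (fst p))\<^sup>2)\<^sup>2) * u (snd p) * indicator \<bbbD> (fst p)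
        * indicator {p. snd p \<in> pseudo_disk (fst p) \<rho>} p) \<in> borel_measurable (lborel \<Otimes>\<^sub>M lborel)"
    by measurable
  also have "(\<lambda>p. ennreal (1 / (1 - (cmod (fst p))\<^sup>2)\<^sup>2) * u (snd p) * indicator \<bbbD> (fst p)
        * indicator {p. snd p \<in> pseudo_disk (fst p) \<rho>} p) = (\<lambda>(a, w). k a w)"
    by (auto simp: k_def pseudo_disk_def indicator_def)
  finally have k: "(\<lambda>(a, w). k a w) \<in> borel_measurable (lborel \<Otimes>\<^sub>M lborel)" .
  have k1[measurable]: "k a \<in> borel_measurable borel" for a
    using k by (auto dest: measurable_Pair2)
  have "(\<integral>\<^sup>+a\<in>\<bbbD>. ennreal (1 / (1 - (cmod a)\<^sup>2)\<^sup>2) * (\<integral>\<^sup>+w\<in>pseudo_disk a \<rho>. u w \<partial>lborel) \<partial>lborel)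
      = (\<integral>\<^sup>+a. \<integral>\<^sup>+w. k a w \<partial>lborel \<partial>lborel)"
  proof (intro nn_integral_cong)
    fix a :: complex
    show "ennreal (1 / (1 - (cmod a)\<^sup>2)\<^sup>2) * (\<integral>\<^sup>+w\<in>pseudo_disk a \<rho>. u w \<partial>lborel) * indicator \<bbbD> a
        = (\<integral>\<^sup>+w. k a w \<partial>lborel)"
    proof (cases "a \<in> \<bbbD>")
      case True
      have "ennreal (1 / (1 - (cmod a)\<^sup>2)\<^sup>2) * (\<integral>\<^sup>+w\<in>pseudo_disk a \<rho>. u w \<partial>lborel)
          = (\<integral>\<^sup>+w. ennreal (1 / (1 - (cmod a)\<^sup>2)\<^sup>2) * (u w * indicator (pseudo_disk a \<rho>) w) \<partial>lborel)"
        by (intro nn_integral_cmult[symmetric]) measurable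
      also have "\<dots> = (\<integral>\<^sup>+w. k a w \<partial>lborel)"
        using True by (intro nn_integral_cong) (auto simp: k_def pseudo_disk_def indicator_def)
      finally show ?thesis using True by simp
    qed (simp add: k_def)
  qed
  also have "\<dots> = (\<integral>\<^sup>+w. \<integral>\<^sup>+a. k a w \<partial>lborel \<partial>lborel)"
    by (rule lborel_pair.Fubini'[OF k, symmetric])
  also have "\<dots> = (\<integral>\<^sup>+w. pseudo_disk_hyp_area \<rho> * (u w * indicator \<bbbD> w) \<partial>lborel)"
  proof (intro nn_integral_cong)
    fix w :: complex
    show "(\<integral>\<^sup>+a. k a w \<partial>lborel) = pseudo_disk_hyp_area \<rho> * (u w * indicator \<bbbD> w)"
    proof (cases "w \<in> \<bbbD>")
      case True
      have "(\<integral>\<^sup>+a. k a w \<partial>lborel)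
          = (\<integral>\<^sup>+a. u w * (ennreal (1 / (1 - (cmod a)\<^sup>2)\<^sup>2) * indicator (pseudo_disk w \<rho>) a) \<partial>lborel)"
        using True by (intro nn_integral_cong)
          (auto simp: k_def pseudo_disk_def indicator_def cmod_disk_swap_commute[of _ w] mult.commute[of "u w"])
      also have "\<dots> = u w * (\<integral>\<^sup>+a\<in>pseudo_disk w \<rho>. ennreal (1 / (1 - (cmod a)\<^sup>2)\<^sup>2) \<partial>lborel)"
        by (intro nn_integral_cmult) measurable
      finally show ?thesis
        unfolding nn_integral_pseudo_disk_hyp[OF True \<rho>] using True by (simp add: mult.commute)
    qed (simp add: k_def)
  qed
  also have "\<dots> = pseudo_disk_hyp_area \<rho> * (\<integral>\<^sup>+w\<in>\<bbbD>. u w \<partial>lborel)"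
    by (intro nn_integral_cmult) measurable
  finally show ?thesis .
qed

lemma pseudo_disk_hyp_area_finite:
  assumes "\<rho> < 1" shows "pseudo_disk_hyp_area \<rho> < \<infinity>"
proof (cases "\<rho> \<le> 0")
  case False
  have "pseudo_disk_hyp_area \<rho> \<le> (\<integral>\<^sup>+u. ennreal (1 / (1 - \<rho>\<^sup>2)\<^sup>2) * indicator (ball 0 \<rho>) u \<partial>(lborel :: complex measure))"
    unfolding pseudo_disk_hyp_area_def
  proof (intro nn_integral_mono)
    fix u :: complex
    have "1 / (1 - (cmod u)\<^sup>2)\<^sup>2 \<le> 1 / (1 - \<rho>\<^sup>2)\<^sup>2" if "u \<in> ball 0 \<rho>"
    proof -
      have "(cmod u)\<^sup>2 \<le> \<rho>\<^sup>2" using that by (intro power_mono) auto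
      moreover have "\<rho>\<^sup>2 < 1" using False assms by (simp add: abs_square_less_1)
      ultimately show ?thesis by (intro divide_left_mono power_mono mult_pos_pos zero_less_power) auto
    qed
    then show "ennreal (1 / (1 - (cmod u)\<^sup>2)\<^sup>2) * indicator (ball 0 \<rho>) u
        \<le> ennreal (1 / (1 - \<rho>\<^sup>2)\<^sup>2) * indicator (ball 0 \<rho>) u"
      by (auto simp: indicator_def intro!: ennreal_leI)
  qed
  also have "\<dots> < \<infinity>"
    using False by (simp add: nn_integral_cmult_indicator emeasure_ball unit_ball_vol_2 ennreal_mult_less_top)
  finally show ?thesis .
qed (simp add: pseudo_disk_hyp_area_def ball_empty)

lemma pseudo_disk_hyp_area_pos:
  assumes "0 < \<rho>" "\<rho> < 1" shows "0 < pseudo_disk_hyp_area \<rho>"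
proof -
  have "0 < emeasure lborel (ball (0::complex) \<rho>)"
    using assms by (simp add: emeasure_ball unit_ball_vol_2)
  also have "\<dots> = (\<integral>\<^sup>+u. indicator (ball (0::complex) \<rho>) u \<partial>lborel)" by simp
  also have "\<dots> \<le> pseudo_disk_hyp_area \<rho>"
    unfolding pseudo_disk_hyp_area_def
  proof (intro nn_integral_mono)
    fix u :: complex
    have "1 \<le> 1 / (1 - (cmod u)\<^sup>2)\<^sup>2" if "u \<in> ball 0 \<rho>"
    proof -
      have "(cmod u)\<^sup>2 < 1" using that assms by (simp add: abs_square_less_1)
      then show ?thesis by (simp add: power_le_one)
    qed
    then show "indicator (ball 0 \<rho>) u \<le> ennreal (1 / (1 - (cmod u)\<^sup>2)\<^sup>2) * indicator (ball 0 \<rho>) u"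
      by (auto simp: indicator_def ennreal_leI[of 1, simplified])
  qed
  finally show ?thesis .
qed

section \<open>Mean values, normal families and dense subsets\<close>

text \<open>
  The Cauchy integral formula for \<open>h\<^sup>2\<close> on the circle through \<open>z + w\<close>; taking the square before averaging
  avoids the Cauchy-Schwarz inequality.
\<close>

lemma cmod_sq_le_circle_average:
  assumes h: "h holomorphic_on ball z t" and w: "cmod w < t"
  shows "sqnorm (h z)
    \<le> (\<integral>\<^sup>+x\<in>{0..1}. sqnorm (h (z + w * exp (2 * of_real pi * \<i> * of_real x))) \<partial>lborel)"
proof -
  define e where "e = (\<lambda>x::real. exp (2 * of_real pi * \<i> * of_real x))"
  define k where "k = (\<lambda>u. (h (z + w * u))\<^sup>2)"
  have e1: "cmod (e x) = 1" for x
    by (simp add: e_def norm_exp_eq_Re)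
  have k: "k holomorphic_on cball 0 1"
    unfolding k_def
  proof (intro holomorphic_intros holomorphic_on_compose_gen[OF _ h, unfolded o_def])
    show "(\<lambda>u. z + w * u) ` cball 0 1 \<subseteq> ball z t"
    proof (intro image_subsetI)
      fix u :: complex assume "u \<in> cball 0 1"
      then have "cmod w * cmod u \<le> cmod w * 1" by (intro mult_left_mono) auto
      then show "z + w * u \<in> ball z t" using w by (simp add: norm_mult dist_norm)
    qed
  qed
  have "((\<lambda>u. k u / (u - 0)) has_contour_integral (2 * of_real pi * \<i> * k 0)) (circlepath 0 1)"
    by (rule Cauchy_integral_circlepath_simple[OF k]) simp
  then have "((\<lambda>x. k (circlepath 0 1 x) / (circlepath 0 1 x - 0) * vector_derivative (circlepath 0 1) (at x))
      has_integral (2 * of_real pi * \<i> * k 0)) {0..1}"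
    by (simp only: has_contour_integral)
  moreover have "k (circlepath 0 1 x) / (circlepath 0 1 x - 0) * vector_derivative (circlepath 0 1) (at x)
      = 2 * of_real pi * \<i> * k (e x)" for x
    unfolding vector_derivative_circlepath unfolding circlepath by (simp add: e_def)
  ultimately have "((\<lambda>x. 2 * of_real pi * \<i> * k (e x)) has_integral (2 * of_real pi * \<i> * k 0)) {0..1}"
    by (simp only:)
  from has_integral_mult_right[OF this, of "1 / (2 * of_real pi * \<i>)"]
  have int: "((\<lambda>x. k (e x)) has_integral k 0) {0..1}" by simp
  have contk: "continuous_on {0..1} (\<lambda>x. k (e x))"
    by (rule continuous_on_compose2[OF holomorphic_on_imp_continuous_on[OF k]])
      (auto simp: e1 e_def intro!: continuous_intros)
  then have "continuous_on {0..1} (\<lambda>x. cmod (k (e x)))"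
    by (intro continuous_intros)
  then have ni: "(\<lambda>x. cmod (k (e x))) integrable_on {0..1}"
    by (rule integrable_continuous_real)
  have "cmod (integral {0..1} (\<lambda>x. k (e x))) \<le> integral {0..1} (\<lambda>x. cmod (k (e x)))"
    using int ni by (intro integral_norm_bound_integral) auto
  then have "ennreal (cmod (k 0)) \<le> ennreal (integral {0..1} (\<lambda>x. cmod (k (e x))))"
    using int by (intro ennreal_leI) (simp add: integral_unique)
  also have "\<dots> = (\<integral>\<^sup>+x\<in>{0..1}. ennreal (cmod (k (e x))) \<partial>lborel)"
    by (rule nn_integral_has_integral_lebesgue'[symmetric]) (use ni in auto)
  finally show ?thesis by (simp add: k_def e_def norm_power)
qed

text \<open>
  Integrating the circle average over all starting points \<open>w\<close> of the disk and exchanging integrals gives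
  the area integral, because rotations preserve area.
\<close>

lemma area_mean_value_inequality:
  assumes h: "h holomorphic_on ball z t" and t: "0 < t"
  shows "ennreal (pi * t\<^sup>2) * sqnorm (h z) \<le> (\<integral>\<^sup>+w\<in>ball z t. sqnorm (h w) \<partial>lborel)"
proof -
  define e where "e = (\<lambda>x::real. exp (2 * of_real pi * \<i> * of_real x))"
  have e1: "cmod (e x) = 1" for x
    by (simp add: e_def norm_exp_eq_Re)
  have [measurable]: "e \<in> borel_measurable borel"
    unfolding e_def by (intro borel_measurable_continuous_onI continuous_intros)
  define H where "H = (\<lambda>w. sqnorm (if w \<in> ball z t then h w else 0))"
  have "(\<lambda>w. if w \<in> ball z t then h w else 0) \<in> borel_measurable borel"
    using h by (subst measurable_restrict_space_iff[symmetric])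
      (auto intro!: borel_measurable_continuous_on_restrict holomorphic_on_imp_continuous_on)
  then have H[measurable]: "H \<in> borel_measurable borel"
    unfolding H_def by measurable
  have rot: "(\<integral>\<^sup>+w. H (z + w * e x) \<partial>lborel) = (\<integral>\<^sup>+w. H w \<partial>lborel)" for x
  proof -
    have ne: "e x \<noteq> 0" using e1[of x] by auto
    have inj: "inj_on (\<lambda>w. z + w * e x) UNIV" using ne by (auto intro!: inj_onI)
    have "y \<in> range (\<lambda>w. z + w * e x)" for y
      by (rule range_eqI[of _ _ "(y - z) / e x"]) (use ne in simp)
    then have surj: "(\<lambda>w. z + w * e x) ` UNIV = UNIV" by blast
    have der: "deriv (\<lambda>w. z + w * e x) w = e x" for w
      by (rule DERIV_imp_deriv) (auto intro!: derivative_eq_intros)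
    have "(\<integral>\<^sup>+w\<in>(\<lambda>w. z + w * e x) ` UNIV. H w \<partial>lborel)
        = (\<integral>\<^sup>+w\<in>UNIV. H (z + w * e x) * sqnorm (deriv (\<lambda>w. z + w * e x) w) \<partial>lborel)"
      by (rule nn_integral_holomorphic_image[OF open_UNIV _ inj]) (auto intro!: holomorphic_intros)
    then show ?thesis by (simp add: surj der e1)
  qed
  have "ennreal (pi * t\<^sup>2) * sqnorm (h z)
      = (\<integral>\<^sup>+w\<in>ball 0 t. sqnorm (h z) \<partial>(lborel :: complex measure))"
    using t by (subst nn_integral_cmult_indicator) (simp_all add: emeasure_ball unit_ball_vol_2 mult.commute)
  also have "\<dots> \<le> (\<integral>\<^sup>+w. (\<integral>\<^sup>+x. H (z + w * e x) * indicator {0..1} x \<partial>lborel) \<partial>lborel)"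
  proof (intro nn_integral_mono)
    fix w :: complex
    show "sqnorm (h z) * indicator (ball 0 t) w \<le> (\<integral>\<^sup>+x. H (z + w * e x) * indicator {0..1} x \<partial>lborel)"
    proof (cases "cmod w < t")
      case True
      have "sqnorm (h z) \<le> (\<integral>\<^sup>+x\<in>{0..1}. sqnorm (h (z + w * e x)) \<partial>lborel)"
        unfolding e_def by (rule cmod_sq_le_circle_average[OF h True])
      also have "\<dots> = (\<integral>\<^sup>+x. H (z + w * e x) * indicator {0..1} x \<partial>lborel)"
        using True by (intro nn_integral_cong) (simp add: H_def norm_mult e1 dist_norm)
      finally show ?thesis using True by simp
    qed simp
  qed
  also have "\<dots> = (\<integral>\<^sup>+x. (\<integral>\<^sup>+w. H (z + w * e x) * indicator {0..1} x \<partial>lborel) \<partial>lborel)"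
    by (rule lborel_pair.Fubini') measurable
  also have "\<dots> = (\<integral>\<^sup>+x. (\<integral>\<^sup>+w. H w \<partial>lborel) * indicator {0..1::real} x \<partial>lborel)"
    by (intro nn_integral_cong) (simp add: nn_integral_multc rot)
  also have "\<dots> = (\<integral>\<^sup>+w. H w \<partial>lborel)"
    by (simp add: nn_integral_cmult_indicator)
  also have "\<dots> = (\<integral>\<^sup>+w\<in>ball z t. sqnorm (h w) \<partial>lborel)"
    by (intro nn_integral_cong) (auto simp: H_def indicator_def)
  finally show ?thesis .
qed

lemma L2_bounded_uniformly_bounded_on_compact:
  assumes S: "open S" and K: "compact K" "K \<subseteq> S"
  shows "\<exists>B>0. \<forall>h C. h holomorphic_on S \<longrightarrow> 0 \<le> C \<longrightarrow>
    (\<integral>\<^sup>+w\<in>S. sqnorm (h w) \<partial>lborel) \<le> ennreal C \<longrightarrow> (\<forall>z\<in>K. (cmod (h z))\<^sup>2 \<le> B * C)"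
proof -
  obtain t where t: "t > 0" "(\<Union>z\<in>K. ball z t) \<subseteq> S"
    using compact_subset_open_imp_ball_epsilon_subset[OF K(1) S K(2)] by blast
  show ?thesis
  proof (intro exI[of _ "1 / (pi * t\<^sup>2)"] conjI allI impI ballI)
    fix h z C assume h: "h holomorphic_on S" and C: "(\<integral>\<^sup>+w\<in>S. sqnorm (h w) \<partial>lborel) \<le> ennreal C"
      and "0 \<le> C" and z: "z \<in> K"
    have b: "ball z t \<subseteq> S" using t z by blast
    have "ennreal (pi * t\<^sup>2 * (cmod (h z))\<^sup>2) \<le> (\<integral>\<^sup>+w\<in>ball z t. sqnorm (h w) \<partial>lborel)"
      using area_mean_value_inequality[OF holomorphic_on_subset[OF h b] t(1)] by (simp add: ennreal_mult)
    also have "\<dots> \<le> (\<integral>\<^sup>+w\<in>S. sqnorm (h w) \<partial>lborel)"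
      using b by (intro nn_integral_mono) (auto simp: indicator_def)
    also note C
    finally have "pi * t\<^sup>2 * (cmod (h z))\<^sup>2 \<le> C" using \<open>0 \<le> C\<close> by (simp add: ennreal_le_iff)
    then show "(cmod (h z))\<^sup>2 \<le> 1 / (pi * t\<^sup>2) * C"
      using t by (simp add: field_simps)
  qed (use t in simp)
qed

lemma L2_bounded_normal_family:
  fixes f :: "nat \<Rightarrow> complex \<Rightarrow> complex"
  assumes S: "open S" and f: "\<And>n. f n holomorphic_on S"
    and C: "\<And>n. (\<integral>\<^sup>+w\<in>S. sqnorm (f n w) \<partial>lborel) \<le> ennreal C"
  shows "\<exists>g r. g holomorphic_on S \<and> strict_mono (r :: nat \<Rightarrow> nat) \<and>
    (\<forall>z\<in>S. (\<lambda>n. f (r n) z) \<longlonglongrightarrow> g z) \<and>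
    (\<forall>K. compact K \<longrightarrow> K \<subseteq> S \<longrightarrow> uniform_limit K (\<lambda>n. f (r n)) g sequentially)"
proof -
  have bd: "\<exists>B. \<forall>h\<in>range f. \<forall>z\<in>K. cmod (h z) \<le> B" if K: "compact K" "K \<subseteq> S" for K
  proof -
    obtain B where B: "\<And>h C z. h holomorphic_on S \<Longrightarrow> 0 \<le> C \<Longrightarrow>
        (\<integral>\<^sup>+w\<in>S. sqnorm (h w) \<partial>lborel) \<le> ennreal C \<Longrightarrow> z \<in> K \<Longrightarrow> (cmod (h z))\<^sup>2 \<le> B * C"
      using L2_bounded_uniformly_bounded_on_compact[OF S K] by blast
    have "cmod (f n z) \<le> sqrt (B * max 0 C)" if "z \<in> K" for n z
    proof (rule real_le_rsqrt, rule B[OF f _ _ that])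
      show "(\<integral>\<^sup>+w\<in>S. sqnorm (f n w) \<partial>lborel) \<le> ennreal (max 0 C)"
        using C[of n] by (rule order_trans) (intro ennreal_leI, simp)
    qed simp
    then show ?thesis by blast
  qed
  show ?thesis
  proof (rule Montel[OF S, of "range f" f])
    fix g r
    assume "g holomorphic_on S" "strict_mono (r :: nat \<Rightarrow> nat)"
      "\<And>x. x \<in> S \<Longrightarrow> ((\<lambda>n. f (r n) x) \<longlongrightarrow> g x) sequentially"
      "\<And>K. \<lbrakk>compact K; K \<subseteq> S\<rbrakk> \<Longrightarrow> uniform_limit K (f \<circ> r) g sequentially"
    then show ?thesis
      by (intro exI[of _ g] exI[of _ r]) (simp add: o_def)
  next
    fix h assume "h \<in> range f"
    then show "h holomorphic_on S" using f by blast
  qed (use bd in auto)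
qed

text \<open>
  If no constant worked, there would be functions \<open>h n\<close> of unit mass on the inner disk, of mass at most
  \<open>K\<close> on the outer disk, and sets \<open>G n\<close> of area at least \<open>\<delta>\<close> on which \<open>h n\<close> has mass tending to \<open>0\<close>.  A
  subsequence converges uniformly on the closed inner disk.  The limit \<open>g\<close> does not vanish
  identically, so its zeros are countable and the set where \<open>|g|\<close> is small has area less than \<open>\<delta> / 2\<close>.  On the rest of \<open>G n\<close>
  the functions are bounded away from \<open>0\<close>, a contradiction.
\<close>

lemma local_mass_on_dense_subset:
  fixes \<rho> R \<delta> K :: real
  assumes \<rho>: "0 < \<rho>" "\<rho> < R" and \<delta>: "0 < \<delta>"
  shows "\<exists>c>0. \<forall>h G. h holomorphic_on ball 0 R \<longrightarrow> G \<in> sets borel \<longrightarrow> G \<subseteq> ball 0 \<rho>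
    \<longrightarrow> ennreal \<delta> \<le> emeasure lborel G
    \<longrightarrow> (\<integral>\<^sup>+w\<in>ball 0 R. sqnorm (h w) \<partial>lborel)
        \<le> ennreal K * (\<integral>\<^sup>+w\<in>ball 0 \<rho>. sqnorm (h w) \<partial>lborel)
    \<longrightarrow> ennreal c * (\<integral>\<^sup>+w\<in>ball 0 \<rho>. sqnorm (h w) \<partial>lborel)
        \<le> (\<integral>\<^sup>+w\<in>G. sqnorm (h w) \<partial>lborel)"
proof (rule ccontr)
  define I where "I = (\<lambda>h E. \<integral>\<^sup>+w\<in>E. sqnorm (h w :: complex) \<partial>(lborel :: complex measure))"
  define P where "P = (\<lambda>(n::nat) h G. h holomorphic_on ball 0 R \<and> G \<in> sets borel \<and> G \<subseteq> ball 0 \<rho>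
    \<and> ennreal \<delta> \<le> emeasure lborel G \<and> I h (ball 0 R) \<le> ennreal K * I h (ball 0 \<rho>)
    \<and> I h G < ennreal (1 / Suc n) * I h (ball 0 \<rho>))"
  assume contr: "\<not> ?thesis"
  have "\<exists>h G. P n h G" for n
  proof (rule ccontr)
    assume "\<not> ?thesis"
    then have "\<forall>h G. \<not> P n h G" by blast
    then show False
      using contr unfolding P_def I_def
      by (auto simp: not_less dest!: spec[of _ "1 / real (Suc n)"])
  qed
  then have "\<exists>h G. \<forall>n. P n (h n) (G n)"
    using choice[of "\<lambda>n p. P n (fst p) (snd p)"] by fastforce
  then obtain h G where "\<And>n. P n (h n) (G n)" by blast
  then have h: "h n holomorphic_on ball 0 R" and G: "G n \<in> sets borel" "G n \<subseteq> ball 0 \<rho>"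
    "ennreal \<delta> \<le> emeasure lborel (G n)" and hK: "I (h n) (ball 0 R) \<le> ennreal K * I (h n) (ball 0 \<rho>)"
    and hG: "I (h n) (G n) < ennreal (1 / Suc n) * I (h n) (ball 0 \<rho>)" for n
    unfolding P_def by blast+
  have meas: "(\<lambda>w. if w \<in> ball 0 R then k w else 0) \<in> borel_measurable borel" if "k holomorphic_on ball 0 R" for k :: "complex \<Rightarrow> complex"
    using that by (subst measurable_restrict_space_iff[symmetric])
      (auto intro!: borel_measurable_continuous_on_restrict holomorphic_on_imp_continuous_on)
  have I_scale: "I (\<lambda>w. k w / of_real s) E = I k E / ennreal (s\<^sup>2)"
    if "k holomorphic_on ball 0 R" "E \<subseteq> ball 0 R" "E \<in> sets borel" "0 < s" for k s E
  proof -
    define k0 where "k0 = (\<lambda>w. if w \<in> ball 0 R then k w else 0)"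
    have [measurable]: "k0 \<in> borel_measurable borel" "E \<in> sets borel"
      using meas[OF that(1)] that by (auto simp: k0_def)
    have eq: "I k E = (\<integral>\<^sup>+w\<in>E. sqnorm (k0 w) \<partial>lborel)"
      using that unfolding I_def by (intro nn_integral_cong) (auto simp: k0_def indicator_def)
    have "I (\<lambda>w. k w / of_real s) E = (\<integral>\<^sup>+w. sqnorm (k0 w) * indicator E w / ennreal (s\<^sup>2) \<partial>lborel)"
      unfolding I_def using that
      by (intro nn_integral_cong) (auto simp: k0_def indicator_def norm_divide power_divide divide_ennreal)
    also have "\<dots> = I k E / ennreal (s\<^sup>2)"
      unfolding eq by (rule nn_integral_divide) measurable
    finally show ?thesis .
  qed
  have Ifin: "I (h n) (ball 0 \<rho>) < \<infinity>" for n
  proof -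
    have "h n holomorphic_on cball 0 \<rho>"
      using \<rho> by (intro holomorphic_on_subset[OF h]) auto
    then have "compact (h n ` cball 0 \<rho>)"
      by (intro compact_continuous_image holomorphic_on_imp_continuous_on) auto
    then obtain B where B: "\<And>w. w \<in> cball 0 \<rho> \<Longrightarrow> cmod (h n w) \<le> B"
      by (meson compact_imp_bounded bounded_iff imageI)
    have "I (h n) (ball 0 \<rho>) \<le> (\<integral>\<^sup>+w. ennreal (B\<^sup>2) * indicator (ball 0 \<rho>) w \<partial>(lborel::complex measure))"
      unfolding I_def using B
      by (intro nn_integral_mono) (auto simp: indicator_def intro!: ennreal_leI power_mono)
    also have "\<dots> < \<infinity>"
      using \<rho> by (simp add: nn_integral_cmult_indicator emeasure_ball unit_ball_vol_2 ennreal_mult_less_top)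
    finally show ?thesis .
  qed
  have Ipos: "0 < I (h n) (ball 0 \<rho>)" for n
    using hG[of n] by (cases "I (h n) (ball 0 \<rho>) = 0") (auto simp: zero_less_iff_neq_zero)
  define s where "s = (\<lambda>n. sqrt (enn2real (I (h n) (ball 0 \<rho>))))"
  have s: "0 < s n" "ennreal ((s n)\<^sup>2) = I (h n) (ball 0 \<rho>)" for n
    using Ipos[of n] Ifin[of n] by (auto simp: s_def enn2real_positive_iff)
  define f where "f = (\<lambda>n w. h n w / of_real (s n))"
  have f: "f n holomorphic_on ball 0 R" for n
    unfolding f_def using s(1)[of n] h by (intro holomorphic_intros) auto
  have I_f: "I (f n) E = I (h n) E / I (h n) (ball 0 \<rho>)" if "E \<subseteq> ball 0 R" "E \<in> sets borel" for n E
    using I_scale[OF h that s(1)] by (simp add: f_def s(2))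
  have f\<rho>: "I (f n) (ball 0 \<rho>) = 1" for n
  proof -
    have "I (f n) (ball 0 \<rho>) = I (h n) (ball 0 \<rho>) / I (h n) (ball 0 \<rho>)"
      using \<rho> by (intro I_f) auto
    also have "\<dots> = 1"
      using Ipos[of n] Ifin[of n] by (intro ennreal_divide_self) auto
    finally show ?thesis .
  qed
  have fR: "I (f n) (ball 0 R) \<le> ennreal K" for n
  proof -
    have "I (f n) (ball 0 R) = I (h n) (ball 0 R) / I (h n) (ball 0 \<rho>)"
      using \<rho> by (intro I_f) auto
    also have "\<dots> \<le> ennreal K * I (h n) (ball 0 \<rho>) / I (h n) (ball 0 \<rho>)"
      by (intro divide_right_mono_ennreal hK)
    also have "\<dots> = ennreal K"
      using Ipos[of n] Ifin[of n] by (intro mult_divide_eq_ennreal) auto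
    finally show ?thesis .
  qed
  have fG: "I (f n) (G n) \<le> ennreal (1 / Suc n)" for n
  proof -
    have "I (f n) (G n) = I (h n) (G n) / I (h n) (ball 0 \<rho>)"
      using \<rho> G(1,2)[of n] by (intro I_f) auto
    also have "\<dots> \<le> ennreal (1 / Suc n) * I (h n) (ball 0 \<rho>) / I (h n) (ball 0 \<rho>)"
      by (intro divide_right_mono_ennreal less_imp_le hG)
    also have "\<dots> = ennreal (1 / Suc n)"
      using Ipos[of n] Ifin[of n] by (intro mult_divide_eq_ennreal) auto
    finally show ?thesis .
  qed
  have "(\<integral>\<^sup>+w\<in>ball 0 R. sqnorm (f n w) \<partial>lborel) \<le> ennreal K" for n
    using fR[of n] by (simp only: I_def)
  from L2_bounded_normal_family[of "ball 0 R" f K, OF open_ball f this]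
  obtain g r where g: "g holomorphic_on ball 0 R" and r: "strict_mono (r :: nat \<Rightarrow> nat)"
    and ul: "\<forall>K. compact K \<longrightarrow> K \<subseteq> ball 0 R \<longrightarrow> uniform_limit K (\<lambda>n. f (r n)) g sequentially"
    by blast
  have ul\<rho>: "uniform_limit (cball 0 \<rho>) (\<lambda>n. f (r n)) g sequentially"
    using \<rho> by (intro ul[rule_format]) auto
  have close: "\<forall>\<^sub>F n in sequentially. \<forall>w\<in>cball 0 \<rho>. cmod (f (r n) w - g w) < \<epsilon>" if "\<epsilon> > 0" for \<epsilon>
    using uniform_limitD[OF ul\<rho> that] by (simp add: dist_norm)
  have "\<exists>w\<in>ball 0 \<rho>. g w \<noteq> 0"
  proof (rule ccontr)
    assume "\<not> ?thesis"
    then have g0: "\<And>w. w \<in> ball 0 \<rho> \<Longrightarrow> g w = 0" by blast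
    \<comment> \<open>Chosen so that functions below this bound have mass at most one half on the inner disk.\<close>
    define \<epsilon> where "\<epsilon> = sqrt (1 / (2 * pi * \<rho>\<^sup>2))"
    have \<epsilon>: "\<epsilon> > 0" "\<epsilon>\<^sup>2 * (pi * \<rho>\<^sup>2) = 1 / 2" using \<rho> by (auto simp: \<epsilon>_def)
    obtain n where n: "\<And>w. w \<in> cball 0 \<rho> \<Longrightarrow> cmod (f (r n) w - g w) < \<epsilon>"
      using eventually_happens'[OF _ close[OF \<epsilon>(1)]] by fastforce
    have "I (f (r n)) (ball 0 \<rho>) \<le> (\<integral>\<^sup>+w. ennreal (\<epsilon>\<^sup>2) * indicator (ball 0 \<rho>) w \<partial>(lborel::complex measure))"
      unfolding I_def
    proof (intro nn_integral_mono)
      fix w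
      have "(cmod (f (r n) w))\<^sup>2 \<le> \<epsilon>\<^sup>2" if "w \<in> ball 0 \<rho>"
        using n[of w] g0[OF that] that by (intro power_mono) auto
      then show "sqnorm (f (r n) w) * indicator (ball 0 \<rho>) w \<le> ennreal (\<epsilon>\<^sup>2) * indicator (ball 0 \<rho>) w"
        by (auto simp: indicator_def intro: ennreal_leI)
    qed
    also have "\<dots> = ennreal (\<epsilon>\<^sup>2 * (pi * \<rho>\<^sup>2))"
      using \<rho> by (subst nn_integral_cmult_indicator)
        (simp_all add: emeasure_ball unit_ball_vol_2 ennreal_mult[symmetric])
    finally have "1 \<le> \<epsilon>\<^sup>2 * (pi * \<rho>\<^sup>2)"
      unfolding f\<rho> by (simp only: ennreal_ge_1)
    then show False using \<epsilon>(2) by simp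
  qed
  then obtain w0 where w0: "w0 \<in> ball 0 R" "g w0 \<noteq> 0"
    using \<rho> by (metis mem_ball_0 order.strict_trans)
  define g0 where "g0 = (\<lambda>w. if w \<in> ball 0 R then g w else 0)"
  have [measurable]: "g0 \<in> borel_measurable borel" unfolding g0_def by (rule meas[OF g])
  define Z where "Z = (\<lambda>k::nat. {w \<in> ball 0 \<rho>. (cmod (g0 w))\<^sup>2 < 1 / Suc k})"
  have [measurable]: "Z k \<in> sets borel" for k unfolding Z_def by measurable
  have "(\<lambda>k. emeasure lborel (Z k)) \<longlonglongrightarrow> emeasure lborel (\<Inter>k. Z k)"
  proof (rule Lim_emeasure_decseq)
    show "decseq Z"
      unfolding Z_def by (intro decseq_SucI) (auto elim!: less_le_trans intro!: divide_left_mono)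
    show "emeasure lborel (Z k) \<noteq> \<infinity>" for k
    proof -
      have "emeasure lborel (Z k) \<le> emeasure lborel (ball (0::complex) \<rho>)"
        by (intro emeasure_mono) (auto simp: Z_def)
      also have "\<dots> < \<infinity>" using \<rho> by (simp add: emeasure_ball unit_ball_vol_2)
      finally show ?thesis by simp
    qed
  qed auto
  moreover have "(\<Inter>k. Z k) \<subseteq> {w \<in> ball 0 R. g w = 0}"
  proof
    fix w assume w: "w \<in> (\<Inter>k. Z k)"
    have "w \<in> Z 0" using w by blast
    then have wb: "w \<in> ball 0 R" using \<rho> by (auto simp: Z_def)
    have "(cmod (g w))\<^sup>2 < 1 / Suc k" for k
      using w wb by (auto simp: Z_def g0_def)
    then have "\<not> 0 < (cmod (g w))\<^sup>2"
      using nat_approx_posE[of "(cmod (g w))\<^sup>2"] by (metis less_asym)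
    then show "w \<in> {w \<in> ball 0 R. g w = 0}" using wb by simp
  qed
  then have "countable (\<Inter>k. Z k)"
    using countable_zeros_holomorphic[OF open_ball connected_ball g w0] countable_subset by blast
  then have "emeasure lborel (\<Inter>k. Z k) = 0"
    by (intro emeasure_lborel_countable)
  ultimately have "(\<lambda>k. emeasure lborel (Z k)) \<longlonglongrightarrow> 0" by simp
  then have "\<forall>\<^sub>F k in sequentially. emeasure lborel (Z k) < ennreal (\<delta> / 2)"
    using \<delta> by (intro order_tendstoD(2)) auto
  then obtain k where k: "emeasure lborel (Z k) < ennreal (\<delta> / 2)"
    using eventually_happens'[OF sequentially_bot] by blast
  define \<tau> where "\<tau> = sqrt (1 / Suc k)"
  have \<tau>: "\<tau> > 0" by (simp add: \<tau>_def)
  have "(\<lambda>n. 1 / Suc n) \<longlonglongrightarrow> 0" by (rule LIMSEQ_Suc[OF lim_1_over_n])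
  then have "\<forall>\<^sub>F n in sequentially. 1 / real (Suc n) < (\<tau> / 2)\<^sup>2 * (\<delta> / 2)"
    using \<tau> \<delta> by (intro order_tendstoD(2)) auto
  moreover have "\<forall>\<^sub>F n in sequentially. \<forall>w\<in>cball 0 \<rho>. cmod (f (r n) w - g w) < \<tau> / 2"
    using \<tau> by (intro close) simp
  ultimately have "\<forall>\<^sub>F n in sequentially. 1 / real (Suc n) < (\<tau> / 2)\<^sup>2 * (\<delta> / 2) \<and>
      (\<forall>w\<in>cball 0 \<rho>. cmod (f (r n) w - g w) < \<tau> / 2)"
    by (rule eventually_conj)
  then obtain n where n: "1 / real (Suc n) < (\<tau> / 2)\<^sup>2 * (\<delta> / 2)"
    "\<And>w. w \<in> cball 0 \<rho> \<Longrightarrow> cmod (f (r n) w - g w) < \<tau> / 2"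
    using eventually_happens'[OF sequentially_bot] by blast
  have "ennreal (\<delta> / 2) + ennreal (\<delta> / 2) \<le> emeasure lborel (G (r n))"
    using G(3)[of "r n"] \<delta> by (simp add: ennreal_plus[symmetric] del: ennreal_plus)
  also have "\<dots> \<le> emeasure lborel ((G (r n) - Z k) \<union> Z k)"
    using G(1)[of "r n"] by (intro emeasure_mono) auto
  also have "\<dots> \<le> emeasure lborel (G (r n) - Z k) + emeasure lborel (Z k)"
    using G(1)[of "r n"] by (intro emeasure_subadditive) auto
  also have "\<dots> \<le> emeasure lborel (G (r n) - Z k) + ennreal (\<delta> / 2)"
    using k by (intro add_left_mono) auto
  also have "\<dots> = ennreal (\<delta> / 2) + emeasure lborel (G (r n) - Z k)"
    by (rule add.commute)
  finally have "ennreal (\<delta> / 2) + ennreal (\<delta> / 2) \<le> ennreal (\<delta> / 2) + emeasure lborel (G (r n) - Z k)" .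
  then have GZ: "ennreal (\<delta> / 2) \<le> emeasure lborel (G (r n) - Z k)"
    unfolding ennreal_add_left_cancel_le by (elim disjE) simp_all
  have "ennreal ((\<tau> / 2)\<^sup>2 * (\<delta> / 2)) = ennreal ((\<tau> / 2)\<^sup>2) * ennreal (\<delta> / 2)"
    using \<delta> by (intro ennreal_mult) auto
  also have "\<dots> \<le> ennreal ((\<tau> / 2)\<^sup>2) * emeasure lborel (G (r n) - Z k)"
    by (intro mult_left_mono GZ) auto
  also have "\<dots> = (\<integral>\<^sup>+w. ennreal ((\<tau> / 2)\<^sup>2) * indicator (G (r n) - Z k) w \<partial>lborel)"
    using G(1)[of "r n"] by (subst nn_integral_cmult_indicator) auto
  also have "\<dots> \<le> I (f (r n)) (G (r n))"
    unfolding I_def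
  proof (intro nn_integral_mono)
    fix w
    have "(\<tau> / 2)\<^sup>2 \<le> (cmod (f (r n) w))\<^sup>2" if w: "w \<in> G (r n)" "w \<notin> Z k"
    proof -
      have wb: "w \<in> ball 0 \<rho>" using w G(2) by blast
      then have "w \<in> ball 0 R" using \<rho> by auto
      then have "1 / Suc k \<le> (cmod (g w))\<^sup>2" using w wb by (auto simp: Z_def g0_def)
      then have "\<tau> \<le> cmod (g w)" unfolding \<tau>_def by (intro real_le_lsqrt) auto
      moreover have "cmod (f (r n) w - g w) < \<tau> / 2" using wb by (intro n(2)) auto
      ultimately have "\<tau> / 2 \<le> cmod (f (r n) w)"
        using norm_triangle_ineq2[of "g w" "f (r n) w"] by (simp add: norm_minus_commute)
      then show ?thesis using \<tau> by (intro power_mono) auto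
    qed
    then show "ennreal ((\<tau> / 2)\<^sup>2) * indicator (G (r n) - Z k) w
        \<le> sqnorm (f (r n) w) * indicator (G (r n)) w"
      by (auto simp: indicator_def intro: ennreal_leI)
  qed
  also have "\<dots> \<le> ennreal (1 / Suc (r n))" by (rule fG)
  also have "\<dots> \<le> ennreal (1 / Suc n)"
    using seq_suble[OF r, of n] by (intro ennreal_leI divide_left_mono) auto
  finally show False using n(1) by (simp add: ennreal_le_iff)
qed

section \<open>Dominating sets for Bergman spaces\<close>

lemma borel_measurable_restrict_disk:
  assumes "g holomorphic_on \<bbbD>"
  shows "(\<lambda>z. if z \<in> \<bbbD> then g z else 0) \<in> borel_measurable borel"
  using assms by (subst measurable_restrict_space_iff[symmetric])
    (auto intro!: borel_measurable_continuous_on_restrict holomorphic_on_imp_continuous_on)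

lemma ennreal_mult_collect:
  assumes "0 \<le> p" "0 \<le> q"
  shows "ennreal p * (ennreal q * x) = ennreal (p * q) * x"
  using assms by (simp add: ennreal_mult mult.assoc)

lemma disk_swap_comparable_integrals:
  fixes F :: "complex \<Rightarrow> ennreal"
  assumes \<alpha>: "-1 < \<alpha>" "\<alpha> < 0" and a: "a \<in> \<bbbD>" and R: "R < 1"
    and E: "E \<subseteq> ball 0 R" "E \<in> sets borel" and F: "F \<in> borel_measurable borel"
  shows "ennreal ((1 - R)\<^sup>2 / 16 * ((1 - (cmod a)\<^sup>2)\<^sup>2 * disk_weight \<alpha> a)) * (\<integral>\<^sup>+u\<in>E. F (disk_swap a u) \<partial>lborel)
      \<le> (\<integral>\<^sup>+w\<in>disk_swap a ` E. F w * ennreal (disk_weight \<alpha> w) \<partial>lborel)" (is ?lower)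
    and "(\<integral>\<^sup>+w\<in>disk_swap a ` E. F w * ennreal (disk_weight \<alpha> w) \<partial>lborel)
      \<le> ennreal (4 / (1 - R) ^ 5 * ((1 - (cmod a)\<^sup>2)\<^sup>2 * disk_weight \<alpha> a)) * (\<integral>\<^sup>+u\<in>E. F (disk_swap a u) \<partial>lborel)"
      (is ?upper)
proof -
  note [measurable] = F E(2)
  have ED: "E \<subseteq> \<bbbD>" using E R by auto
  define J where "J = (\<lambda>u. disk_weight \<alpha> (disk_swap a u) * (cmod (deriv (disk_swap a) u))\<^sup>2)"
  have eq: "(\<integral>\<^sup>+w\<in>disk_swap a ` E. F w * ennreal (disk_weight \<alpha> w) \<partial>lborel)
      = (\<integral>\<^sup>+u. F (disk_swap a u) * indicator E u * ennreal (J u) \<partial>lborel)"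
  proof -
    have "(\<integral>\<^sup>+w\<in>disk_swap a ` E. F w * ennreal (disk_weight \<alpha> w) \<partial>lborel)
      = (\<integral>\<^sup>+u\<in>E. F (disk_swap a u) * ennreal (disk_weight \<alpha> (disk_swap a u))
           * sqnorm (deriv (disk_swap a) u) \<partial>lborel)"
      by (intro nn_integral_disk_swap_image[OF a ED E(2)]) measurable
    also have "\<dots> = (\<integral>\<^sup>+u. F (disk_swap a u) * indicator E u * ennreal (J u) \<partial>lborel)"
      by (intro nn_integral_cong) (simp add: J_def ennreal_mult mult_ac)
    finally show ?thesis .
  qed
  have J: "(1 - R)\<^sup>2 / 16 * ((1 - (cmod a)\<^sup>2)\<^sup>2 * disk_weight \<alpha> a) \<le> J u"
    "J u \<le> 4 / (1 - R) ^ 5 * ((1 - (cmod a)\<^sup>2)\<^sup>2 * disk_weight \<alpha> a)" if "u \<in> E" for u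
    unfolding J_def using disk_swap_jacobian_comparable[OF \<alpha> a _ R, of u] that E by auto
  have const: "ennreal c * (\<integral>\<^sup>+u\<in>E. F (disk_swap a u) \<partial>lborel)
      = (\<integral>\<^sup>+u. F (disk_swap a u) * indicator E u * ennreal c \<partial>lborel)" for c
    by (subst nn_integral_multc) (measurable, simp add: mult.commute)
  show ?lower
    unfolding eq const
  proof (intro nn_integral_mono)
    fix u
    show "F (disk_swap a u) * indicator E u * ennreal ((1 - R)\<^sup>2 / 16 * ((1 - (cmod a)\<^sup>2)\<^sup>2 * disk_weight \<alpha> a))
      \<le> F (disk_swap a u) * indicator E u * ennreal (J u)"
      using J(1)[of u] by (cases "u \<in> E") (auto intro!: mult_left_mono ennreal_leI simp del: times_divide_eq_left)
  qed
  show ?upper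
    unfolding eq const
  proof (intro nn_integral_mono)
    fix u
    show "F (disk_swap a u) * indicator E u * ennreal (J u)
      \<le> F (disk_swap a u) * indicator E u * ennreal (4 / (1 - R) ^ 5 * ((1 - (cmod a)\<^sup>2)\<^sup>2 * disk_weight \<alpha> a))"
      using J(2)[of u] by (cases "u \<in> E") (auto intro!: mult_left_mono ennreal_leI simp del: times_divide_eq_left)
  qed
qed

text \<open>
  The transport to a disk about the origin distorts weighted area by constants that do not depend on \<open>a\<close>,
  so relative density at every \<open>a\<close> becomes an absolute lower bound for the area of the transported set.
\<close>

lemma disk_swap_transport_density:
  assumes \<alpha>: "-1 < \<alpha>" "\<alpha> < 0" and \<rho>: "0 < \<rho>" "\<rho> < R" "R < 1" and \<delta>: "0 < \<delta>"
    and G: "G \<in> sets borel" and a: "a \<in> \<bbbD>"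
    and dens: "ennreal \<delta> * weighted_mass \<alpha> (pseudo_disk a \<rho>)
      \<le> weighted_mass \<alpha> (G \<inter> pseudo_disk a \<rho>)"
  shows "ennreal (\<delta> * ((1 - R)\<^sup>2 / 16) * (pi * \<rho>\<^sup>2) / (4 / (1 - R) ^ 5))
    \<le> emeasure lborel (ball 0 \<rho> \<inter> disk_swap a -` G)"
proof -
  define s where "s = (1 - (cmod a)\<^sup>2)\<^sup>2 * disk_weight \<alpha> a"
  have s: "0 < s" using a cmod_sq_lt_1[OF a] by (simp add: s_def)
  define c where "c = (1 - R)\<^sup>2 / 16"
  define C where "C = 4 / (1 - R) ^ 5"
  have cC: "0 < c" "0 < C" using \<rho> by (auto simp: c_def C_def)
  note [measurable] = G
  define Ga where "Ga = ball 0 \<rho> \<inter> disk_swap a -` G"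
  have "disk_swap a -` G \<in> sets borel"
    using measurable_sets[OF borel_measurable_disk_swap[of a] G] by simp
  then have Ga: "Ga \<in> sets borel" "Ga \<subseteq> ball 0 R" using \<rho> by (auto simp: Ga_def)
  have b\<rho>: "ball 0 \<rho> \<in> sets borel" "(ball 0 \<rho> :: complex set) \<subseteq> ball 0 R" using \<rho> by auto
  have pd: "pseudo_disk a \<rho> = disk_swap a ` ball 0 \<rho>"
    using \<rho> by (intro pseudo_disk_eq_image[OF a]) auto
  have pdG: "G \<inter> pseudo_disk a \<rho> = disk_swap a ` Ga"
    unfolding pd Ga_def by blast
  have one: "(\<lambda>_::complex. 1::ennreal) \<in> borel_measurable borel" by simp
  have "ennreal (\<delta> * c * (pi * \<rho>\<^sup>2) * s) = ennreal \<delta> * (ennreal (c * s) * (\<integral>\<^sup>+u\<in>ball 0 \<rho>. 1 \<partial>(lborel::complex measure)))"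
    using \<delta> cC s \<rho> by (simp add: emeasure_ball unit_ball_vol_2 ennreal_mult[symmetric] mult_ac)
  also have "\<dots> \<le> ennreal \<delta> * (\<integral>\<^sup>+w\<in>pseudo_disk a \<rho>. 1 * ennreal (disk_weight \<alpha> w) \<partial>lborel)"
    unfolding pd c_def s_def
    by (intro mult_left_mono disk_swap_comparable_integrals(1)[OF \<alpha> a \<rho>(3) b\<rho>(2,1) one]) auto
  also have "\<dots> \<le> (\<integral>\<^sup>+w\<in>G \<inter> pseudo_disk a \<rho>. 1 * ennreal (disk_weight \<alpha> w) \<partial>lborel)"
    using dens by simp
  also have "\<dots> \<le> ennreal (C * s) * (\<integral>\<^sup>+u\<in>Ga. 1 \<partial>(lborel::complex measure))"
    unfolding pdG C_def s_def
    by (rule disk_swap_comparable_integrals(2)[OF \<alpha> a \<rho>(3) Ga(2,1) one])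
  also have "\<dots> = ennreal (C * s) * emeasure lborel Ga"
    using Ga by simp
  finally have "ennreal (\<delta> * c * (pi * \<rho>\<^sup>2) * s) \<le> ennreal (C * s) * emeasure lborel Ga" .
  then have "ennreal (1 / (C * s)) * ennreal (\<delta> * c * (pi * \<rho>\<^sup>2) * s) \<le> ennreal (1 / (C * s)) * (ennreal (C * s) * emeasure lborel Ga)"
    by (intro mult_left_mono) auto
  also have "\<dots> = emeasure lborel Ga"
    using cC s by (simp add: mult.assoc[symmetric] ennreal_mult[symmetric])
  also have "ennreal (1 / (C * s)) * ennreal (\<delta> * c * (pi * \<rho>\<^sup>2) * s) = ennreal (\<delta> * c * (pi * \<rho>\<^sup>2) / C)"
    using cC s \<delta> by (simp add: ennreal_mult[symmetric])
  finally show ?thesis by (simp add: c_def C_def Ga_def)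
qed

text \<open>
  Luecking's theorem on dominating sets.  Let \<open>P\<close>, \<open>Q\<close> and \<open>PG\<close> be the masses of \<open>|g|\<^sup>2\<close> on the disk of
  radius \<open>\<rho>\<close> about \<open>a\<close>, on the larger disk of radius \<open>R\<close>, and on the part of the first disk in \<open>G\<close>.
  If \<open>Q \<le> K P\<close>, the local estimate gives \<open>c1 P \<le> PG\<close>; otherwise \<open>c1 P \<le> (c1 / K) Q\<close>.  So
  \<open>c1 P \<le> PG + (c1 / K) Q\<close> at every centre.  Averaging over the centres turns \<open>P\<close>, \<open>PG\<close> and \<open>Q\<close> into
  multiples of the total masses, and for large \<open>K\<close> the last term is absorbed in the left-hand side,
  which is possible because the norm of \<open>g\<close> is finite.
\<close>

theorem dominating_set_if_hyperbolically_dense: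
  assumes \<alpha>: "-1 < \<alpha>" "\<alpha> < 0" and \<rho>: "0 < \<rho>" "\<rho> < 1" and \<delta>: "0 < \<delta>"
    and G[measurable]: "G \<in> sets borel" and GD: "G \<subseteq> \<bbbD>"
    and dens: "\<And>a. a \<in> \<bbbD> \<Longrightarrow> ennreal \<delta> * weighted_mass \<alpha> (pseudo_disk a \<rho>)
      \<le> weighted_mass \<alpha> (G \<inter> pseudo_disk a \<rho>)"
  shows "\<exists>c>0. \<forall>g. g holomorphic_on \<bbbD> \<longrightarrow>
      (\<integral>\<^sup>+w\<in>\<bbbD>. sqnorm (g w) * ennreal (disk_weight \<alpha> w) \<partial>lborel) < \<infinity> \<longrightarrow>
      ennreal c * (\<integral>\<^sup>+w\<in>\<bbbD>. sqnorm (g w) * ennreal (disk_weight \<alpha> w) \<partial>lborel)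
      \<le> (\<integral>\<^sup>+w\<in>G. sqnorm (g w) * ennreal (disk_weight \<alpha> w) \<partial>lborel)"
proof -
  define R where "R = (1 + \<rho>) / 2"
  have R: "\<rho> < R" "R < 1" "0 < R" using \<rho> by (auto simp: R_def)
  define b where "b = (1 - R)\<^sup>2 / 16"
  define B where "B = 4 / (1 - R) ^ 5"
  have bB: "0 < b" "0 < B" using R by (auto simp: b_def B_def)
  define \<kappa> where "\<kappa> = (\<lambda>\<rho>. enn2real (pseudo_disk_hyp_area \<rho>))"
  have \<kappa>: "0 < \<kappa> t" "pseudo_disk_hyp_area t = ennreal (\<kappa> t)" if "0 < t" "t < 1" for t
    using pseudo_disk_hyp_area_finite[OF that(2)] pseudo_disk_hyp_area_pos[OF that]
    by (auto simp: \<kappa>_def enn2real_positive_iff)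
  \<comment> \<open>The choice that makes the bad centres account for at most half of the norm.\<close>
  define K where "K = 2 * \<kappa> R / \<kappa> \<rho>"
  have K: "0 < K" using \<kappa>[of R] \<kappa>[of \<rho>] R \<rho> by (simp add: K_def)
  define \<delta>' where "\<delta>' = \<delta> * b * (pi * \<rho>\<^sup>2) / B"
  have \<delta>': "0 < \<delta>'" using \<delta> bB \<rho> by (simp add: \<delta>'_def)
  obtain c0 where c0: "0 < c0" and local: "\<And>h E. h holomorphic_on ball 0 R \<Longrightarrow> E \<in> sets borel \<Longrightarrow> E \<subseteq> ball 0 \<rho>
    \<Longrightarrow> ennreal \<delta>' \<le> emeasure lborel E
    \<Longrightarrow> (\<integral>\<^sup>+w\<in>ball 0 R. sqnorm (h w) \<partial>lborel)
        \<le> ennreal (K * B / b) * (\<integral>\<^sup>+w\<in>ball 0 \<rho>. sqnorm (h w) \<partial>lborel)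
    \<Longrightarrow> ennreal c0 * (\<integral>\<^sup>+w\<in>ball 0 \<rho>. sqnorm (h w) \<partial>lborel)
        \<le> (\<integral>\<^sup>+w\<in>E. sqnorm (h w) \<partial>lborel)"
    using local_mass_on_dense_subset[OF \<rho>(1) R(1) \<delta>', of "K * B / b"] by blast
  define c1 where "c1 = c0 * b / B"
  have c1: "0 < c1" using c0 bB by (simp add: c1_def)
  have main: "ennreal (c1 / 2) * (\<integral>\<^sup>+w\<in>\<bbbD>. sqnorm (g w) * ennreal (disk_weight \<alpha> w) \<partial>lborel)
      \<le> (\<integral>\<^sup>+w\<in>G. sqnorm (g w) * ennreal (disk_weight \<alpha> w) \<partial>lborel)"
    if g: "g holomorphic_on \<bbbD>"
      and fin: "(\<integral>\<^sup>+w\<in>\<bbbD>. sqnorm (g w) * ennreal (disk_weight \<alpha> w) \<partial>lborel) < \<infinity>" for g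
  proof -
    define F where "F = (\<lambda>w. sqnorm (if w \<in> \<bbbD> then g w else 0))"
    have F[measurable]: "F \<in> borel_measurable borel"
      unfolding F_def using borel_measurable_restrict_disk[OF g] by measurable
    define u where "u = (\<lambda>w. F w * ennreal (disk_weight \<alpha> w))"
    have u[measurable]: "u \<in> borel_measurable borel" unfolding u_def by measurable
    define uG where "uG = (\<lambda>w. u w * indicator G w)"
    have uG[measurable]: "uG \<in> borel_measurable borel" unfolding uG_def by measurable
    define X where "X = (\<integral>\<^sup>+w\<in>\<bbbD>. u w \<partial>lborel)"
    have Xeq: "X = (\<integral>\<^sup>+w\<in>\<bbbD>. sqnorm (g w) * ennreal (disk_weight \<alpha> w) \<partial>lborel)"
      unfolding X_def u_def F_def by (intro nn_integral_cong) (auto simp: indicator_def)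
    define Y where "Y = (\<integral>\<^sup>+w\<in>\<bbbD>. uG w \<partial>lborel)"
    have Yeq: "Y = (\<integral>\<^sup>+w\<in>G. sqnorm (g w) * ennreal (disk_weight \<alpha> w) \<partial>lborel)"
      unfolding Y_def uG_def u_def F_def using GD by (intro nn_integral_cong) (auto simp: indicator_def)
    define P where "P = (\<lambda>a. \<integral>\<^sup>+w\<in>pseudo_disk a \<rho>. u w \<partial>lborel)"
    define Q where "Q = (\<lambda>a. \<integral>\<^sup>+w\<in>pseudo_disk a R. u w \<partial>lborel)"
    define PG where "PG = (\<lambda>a. \<integral>\<^sup>+w\<in>pseudo_disk a \<rho>. uG w \<partial>lborel)"
    have [measurable]: "P \<in> borel_measurable borel" "Q \<in> borel_measurable borel" "PG \<in> borel_measurable borel"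
      unfolding P_def Q_def PG_def by (intro borel_measurable_pseudo_disk_integral u uG)+
    have pt: "ennreal c1 * P a \<le> PG a + ennreal (c1 / K) * Q a" if a: "a \<in> \<bbbD>" for a
    proof (cases "Q a \<le> ennreal K * P a")
      case False
      have "ennreal c1 * P a = ennreal (c1 / K) * (ennreal K * P a)"
        using c1 K by (simp add: mult.assoc[symmetric] ennreal_mult[symmetric])
      also have "\<dots> \<le> ennreal (c1 / K) * Q a"
        using False by (intro mult_left_mono) auto
      also have "\<dots> \<le> PG a + ennreal (c1 / K) * Q a" by simp
      finally show ?thesis .
    next
      case True
      define s where "s = (1 - (cmod a)\<^sup>2)\<^sup>2 * disk_weight \<alpha> a"
      have s: "0 < s" using a cmod_sq_lt_1[OF a] by (simp add: s_def)
      define h where "h = g \<circ> disk_swap a"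
      have subR: "ball 0 R \<subseteq> \<bbbD>" using R by auto
      have h: "h holomorphic_on ball 0 R"
        unfolding h_def using disk_swap_in_disk[OF a] subR
        by (intro holomorphic_on_compose_gen[OF holomorphic_on_subset[OF holomorphic_disk_swap[OF a] subR] g])
          auto
      have Fh: "(\<integral>\<^sup>+z\<in>E. F (disk_swap a z) \<partial>lborel) = (\<integral>\<^sup>+z\<in>E. sqnorm (h z) \<partial>lborel)"
        if "E \<subseteq> ball 0 R" for E
        using that subR disk_swap_in_disk[OF a]
        by (intro nn_integral_cong) (auto simp: F_def h_def indicator_def)
      define E where "E = ball 0 \<rho> \<inter> disk_swap a -` G"
      have "disk_swap a -` G \<in> sets borel"
        using measurable_sets[OF borel_measurable_disk_swap[of a] G] by simp
      then have E: "E \<in> sets borel" "E \<subseteq> ball 0 \<rho>" "E \<subseteq> ball 0 R" using R by (auto simp: E_def)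
      have b\<rho>: "(ball 0 \<rho> :: complex set) \<subseteq> ball 0 R" using R by auto
      have pd: "pseudo_disk a t = disk_swap a ` ball 0 t" if "t \<le> 1" for t
        using that by (rule pseudo_disk_eq_image[OF a])
      have Pd: "P a = (\<integral>\<^sup>+w\<in>disk_swap a ` ball 0 \<rho>. F w * ennreal (disk_weight \<alpha> w) \<partial>lborel)"
        using \<rho> pd[of \<rho>] by (simp add: P_def u_def)
      have Qd: "Q a = (\<integral>\<^sup>+w\<in>disk_swap a ` ball 0 R. F w * ennreal (disk_weight \<alpha> w) \<partial>lborel)"
        using R pd[of R] by (simp add: Q_def u_def)
      have "G \<inter> pseudo_disk a \<rho> = disk_swap a ` E"
        using \<rho> by (subst pd) (auto simp: E_def)
      then have PGd: "PG a = (\<integral>\<^sup>+w\<in>disk_swap a ` E. F w * ennreal (disk_weight \<alpha> w) \<partial>lborel)"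
        unfolding PG_def uG_def u_def by (intro nn_integral_cong) (auto simp: indicator_def)
      have Plo: "P a \<le> ennreal (B * s) * (\<integral>\<^sup>+z\<in>ball 0 \<rho>. sqnorm (h z) \<partial>lborel)"
        using disk_swap_comparable_integrals(2)[OF \<alpha> a R(2) b\<rho> _ F]
        by (simp add: Pd B_def s_def Fh[OF b\<rho>])
      have Qlo: "ennreal (b * s) * (\<integral>\<^sup>+z\<in>ball 0 R. sqnorm (h z) \<partial>lborel) \<le> Q a"
        using disk_swap_comparable_integrals(1)[OF \<alpha> a R(2) order_refl _ F]
        by (simp add: Qd b_def s_def Fh[OF order_refl])
      have PGlo: "ennreal (b * s) * (\<integral>\<^sup>+z\<in>E. sqnorm (h z) \<partial>lborel) \<le> PG a"
        using disk_swap_comparable_integrals(1)[OF \<alpha> a R(2) E(3,1) F]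
        by (simp add: PGd b_def s_def Fh[OF E(3)])
      have "(\<integral>\<^sup>+z\<in>ball 0 R. sqnorm (h z) \<partial>lborel)
          = ennreal (1 / (b * s)) * (ennreal (b * s) * (\<integral>\<^sup>+z\<in>ball 0 R. sqnorm (h z) \<partial>lborel))"
        using bB s by (subst ennreal_mult_collect) auto
      also have "\<dots> \<le> ennreal (1 / (b * s)) * Q a"
        by (intro mult_left_mono Qlo) simp
      also have "ennreal (1 / (b * s)) * Q a
          \<le> ennreal (1 / (b * s)) * (ennreal K * (ennreal (B * s) * (\<integral>\<^sup>+z\<in>ball 0 \<rho>. sqnorm (h z) \<partial>lborel)))"
        using Plo by (intro mult_left_mono order_trans[OF True]) auto
      also have "\<dots> = ennreal (K * B / b) * (\<integral>\<^sup>+z\<in>ball 0 \<rho>. sqnorm (h z) \<partial>lborel)"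
      proof -
        have "1 / (b * s) * (K * (B * s)) = K * B / b" using bB s by simp
        then show ?thesis
          using bB s K by (subst ennreal_mult_collect, simp, simp, subst ennreal_mult_collect) auto
      qed
      finally have doubling: "(\<integral>\<^sup>+z\<in>ball 0 R. sqnorm (h z) \<partial>lborel)
          \<le> ennreal (K * B / b) * (\<integral>\<^sup>+z\<in>ball 0 \<rho>. sqnorm (h z) \<partial>lborel)" .
      have "ennreal \<delta>' \<le> emeasure lborel E"
        unfolding \<delta>'_def b_def B_def E_def
        by (rule disk_swap_transport_density[OF \<alpha> \<rho>(1) R(1,2) \<delta> G a dens[OF a]])
      note loc = local[OF h E(1,2) this doubling]
      have "ennreal c1 * P a \<le> ennreal c1 * (ennreal (B * s) * (\<integral>\<^sup>+z\<in>ball 0 \<rho>. sqnorm (h z) \<partial>lborel))"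
        by (intro mult_left_mono Plo) auto
      also have "\<dots> = ennreal (b * s) * (ennreal c0 * (\<integral>\<^sup>+z\<in>ball 0 \<rho>. sqnorm (h z) \<partial>lborel))"
      proof -
        have e: "c1 * (B * s) = b * s * c0" using bB by (simp add: c1_def)
        have nn: "0 \<le> c1" "0 \<le> B * s" "0 \<le> b * s" "0 \<le> c0" using bB s c0 c1 by auto
        show ?thesis
          unfolding ennreal_mult_collect[OF nn(1,2)] ennreal_mult_collect[OF nn(3,4)] e ..
      qed
      also have "\<dots> \<le> ennreal (b * s) * (\<integral>\<^sup>+z\<in>E. sqnorm (h z) \<partial>lborel)"
        by (intro mult_left_mono loc) auto
      also have "\<dots> \<le> PG a" by (rule PGlo)
      also have "\<dots> \<le> PG a + ennreal (c1 / K) * Q a" by simp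
      finally show ?thesis .
    qed
    define v where "v = (\<lambda>a::complex. ennreal (1 / (1 - (cmod a)\<^sup>2)\<^sup>2))"
    have [measurable]: "v \<in> borel_measurable borel" unfolding v_def by measurable
    have avg: "(\<integral>\<^sup>+a\<in>\<bbbD>. v a * P a \<partial>lborel) = ennreal (\<kappa> \<rho>) * X"
      "(\<integral>\<^sup>+a\<in>\<bbbD>. v a * PG a \<partial>lborel) = ennreal (\<kappa> \<rho>) * Y"
      "(\<integral>\<^sup>+a\<in>\<bbbD>. v a * Q a \<partial>lborel) = ennreal (\<kappa> R) * X"
      unfolding v_def P_def PG_def Q_def X_def Y_def
      using \<rho> R \<kappa>(2)[of \<rho>] \<kappa>(2)[of R]
      by (simp_all add: nn_integral_pseudo_disk_average)
    have "ennreal c1 * (ennreal (\<kappa> \<rho>) * X) = (\<integral>\<^sup>+a. ennreal c1 * (v a * P a * indicator \<bbbD> a) \<partial>lborel)"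
      unfolding avg(1)[symmetric] by (intro nn_integral_cmult[symmetric]) measurable
    also have "\<dots> \<le> (\<integral>\<^sup>+a. v a * PG a * indicator \<bbbD> a + ennreal (c1 / K) * (v a * Q a * indicator \<bbbD> a) \<partial>lborel)"
    proof (intro nn_integral_mono)
      fix a :: complex
      show "ennreal c1 * (v a * P a * indicator \<bbbD> a)
          \<le> v a * PG a * indicator \<bbbD> a + ennreal (c1 / K) * (v a * Q a * indicator \<bbbD> a)"
      proof (cases "a \<in> \<bbbD>")
        case True
        have "v a * (ennreal c1 * P a) \<le> v a * (PG a + ennreal (c1 / K) * Q a)"
          by (intro mult_left_mono pt True) simp
        then show ?thesis using True by (simp add: distrib_left mult_ac)
      qed simp
    qed
    also have "\<dots> = ennreal (\<kappa> \<rho>) * Y + ennreal (c1 / K) * (ennreal (\<kappa> R) * X)"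
      unfolding avg(2,3)[symmetric]
      by (subst nn_integral_add) (simp_all add: nn_integral_cmult)
    finally have le: "ennreal c1 * (ennreal (\<kappa> \<rho>) * X) \<le> ennreal (\<kappa> \<rho>) * Y + ennreal (c1 / K) * (ennreal (\<kappa> R) * X)" .
    obtain x where x: "X = ennreal x" "0 \<le> x" 
    proof -
      have "X < \<infinity>" unfolding Xeq by (rule fin)
      then show ?thesis using that by (cases X) auto
    qed
    have \<kappa>p: "0 < \<kappa> \<rho>" "0 < \<kappa> R" using \<kappa>(1) R \<rho> by auto
    have "ennreal (c1 / 2) * X \<le> Y"
    proof (cases Y)
      case (real y)
      have "c1 * (\<kappa> \<rho> * x) \<le> \<kappa> \<rho> * y + c1 / K * (\<kappa> R * x)"
        using le real x c1 K \<kappa>p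
        by (simp add: ennreal_mult[symmetric] ennreal_plus[symmetric] ennreal_le_iff del: ennreal_plus)
      moreover have "c1 / K * (\<kappa> R * x) = c1 * (\<kappa> \<rho> * x) / 2"
        using \<kappa>p by (simp add: K_def field_simps)
      moreover have "\<kappa> \<rho> * (c1 / 2 * x) = c1 * (\<kappa> \<rho> * x) / 2" by simp
      ultimately have "\<kappa> \<rho> * (c1 / 2 * x) \<le> \<kappa> \<rho> * y" by linarith
      then have "c1 / 2 * x \<le> y" using \<kappa>p by simp
      then show ?thesis using real x c1 by (simp add: ennreal_mult[symmetric] ennreal_leI)
    qed simp
    then show ?thesis unfolding Xeq Yeq .
  qed
  show ?thesis
    by (rule exI[of _ "c1 / 2"]) (use c1 main in auto)
qed

section \<open>Energies, the counting function and the tail condition\<close>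

lemma counting_fun_eq_preimage_sum: "counting_fun \<phi> \<alpha> = preimage_sum \<bbbD> \<phi> (disk_weight \<alpha>)"
  by (simp add: fun_eq_iff counting_fun_def preimage_sum_def)

lemma continuous_on_disk_weight: "continuous_on \<bbbD> (disk_weight \<alpha>)"
proof (intro continuous_on_powr continuous_intros ballI)
  fix z :: complex assume "z \<in> \<bbbD>"
  then show "1 - (cmod z)\<^sup>2 \<noteq> 0" using abs_square_less_1[of "cmod z"] by simp
qed

lemma holomorphic_deriv_sq_measurable:
  assumes "f holomorphic_on \<bbbD>"
  shows "(\<lambda>z. sqnorm (if z \<in> \<bbbD> then deriv f z else 0)) \<in> borel_measurable borel"
    and "(\<lambda>z. sqnorm (deriv f z)) \<in> borel_measurable (restrict_space borel \<bbbD>)"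
proof -
  have d: "deriv f holomorphic_on \<bbbD>" using assms by (intro holomorphic_deriv) auto
  show "(\<lambda>z. sqnorm (if z \<in> \<bbbD> then deriv f z else 0)) \<in> borel_measurable borel"
    using borel_measurable_restrict_disk[OF d] by measurable
  have "deriv f \<in> borel_measurable (restrict_space borel \<bbbD>)"
    using d by (intro borel_measurable_disk_continuous holomorphic_on_imp_continuous_on)
  then show "(\<lambda>z. sqnorm (deriv f z)) \<in> borel_measurable (restrict_space borel \<bbbD>)"
    by measurable
qed

text \<open>
  The Dirichlet integral without the normalising factor \<open>(1 + \<alpha>) / \<pi>\<close>, over plain Lebesgue measure.
\<close>

definition weighted_energy :: "real \<Rightarrow> (complex \<Rightarrow> complex) \<Rightarrow> ennreal"
  where "weighted_energy \<alpha> f = (\<integral>\<^sup>+z\<in>\<bbbD>. sqnorm (deriv f z) * ennreal (disk_weight \<alpha> z) \<partial>lborel)"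

lemma dirichlet_normsq_eq_energy:
  assumes "f holomorphic_on \<bbbD>" "-1 < \<alpha>"
  shows "dirichlet_normsq \<alpha> f = sqnorm (f 0) + ennreal ((1 + \<alpha>) / pi) * weighted_energy \<alpha> f"
  unfolding dirichlet_normsq_def weighted_energy_def
  by (subst nn_integral_weighted_area[OF holomorphic_deriv_sq_measurable(2)[OF assms(1)] assms(2)]) simp

lemma weighted_energy_finite:
  assumes "f \<in> dirichlet_space \<alpha>" "-1 < \<alpha>"
  shows "weighted_energy \<alpha> f < \<infinity>"
proof -
  have "ennreal ((1 + \<alpha>) / pi) * weighted_energy \<alpha> f < \<infinity>"
    using assms dirichlet_normsq_eq_energy[of f \<alpha>] by (auto simp: dirichlet_space_def)
  then show ?thesis using assms(2) by (auto simp: ennreal_mult_less_top)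
qed

lemma deriv_eq_on_disk:
  assumes "\<And>z. z \<in> \<bbbD> \<Longrightarrow> f z = g z" "z \<in> \<bbbD>"
  shows "deriv f z = deriv g z"
proof (rule deriv_cong_ev)
  show "\<forall>\<^sub>F x in nhds z. f x = g x"
    using assms by (auto simp: eventually_nhds intro!: exI[of _ \<bbbD>])
qed simp

lemma restrict_minus_const:
  assumes f: "f holomorphic_on \<bbbD>"
  shows "restrict (\<lambda>z. f z - c) \<bbbD> holomorphic_on \<bbbD>"
    and "z \<in> \<bbbD> \<Longrightarrow> deriv (restrict (\<lambda>z. f z - c) \<bbbD>) z = deriv f z"
proof -
  show "restrict (\<lambda>z. f z - c) \<bbbD> holomorphic_on \<bbbD>"
    by (rule holomorphic_transform[of "\<lambda>z. f z - c"]) (auto intro!: holomorphic_intros f)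
  assume z: "z \<in> \<bbbD>"
  have "deriv (restrict (\<lambda>z. f z - c) \<bbbD>) z = deriv (\<lambda>z. f z - c) z"
    by (rule deriv_eq_on_disk[OF _ z]) simp
  also have "\<dots> = deriv f z"
    using holomorphic_on_imp_differentiable_at[OF f open_ball z] by simp
  finally show "deriv (restrict (\<lambda>z. f z - c) \<bbbD>) z = deriv f z" .
qed

text \<open>
  The tail condition speaks of functions vanishing at \<open>0\<close> only; subtracting \<open>f(0)\<close> changes neither the
  derivative nor any energy.
\<close>

lemma recentre_in_dirichlet_space0:
  assumes fD: "f \<in> dirichlet_space \<alpha>" and \<alpha>: "-1 < \<alpha>"
  shows "\<exists>h\<in>dirichlet_space0 \<alpha>. (\<forall>z\<in>\<bbbD>. deriv h z = deriv f z) \<and> weighted_energy \<alpha> h = weighted_energy \<alpha> f"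
proof (intro bexI[of _ "restrict (\<lambda>z. f z - f 0) \<bbbD>"] conjI ballI)
  let ?h = "restrict (\<lambda>z. f z - f 0) \<bbbD>"
  have f: "f holomorphic_on \<bbbD>" using fD by (simp add: dirichlet_space_def)
  note h = restrict_minus_const[OF f, where c = "f 0"]
  show "deriv ?h z = deriv f z" if "z \<in> \<bbbD>" for z using h(2)[OF that] .
  show e: "weighted_energy \<alpha> ?h = weighted_energy \<alpha> f"
    unfolding weighted_energy_def by (intro nn_integral_cong) (auto simp: indicator_def h(2))
  have "dirichlet_normsq \<alpha> ?h = ennreal ((1 + \<alpha>) / pi) * weighted_energy \<alpha> f"
    unfolding dirichlet_normsq_eq_energy[OF h(1) \<alpha>] e by simp
  then have "dirichlet_normsq \<alpha> ?h < \<infinity>"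
    using weighted_energy_finite[OF fD \<alpha>] by (simp add: ennreal_mult_less_top)
  then show "?h \<in> dirichlet_space0 \<alpha>"
    using h(1) by (simp add: dirichlet_space0_def dirichlet_space_def)
qed

lemma dirichlet_normsq_cong:
  assumes "\<And>z. z \<in> \<bbbD> \<Longrightarrow> f z = g z"
  shows "dirichlet_normsq \<alpha> f = dirichlet_normsq \<alpha> g"
proof -
  have "(\<integral>\<^sup>+ z. sqnorm (deriv f z) \<partial>weighted_area \<alpha>) = (\<integral>\<^sup>+ z. sqnorm (deriv g z) \<partial>weighted_area \<alpha>)"
    using deriv_eq_on_disk[OF assms] by (intro nn_integral_cong) auto
  then show ?thesis using assms[of 0] by (simp add: dirichlet_normsq_def)
qed

lemma dirichlet_normsq_scale:
  assumes f: "f holomorphic_on \<bbbD>"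
  shows "dirichlet_normsq \<alpha> (\<lambda>z. of_real s * f z) = ennreal (s\<^sup>2) * dirichlet_normsq \<alpha> f"
proof -
  have "(\<integral>\<^sup>+ z. sqnorm (deriv (\<lambda>z. of_real s * f z) z) \<partial>weighted_area \<alpha>)
      = (\<integral>\<^sup>+ z. ennreal (s\<^sup>2) * sqnorm (deriv f z) \<partial>weighted_area \<alpha>)"
  proof (intro nn_integral_cong)
    fix z assume "z \<in> space (weighted_area \<alpha>)"
    then have "f field_differentiable at z"
      using f by (intro holomorphic_on_imp_differentiable_at[of f \<bbbD>]) auto
    then show "sqnorm (deriv (\<lambda>z. of_real s * f z) z) = ennreal (s\<^sup>2) * sqnorm (deriv f z)"
      by (simp add: norm_mult power_mult_distrib ennreal_mult)
  qed
  also have "\<dots> = ennreal (s\<^sup>2) * (\<integral>\<^sup>+ z. sqnorm (deriv f z) \<partial>weighted_area \<alpha>)"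
    using measurable_deriv_sq[OF f] by (rule nn_integral_cmult)
  finally show ?thesis
    by (simp add: dirichlet_normsq_def norm_mult power_mult_distrib ennreal_mult distrib_left)
qed

lemma dirichlet_norm_sq: "f \<in> dirichlet_space \<alpha> \<Longrightarrow> dirichlet_normsq \<alpha> f = ennreal ((dirichlet_norm \<alpha> f)\<^sup>2)"
  by (simp add: dirichlet_norm_def dirichlet_space_def)

lemma scale_in_dirichlet_space:
  assumes "f \<in> dirichlet_space \<alpha>"
  shows "restrict (\<lambda>z. of_real s * f z) \<bbbD> \<in> dirichlet_space \<alpha>"
proof -
  have f: "f holomorphic_on \<bbbD>" using assms by (simp add: dirichlet_space_def)
  have "dirichlet_normsq \<alpha> (restrict (\<lambda>z. of_real s * f z) \<bbbD>) = ennreal (s\<^sup>2) * dirichlet_normsq \<alpha> f"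
    using dirichlet_normsq_cong[of "restrict (\<lambda>z. of_real s * f z) \<bbbD>"] dirichlet_normsq_scale[OF f] by simp
  moreover have "restrict (\<lambda>z. of_real s * f z) \<bbbD> holomorphic_on \<bbbD>"
    by (rule holomorphic_transform[of "\<lambda>z. of_real s * f z"]) (auto intro!: holomorphic_intros f)
  ultimately show ?thesis
    using assms by (auto simp: dirichlet_space_def ennreal_mult_less_top)
qed

locale disk_self_map =
  fixes \<alpha> :: real and \<phi> :: "complex \<Rightarrow> complex"
  assumes \<alpha>: "-1 < \<alpha>" "\<alpha> < 0"
    and hol: "\<phi> holomorphic_on \<bbbD>" and into: "\<phi> ` \<bbbD> \<subseteq> \<bbbD>"
    and nonconst: "\<not> \<phi> constant_on \<bbbD>" and fix0: "\<phi> 0 = 0"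
begin

abbreviation N :: "complex \<Rightarrow> ennreal" where "N \<equiv> counting_fun \<phi> \<alpha>"

lemma borel_measurable_counting_fun [measurable]: "N \<in> borel_measurable borel"
  unfolding counting_fun_eq_preimage_sum
  by (rule borel_measurable_preimage_sum[OF open_ball connected_ball hol nonconst continuous_on_disk_weight]) simp

lemma nn_integral_counting_measure:
  assumes "F \<in> borel_measurable (restrict_space borel \<bbbD>)"
  shows "(\<integral>\<^sup>+w. F w \<partial>counting_measure \<phi> \<alpha>) = ennreal (1 / pi) * (\<integral>\<^sup>+w\<in>\<bbbD>. F w * N w \<partial>lborel)"
proof -
  have N: "N \<in> borel_measurable (restrict_space borel \<bbbD>)"
    by (intro disk_measurableI borel_measurable_counting_fun)
  have "(\<integral>\<^sup>+w. F w \<partial>counting_measure \<phi> \<alpha>) = (\<integral>\<^sup>+w. N w * F w \<partial>disk_area)"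
    unfolding counting_measure_def using assms N by (intro nn_integral_density) (simp_all add: disk_area_measurable_iff)
  also have "\<dots> = ennreal (1 / pi) * (\<integral>\<^sup>+w\<in>\<bbbD>. (N w * F w) \<partial>lborel)"
    by (rule nn_integral_disk_area[OF borel_measurable_times_ennreal[OF N assms]])
  finally show ?thesis by (simp add: mult.commute)
qed

lemma sets_counting_measure: "sets (counting_measure \<phi> \<alpha>) = sets (restrict_space borel \<bbbD>)"
  by (simp add: counting_measure_def)

lemma emeasure_counting_measure:
  assumes E: "E \<in> sets borel" "E \<subseteq> \<bbbD>"
  shows "emeasure (counting_measure \<phi> \<alpha>) E = ennreal (1 / pi) * (\<integral>\<^sup>+w\<in>E. N w \<partial>lborel)"
proof -
  have "E \<in> sets (counting_measure \<phi> \<alpha>)"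
    using E by (simp add: sets_counting_measure sets_restrict_space_iff)
  then have "emeasure (counting_measure \<phi> \<alpha>) E = (\<integral>\<^sup>+w. indicator E w \<partial>counting_measure \<phi> \<alpha>)"
    by (simp add: nn_integral_indicator)
  also have "\<dots> = ennreal (1 / pi) * (\<integral>\<^sup>+w\<in>\<bbbD>. indicator E w * N w \<partial>lborel)"
    using E by (intro nn_integral_counting_measure disk_measurableI) auto
  also have "(\<integral>\<^sup>+w\<in>\<bbbD>. indicator E w * N w \<partial>lborel) = (\<integral>\<^sup>+w\<in>E. N w \<partial>lborel)"
    using E by (intro nn_integral_cong) (auto simp: indicator_def)
  finally show ?thesis .
qed

lemma open_range: "open (\<phi> ` \<bbbD>)"
  using open_mapping_thm[OF hol open_ball connected_ball open_ball subset_refl nonconst] .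

text \<open>
  Schwarz's lemma gives \<open>|w| \<le> |z|\<close> for a preimage \<open>z\<close> of \<open>w\<close>, and the negative power \<open>\<alpha>\<close> reverses this into
  \<open>(1 - |z|\<^sup>2)\<^sup>\<alpha> \<ge> (1 - |w|\<^sup>2)\<^sup>\<alpha>\<close>.  One preimage, of multiplicity at least one, already suffices.
\<close>

lemma counting_fun_ge_weight:
  assumes "w \<in> \<phi> ` \<bbbD>"
  shows "ennreal (disk_weight \<alpha> w) \<le> N w"
proof -
  obtain z where z: "z \<in> \<bbbD>" "\<phi> z = w" using assms by auto
  have "cmod w \<le> cmod z"
    using Schwarz_Lemma(1)[OF hol fix0, of z] into z by (auto simp: image_subset_iff)
  then have "1 - (cmod z)\<^sup>2 \<le> 1 - (cmod w)\<^sup>2" by (simp add: power_mono)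
  moreover have "0 < 1 - (cmod z)\<^sup>2" using z abs_square_less_1[of "cmod z"] by simp
  ultimately have "disk_weight \<alpha> w \<le> disk_weight \<alpha> z" using \<alpha> by (intro powr_mono2') auto
  moreover have "0 < zorder (\<lambda>u. \<phi> u - w) z"
  proof -
    have "\<exists>u\<in>\<bbbD>. \<phi> u - w \<noteq> 0" using nonconst unfolding constant_on_def by auto
    moreover have "(\<lambda>u. \<phi> u - w) holomorphic_on \<bbbD>" by (intro holomorphic_intros hol)
    ultimately show ?thesis
      using zorder_exist_zero[of "\<lambda>u. \<phi> u - w" \<bbbD> z] z by auto
  qed
  then have "1 * disk_weight \<alpha> z \<le> of_int (zorder (\<lambda>u. \<phi> u - w) z) * disk_weight \<alpha> z"
    by (intro mult_right_mono) auto
  ultimately have "ennreal (disk_weight \<alpha> w) \<le> ennreal (of_int (zorder (\<lambda>u. \<phi> u - w) z) * disk_weight \<alpha> z)"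
    by (intro ennreal_leI) simp
  also have "\<dots> = (\<Sum>u\<in>{z}. ennreal (of_int (zorder (\<lambda>u'. \<phi> u' - w) u) * disk_weight \<alpha> u))" by simp
  also have "\<dots> \<le> N w"
    unfolding counting_fun_def by (subst nonneg_infsum_complete) (simp, rule SUP_upper, use z in auto)
  finally show ?thesis .
qed

lemma counting_fun_eq_0: "w \<notin> \<phi> ` \<bbbD> \<Longrightarrow> N w = 0"
proof -
  assume "w \<notin> \<phi> ` \<bbbD>"
  then have "{z \<in> \<bbbD>. \<phi> z = w} = {}" by auto
  then show ?thesis unfolding counting_fun_def by (simp only: infsum_empty)
qed

lemma tail_set_subset: "tail_set \<phi> \<alpha> M \<subseteq> \<bbbD>"
  using into by (auto simp: tail_set_def)

lemma borel_tail_set [measurable]: "tail_set \<phi> \<alpha> M \<in> sets borel"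
proof -
  have [measurable]: "\<phi> ` \<bbbD> \<in> sets borel" using open_range by simp
  have "tail_set \<phi> \<alpha> M = \<phi> ` \<bbbD> \<inter> {w. counting_fun \<phi> \<alpha> w / ennreal (disk_weight \<alpha> w) > ennreal M}"
    by (auto simp: tail_set_def)
  also have "\<dots> \<in> sets borel" by measurable
  finally show ?thesis .
qed

lemma counting_fun_le_outside_tail:
  assumes "w \<in> \<bbbD>" "w \<notin> tail_set \<phi> \<alpha> M"
  shows "N w \<le> ennreal M * ennreal (disk_weight \<alpha> w)"
proof (cases "w \<in> \<phi> ` \<bbbD>")
  case True
  then have "N w / ennreal (disk_weight \<alpha> w) \<le> ennreal M"
    using assms by (auto simp: tail_set_def not_less)
  moreover have "0 < disk_weight \<alpha> w" using assms(1) abs_square_less_1[of "cmod w"] by simp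
  ultimately have "N w / ennreal (disk_weight \<alpha> w) * ennreal (disk_weight \<alpha> w) \<le> ennreal M * ennreal (disk_weight \<alpha> w)"
    by (intro mult_right_mono) auto
  then show ?thesis
    using \<open>0 < disk_weight \<alpha> w\<close> by (simp add: ennreal_divide_times ennreal_times_divide[symmetric] mult_divide_eq_ennreal)
qed (simp add: counting_fun_eq_0)

text \<open>
  Off the tail set the counting function is at most \<open>M\<close> times the weight, and it vanishes off the range.
\<close>

lemma nn_integral_counting_split:
  assumes [measurable]: "F \<in> borel_measurable borel" "A \<in> sets borel" and A: "A \<subseteq> \<bbbD>"
  shows "(\<integral>\<^sup>+w\<in>A. F w * N w \<partial>lborel)
    \<le> ennreal M * (\<integral>\<^sup>+w\<in>A \<inter> \<phi> ` \<bbbD>. F w * ennreal (disk_weight \<alpha> w) \<partial>lborel)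
      + (\<integral>\<^sup>+w\<in>A \<inter> tail_set \<phi> \<alpha> M. F w * N w \<partial>lborel)"
proof -
  have [measurable]: "\<phi> ` \<bbbD> \<in> sets borel" using open_range by simp
  have "(\<integral>\<^sup>+w\<in>A. F w * N w \<partial>lborel)
      \<le> (\<integral>\<^sup>+w. ennreal M * (F w * ennreal (disk_weight \<alpha> w) * indicator (A \<inter> \<phi> ` \<bbbD>) w)
          + F w * N w * indicator (A \<inter> tail_set \<phi> \<alpha> M) w \<partial>lborel)"
  proof (intro nn_integral_mono)
    fix w
    consider "w \<notin> A" | "w \<in> A" "w \<in> tail_set \<phi> \<alpha> M" | "w \<in> A" "w \<notin> tail_set \<phi> \<alpha> M" "w \<in> \<phi> ` \<bbbD>"
      | "w \<notin> \<phi> ` \<bbbD>" by blast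
    then show "F w * N w * indicator A w
        \<le> ennreal M * (F w * ennreal (disk_weight \<alpha> w) * indicator (A \<inter> \<phi> ` \<bbbD>) w)
          + F w * N w * indicator (A \<inter> tail_set \<phi> \<alpha> M) w"
    proof cases
      case 3
      then have "F w * N w \<le> F w * (ennreal M * ennreal (disk_weight \<alpha> w))"
        using A by (intro mult_left_mono counting_fun_le_outside_tail) auto
      with 3 show ?thesis by (simp add: mult_ac)
    qed (auto simp: counting_fun_eq_0)
  qed
  also have "\<dots> = ennreal M * (\<integral>\<^sup>+w\<in>A \<inter> \<phi> ` \<bbbD>. F w * ennreal (disk_weight \<alpha> w) \<partial>lborel)
      + (\<integral>\<^sup>+w\<in>A \<inter> tail_set \<phi> \<alpha> M. F w * N w \<partial>lborel)"
    by (subst nn_integral_add) (measurable, simp add: nn_integral_cmult)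
  finally show ?thesis .
qed

text \<open>
  The supremum in the tail condition runs over the unit sphere; homogeneity extends the bound to all
  functions vanishing at \<open>0\<close>.  The normalising constants of the two measures leave the factor
  \<open>1 + \<alpha> \<le> 1\<close>, which is dropped.
\<close>

lemma tail_energy_small:
  assumes utc: "uniform_tail_condition \<phi> \<alpha>" and \<epsilon>: "0 < \<epsilon>"
  shows "\<exists>M>0. \<forall>f\<in>dirichlet_space0 \<alpha>.
    (\<integral>\<^sup>+w\<in>tail_set \<phi> \<alpha> M. sqnorm (deriv f w) * N w \<partial>lborel) \<le> ennreal \<epsilon> * weighted_energy \<alpha> f"
proof -
  define S where "S = (\<lambda>M. SUP f\<in>{f \<in> dirichlet_space0 \<alpha>. dirichlet_norm \<alpha> f = 1}.
        \<integral>\<^sup>+ w\<in>tail_set \<phi> \<alpha> M. (sqnorm (deriv f w) * N w) \<partial>disk_area)"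
  have "(S \<longlongrightarrow> 0) at_top"
    using utc unfolding uniform_tail_condition_def S_def .
  then have "\<forall>\<^sub>F M in at_top. S M < ennreal \<epsilon>"
    using \<epsilon> by (intro order_tendstoD(2)) auto
  moreover have "\<forall>\<^sub>F M in at_top. (0::real) < M" by (rule eventually_gt_at_top)
  ultimately have "\<forall>\<^sub>F M in at_top. S M < ennreal \<epsilon> \<and> 0 < M" by (rule eventually_conj)
  then obtain M where M: "S M < ennreal \<epsilon>" "0 < M"
    using eventually_happens'[OF trivial_limit_at_top_linorder] by blast
  have tail_lborel: "(\<integral>\<^sup>+ w\<in>tail_set \<phi> \<alpha> M. (sqnorm (deriv f w) * N w) \<partial>disk_area)
      = ennreal (1 / pi) * (\<integral>\<^sup>+w\<in>tail_set \<phi> \<alpha> M. sqnorm (deriv f w) * N w \<partial>lborel)"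
    if f: "f holomorphic_on \<bbbD>" for f
  proof -
    have mI: "(\<lambda>w. indicator (tail_set \<phi> \<alpha> M) w :: ennreal) \<in> borel_measurable (restrict_space borel \<bbbD>)"
      by (intro disk_measurableI) measurable
    have mN: "N \<in> borel_measurable (restrict_space borel \<bbbD>)"
      by (intro disk_measurableI borel_measurable_counting_fun)
    have "(\<integral>\<^sup>+ w\<in>tail_set \<phi> \<alpha> M. (sqnorm (deriv f w) * N w) \<partial>disk_area)
      = ennreal (1 / pi) * (\<integral>\<^sup>+w\<in>\<bbbD>. (sqnorm (deriv f w) * N w * indicator (tail_set \<phi> \<alpha> M) w) \<partial>lborel)"
      by (intro nn_integral_disk_area borel_measurable_times_ennreal mI mN holomorphic_deriv_sq_measurable(2)[OF f])
    also have "(\<integral>\<^sup>+w\<in>\<bbbD>. (sqnorm (deriv f w) * N w * indicator (tail_set \<phi> \<alpha> M) w) \<partial>lborel)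
        = (\<integral>\<^sup>+w\<in>tail_set \<phi> \<alpha> M. sqnorm (deriv f w) * N w \<partial>lborel)"
      by (intro nn_integral_cong) (auto simp: indicator_def dest: subsetD[OF tail_set_subset])
    finally show ?thesis .
  qed
  show ?thesis
  proof (intro exI[of _ M] conjI ballI M(2))
    fix f assume f0: "f \<in> dirichlet_space0 \<alpha>"
    then have f: "f \<in> dirichlet_space \<alpha>" and f00: "f 0 = 0" and fh: "f holomorphic_on \<bbbD>"
      by (auto simp: dirichlet_space0_def dirichlet_space_def)
    have en: "dirichlet_normsq \<alpha> f = ennreal ((1 + \<alpha>) / pi) * weighted_energy \<alpha> f"
      using dirichlet_normsq_eq_energy[OF fh \<alpha>(1)] f00 by simp
    let ?T = "\<lambda>f. \<integral>\<^sup>+w\<in>tail_set \<phi> \<alpha> M. sqnorm (deriv f w) * N w \<partial>lborel"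
    define n where "n = dirichlet_norm \<alpha> f"
    show "?T f \<le> ennreal \<epsilon> * weighted_energy \<alpha> f"
    \<comment> \<open>A function of norm zero vanishes on the disk and cannot be normalised.\<close>
    proof (cases "n = 0")
      case True
      then have "dirichlet_normsq \<alpha> f = 0" using dirichlet_norm_sq[OF f] by (simp add: n_def)
      then have z: "f z = 0" if "z \<in> \<bbbD>" for z
        using dirichlet_normsq_eq_0D[OF fh _ \<alpha>(1) that] by blast
      have "deriv f z = 0" if "z \<in> \<bbbD>" for z
        using deriv_eq_on_disk[of f "\<lambda>_. 0", OF _ that] z by simp
      then have "?T f = (\<integral>\<^sup>+w. 0 \<partial>(lborel::complex measure))"
        by (intro nn_integral_cong) (auto simp: indicator_def dest: subsetD[OF tail_set_subset])
      then show ?thesis by simp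
    next
      case False
      then have n: "0 < n" by (simp add: n_def dirichlet_norm_def less_le)
      define f1 where "f1 = restrict (\<lambda>z. of_real (1 / n) * f z) \<bbbD>"
      have f1: "f1 \<in> dirichlet_space \<alpha>"
        unfolding f1_def by (rule scale_in_dirichlet_space[OF f])
      have "dirichlet_normsq \<alpha> f1 = ennreal ((1/n)\<^sup>2) * dirichlet_normsq \<alpha> f"
        using dirichlet_normsq_cong[of f1 "\<lambda>z. of_real (1 / n) * f z"] dirichlet_normsq_scale[OF fh, of \<alpha> "1/n"]
        by (simp add: f1_def)
      also have "\<dots> = 1"
        using n by (simp add: dirichlet_norm_sq[OF f] n_def[symmetric] ennreal_mult[symmetric] power_divide)
      finally have "dirichlet_norm \<alpha> f1 = 1" by (simp add: dirichlet_norm_def)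
      then have f1in: "f1 \<in> {f \<in> dirichlet_space0 \<alpha>. dirichlet_norm \<alpha> f = 1}"
        using f1 f00 by (simp add: dirichlet_space0_def f1_def)
      have "ennreal (1 / pi) * ?T f1 \<le> S M"
        unfolding S_def using tail_lborel[of f1] f1 f1in
        by (intro SUP_upper2[OF f1in]) (auto simp: dirichlet_space_def)
      then have le: "ennreal (1 / pi) * ?T f1 \<le> ennreal \<epsilon>" using M(1) by simp
      have dz: "deriv f1 z = of_real (1 / n) * deriv f z" if "z \<in> \<bbbD>" for z
      proof -
        have "f field_differentiable at z"
          using fh that by (intro holomorphic_on_imp_differentiable_at[of f \<bbbD>]) auto
        then have "deriv (\<lambda>z. of_real (1 / n) * f z) z = of_real (1 / n) * deriv f z"
          by (rule deriv_cmult)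
        moreover have "deriv f1 z = deriv (\<lambda>z. of_real (1 / n) * f z) z"
          by (rule deriv_eq_on_disk[OF _ that]) (simp add: f1_def)
        ultimately show ?thesis by simp
      qed
      have "?T f = (\<integral>\<^sup>+w. ennreal (n\<^sup>2) * (sqnorm (if w \<in> \<bbbD> then deriv f1 w else 0) * N w * indicator (tail_set \<phi> \<alpha> M) w) \<partial>lborel)"
      proof (intro nn_integral_cong)
        fix w
        show "sqnorm (deriv f w) * N w * indicator (tail_set \<phi> \<alpha> M) w
          = ennreal (n\<^sup>2) * (sqnorm (if w \<in> \<bbbD> then deriv f1 w else 0) * N w * indicator (tail_set \<phi> \<alpha> M) w)"
        proof (cases "w \<in> tail_set \<phi> \<alpha> M")
          case True
          then have wD: "w \<in> \<bbbD>" using tail_set_subset by blast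
          have "(cmod (deriv f w))\<^sup>2 = n\<^sup>2 * (cmod (deriv f1 w))\<^sup>2"
            using n by (simp add: dz[OF wD] norm_mult norm_divide power_divide)
          then show ?thesis using True wD by (simp add: ennreal_mult mult.assoc)
        qed simp
      qed
      also have "\<dots> = ennreal (n\<^sup>2) * (\<integral>\<^sup>+w. sqnorm (if w \<in> \<bbbD> then deriv f1 w else 0) * N w * indicator (tail_set \<phi> \<alpha> M) w \<partial>lborel)"
        using f1 holomorphic_deriv_sq_measurable(1)[of f1]
        by (intro nn_integral_cmult borel_measurable_times_ennreal) (auto simp: dirichlet_space_def)
      also have "(\<integral>\<^sup>+w. sqnorm (if w \<in> \<bbbD> then deriv f1 w else 0) * N w * indicator (tail_set \<phi> \<alpha> M) w \<partial>lborel) = ?T f1"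
        by (intro nn_integral_cong) (auto simp: indicator_def dest: subsetD[OF tail_set_subset])
      also have "ennreal (n\<^sup>2) * ?T f1 = ennreal (n\<^sup>2 * pi) * (ennreal (1 / pi) * ?T f1)"
        by (simp add: mult.assoc[symmetric] ennreal_mult[symmetric])
      also have "\<dots> \<le> ennreal (n\<^sup>2 * pi) * ennreal \<epsilon>"
        by (intro mult_left_mono le) simp
      also have "\<dots> = ennreal (\<epsilon> * pi) * dirichlet_normsq \<alpha> f"
        using \<epsilon> by (simp add: dirichlet_norm_sq[OF f] n_def[symmetric] ennreal_mult[symmetric] mult_ac)
      also have "\<dots> = ennreal (\<epsilon> * (1 + \<alpha>)) * weighted_energy \<alpha> f"
        using \<epsilon> \<alpha> unfolding en by (simp add: mult.assoc[symmetric] ennreal_mult[symmetric])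
      also have "\<dots> \<le> ennreal \<epsilon> * weighted_energy \<alpha> f"
        using \<epsilon> \<alpha> by (intro mult_right_mono ennreal_leI) auto
      finally show ?thesis .
    qed
  qed
qed

end

section \<open>Density conditions and the reverse Carleson inequality\<close>

lemma ennreal_mult3:
  "0 \<le> p \<Longrightarrow> 0 \<le> q \<Longrightarrow> 0 \<le> r \<Longrightarrow> ennreal p * (ennreal q * ennreal r) = ennreal (p * (q * r))"
  by (simp add: ennreal_mult)

text \<open>
  Test functions concentrated near \<open>a\<close>; subtracting \<open>a = \<phi>\<^sub>a(0)\<close> makes them vanish at \<open>0\<close>.
\<close>

definition swap_test_fun :: "complex \<Rightarrow> complex \<Rightarrow> complex"
  where "swap_test_fun a = restrict (\<lambda>w. disk_swap a w - a) \<bbbD>"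

lemma holomorphic_swap_test_fun: "a \<in> \<bbbD> \<Longrightarrow> swap_test_fun a holomorphic_on \<bbbD>"
  unfolding swap_test_fun_def by (intro restrict_minus_const(1) holomorphic_disk_swap)

lemma deriv_swap_test_fun: "a \<in> \<bbbD> \<Longrightarrow> w \<in> \<bbbD> \<Longrightarrow> deriv (swap_test_fun a) w = deriv (disk_swap a) w"
  unfolding swap_test_fun_def by (intro restrict_minus_const(2) holomorphic_disk_swap)

text \<open>
  The derivatives of the involution at \<open>u\<close> and at its image are reciprocal, so the change of variables
  removes the derivative from the integral.
\<close>

lemma swap_energy_on_image:
  assumes a: "a \<in> \<bbbD>" and E: "E \<subseteq> \<bbbD>" "E \<in> sets borel"
  shows "(\<integral>\<^sup>+w\<in>disk_swap a ` E. sqnorm (deriv (disk_swap a) w) * ennreal (disk_weight \<alpha> w) \<partial>lborel)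
    = (\<integral>\<^sup>+u\<in>E. ennreal (disk_weight \<alpha> (disk_swap a u)) \<partial>lborel)"
proof -
  define F where "F = (\<lambda>w. sqnorm (if w \<in> \<bbbD> then deriv (disk_swap a) w else 0) * ennreal (disk_weight \<alpha> w))"
  have F: "F \<in> borel_measurable borel"
    unfolding F_def by (intro borel_measurable_times_ennreal holomorphic_deriv_sq_measurable holomorphic_disk_swap[OF a]) measurable
  have "(\<integral>\<^sup>+w\<in>disk_swap a ` E. sqnorm (deriv (disk_swap a) w) * ennreal (disk_weight \<alpha> w) \<partial>lborel)
      = (\<integral>\<^sup>+w\<in>disk_swap a ` E. F w \<partial>lborel)"
  proof (intro nn_integral_cong)
    fix w
    have "w \<in> \<bbbD>" if "w \<in> disk_swap a ` E" using that E disk_swap_in_disk[OF a] by blast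
    then show "sqnorm (deriv (disk_swap a) w) * ennreal (disk_weight \<alpha> w) * indicator (disk_swap a ` E) w
        = F w * indicator (disk_swap a ` E) w"
      by (cases "w \<in> disk_swap a ` E") (auto simp: F_def)
  qed
  also have "\<dots> = (\<integral>\<^sup>+u\<in>E. F (disk_swap a u) * sqnorm (deriv (disk_swap a) u) \<partial>lborel)"
    by (rule nn_integral_disk_swap_image[OF a E F])
  also have "\<dots> = (\<integral>\<^sup>+u\<in>E. ennreal (disk_weight \<alpha> (disk_swap a u)) \<partial>lborel)"
  proof (intro nn_integral_cong)
    fix u
    show "F (disk_swap a u) * sqnorm (deriv (disk_swap a) u) * indicator E u
        = ennreal (disk_weight \<alpha> (disk_swap a u)) * indicator E u"
    proof (cases "u \<in> E")
      case True
      then have u: "u \<in> \<bbbD>" using E by blast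
      have one: "(cmod (deriv (disk_swap a) (disk_swap a u)))\<^sup>2 * (cmod (deriv (disk_swap a) u))\<^sup>2 = 1"
        unfolding cmod_deriv_disk_swap[OF a u] cmod_deriv_disk_swap_at_image[OF a u]
        using disk_swap_denom_nz[OF a u] cmod_sq_lt_1[OF a] by (simp add: power_mult_distrib[symmetric])
      have "F (disk_swap a u) * sqnorm (deriv (disk_swap a) u)
          = ennreal ((cmod (deriv (disk_swap a) (disk_swap a u)))\<^sup>2 * (cmod (deriv (disk_swap a) u))\<^sup>2)
            * ennreal (disk_weight \<alpha> (disk_swap a u))"
        using disk_swap_in_disk[OF a u] by (simp add: F_def ennreal_mult mult_ac)
      then show ?thesis using one by simp
    qed simp
  qed
  finally show ?thesis .
qed

definition disk_mass :: "real \<Rightarrow> real"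
  where "disk_mass \<alpha> = enn2real (weighted_mass \<alpha> \<bbbD>)"

lemma disk_mass:
  assumes "-1 < \<alpha>" "\<alpha> < 0"
  shows "weighted_mass \<alpha> \<bbbD> = ennreal (disk_mass \<alpha>)"
  using disk_weight_finite_mass[OF assms] by (simp add: disk_mass_def)

lemma disk_mass_nonneg: "0 \<le> disk_mass \<alpha>"
  by (simp add: disk_mass_def)

lemma swap_energy_le_mass:
  assumes \<alpha>: "-1 < \<alpha>" "\<alpha> < 0" and a: "a \<in> \<bbbD>" and E: "E \<subseteq> \<bbbD>" "E \<in> sets borel"
  shows "(\<integral>\<^sup>+w\<in>disk_swap a ` E. sqnorm (deriv (disk_swap a) w) * ennreal (disk_weight \<alpha> w) \<partial>lborel)
    \<le> ennreal (4 * disk_weight \<alpha> a) * weighted_mass \<alpha> E"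
proof -
  have "(\<integral>\<^sup>+u\<in>E. ennreal (disk_weight \<alpha> (disk_swap a u)) \<partial>lborel)
      \<le> (\<integral>\<^sup>+u. ennreal (4 * disk_weight \<alpha> a) * (ennreal (disk_weight \<alpha> u) * indicator E u) \<partial>lborel)"
  proof (intro nn_integral_mono)
    fix u
    show "ennreal (disk_weight \<alpha> (disk_swap a u)) * indicator E u
      \<le> ennreal (4 * disk_weight \<alpha> a) * (ennreal (disk_weight \<alpha> u) * indicator E u)"
    proof (cases "u \<in> E")
      case True
      then have "u \<in> \<bbbD>" using E by blast
      then have "disk_weight \<alpha> (disk_swap a u) \<le> 4 * disk_weight \<alpha> a * disk_weight \<alpha> u"
        by (rule disk_weight_swap_bounds(1)[OF \<alpha> a])
      then have "ennreal (disk_weight \<alpha> (disk_swap a u)) \<le> ennreal (4 * disk_weight \<alpha> a * disk_weight \<alpha> u)"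
        by (rule ennreal_leI)
      also have "\<dots> = ennreal (4 * disk_weight \<alpha> a) * ennreal (disk_weight \<alpha> u)"
        by (intro ennreal_mult) auto
      finally show ?thesis using True by simp
    qed simp
  qed
  also have "\<dots> = ennreal (4 * disk_weight \<alpha> a) * weighted_mass \<alpha> E"
  proof -
    note [measurable] = E(2)
    show ?thesis by (intro nn_integral_cmult) measurable
  qed
  finally show ?thesis unfolding swap_energy_on_image[OF a E] .
qed

lemma disk_swap_image_disk: "a \<in> \<bbbD> \<Longrightarrow> disk_swap a ` \<bbbD> = \<bbbD>"
proof (intro equalityI image_subsetI subsetI)
  fix w :: complex assume "a \<in> \<bbbD>" "w \<in> \<bbbD>"
  then show "disk_swap a w \<in> \<bbbD>" "w \<in> disk_swap a ` \<bbbD>"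
    using disk_swap_in_disk disk_swap_involution[of a w] by (blast, metis imageI disk_swap_in_disk)
qed

lemma weighted_energy_swap_test_fun:
  assumes a: "a \<in> \<bbbD>"
  shows "weighted_energy \<alpha> (swap_test_fun a)
    = (\<integral>\<^sup>+w\<in>disk_swap a ` \<bbbD>. sqnorm (deriv (disk_swap a) w) * ennreal (disk_weight \<alpha> w) \<partial>lborel)"
  unfolding weighted_energy_def disk_swap_image_disk[OF a]
  by (intro nn_integral_cong) (auto simp: indicator_def deriv_swap_test_fun[OF a])

text \<open>
  The energy of the test function is the total weight transported by the involution, which is comparable
  to the weight at \<open>a\<close>; the disk of radius \<open>1/2\<close> suffices for the lower bound.
\<close>

lemma weighted_energy_swap_test_fun_bounds:
  assumes \<alpha>: "-1 < \<alpha>" "\<alpha> < 0" and a: "a \<in> \<bbbD>"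
  shows "weighted_energy \<alpha> (swap_test_fun a) \<le> ennreal (4 * disk_mass \<alpha> * disk_weight \<alpha> a)"
    and "ennreal (pi / 16 * disk_weight \<alpha> a) \<le> weighted_energy \<alpha> (swap_test_fun a)"
proof -
  have "weighted_energy \<alpha> (swap_test_fun a) \<le> ennreal (4 * disk_weight \<alpha> a) * ennreal (disk_mass \<alpha>)"
    unfolding weighted_energy_swap_test_fun[OF a] disk_mass[OF \<alpha>, symmetric]
    by (rule swap_energy_le_mass[OF \<alpha> a]) auto
  also have "\<dots> = ennreal (4 * disk_mass \<alpha> * disk_weight \<alpha> a)"
    using disk_mass_nonneg[of \<alpha>] by (simp add: ennreal_mult[symmetric] mult_ac)
  finally show "weighted_energy \<alpha> (swap_test_fun a) \<le> ennreal (4 * disk_mass \<alpha> * disk_weight \<alpha> a)" .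
  have "ennreal (pi / 16 * disk_weight \<alpha> a) = ennreal (disk_weight \<alpha> a / 4) * emeasure lborel (ball (0::complex) (1/2))"
    by (simp add: emeasure_ball unit_ball_vol_2 ennreal_mult[symmetric] power2_eq_square)
  also have "\<dots> = (\<integral>\<^sup>+u. ennreal (disk_weight \<alpha> a / 4) * indicator (ball (0::complex) (1/2)) u \<partial>lborel)"
    by (rule nn_integral_cmult_indicator[symmetric]) simp
  also have "\<dots> \<le> (\<integral>\<^sup>+u\<in>\<bbbD>. ennreal (disk_weight \<alpha> (disk_swap a u)) \<partial>lborel)"
  proof (intro nn_integral_mono)
    fix u :: complex
    show "ennreal (disk_weight \<alpha> a / 4) * indicator (ball (0::complex) (1/2)) u
      \<le> ennreal (disk_weight \<alpha> (disk_swap a u)) * indicator \<bbbD> u"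
    proof (cases "cmod u < 1/2")
      case True
      then have u: "u \<in> \<bbbD>" by simp
      have "(1/2)\<^sup>2 \<le> (1 - cmod u)\<^sup>2" using True by (intro power_mono) auto
      then have "1/4 * disk_weight \<alpha> a \<le> (1 - cmod u)\<^sup>2 * disk_weight \<alpha> a"
        by (intro mult_right_mono) (auto simp: power2_eq_square)
      also have "\<dots> \<le> disk_weight \<alpha> (disk_swap a u)"
        by (rule disk_weight_swap_bounds(2)[OF \<alpha> a u])
      finally show ?thesis using u True by (auto simp: indicator_def intro!: ennreal_leI)
    qed simp
  qed
  also have "\<dots> = weighted_energy \<alpha> (swap_test_fun a)"
    unfolding weighted_energy_swap_test_fun[OF a] by (rule swap_energy_on_image[OF a, symmetric]) auto
  finally show "ennreal (pi / 16 * disk_weight \<alpha> a) \<le> weighted_energy \<alpha> (swap_test_fun a)" .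
qed

lemma swap_test_fun_in_dirichlet_space0:
  assumes \<alpha>: "-1 < \<alpha>" "\<alpha> < 0" and a: "a \<in> \<bbbD>"
  shows "swap_test_fun a \<in> dirichlet_space0 \<alpha>"
proof -
  have "swap_test_fun a 0 = 0" by (simp add: swap_test_fun_def disk_swap_def)
  moreover have "weighted_energy \<alpha> (swap_test_fun a) < \<infinity>"
    using weighted_energy_swap_test_fun_bounds(1)[OF \<alpha> a] by (auto simp: le_less_trans)
  ultimately show ?thesis
    using holomorphic_swap_test_fun[OF a] \<alpha>
    by (auto simp: dirichlet_space0_def dirichlet_space_def dirichlet_normsq_eq_energy ennreal_mult_less_top)
      (auto simp: swap_test_fun_def)
qed

lemma pseudo_disk_weight_bounds:
  assumes \<alpha>: "-1 < \<alpha>" "\<alpha> < 0" and a: "a \<in> \<bbbD>" and \<rho>: "0 < \<rho>" "\<rho> < 1"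
  shows "ennreal ((1 - \<rho>)\<^sup>2 / 16 * (pi * \<rho>\<^sup>2) * ((1 - (cmod a)\<^sup>2)\<^sup>2 * disk_weight \<alpha> a))
      \<le> weighted_mass \<alpha> (pseudo_disk a \<rho>)"
    and "weighted_mass \<alpha> (pseudo_disk a \<rho>)
      \<le> ennreal (4 / (1 - \<rho>) ^ 5 * (pi * \<rho>\<^sup>2) * ((1 - (cmod a)\<^sup>2)\<^sup>2 * disk_weight \<alpha> a))"
proof -
  define s where "s = (1 - (cmod a)\<^sup>2)\<^sup>2 * disk_weight \<alpha> a"
  have s: "0 \<le> s" by (simp add: s_def)
  have pd: "pseudo_disk a \<rho> = disk_swap a ` ball 0 \<rho>"
    using \<rho> by (intro pseudo_disk_eq_image[OF a]) auto
  have one: "(\<lambda>_::complex. 1::ennreal) \<in> borel_measurable borel" by simp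
  have b: "(ball 0 \<rho> :: complex set) \<in> sets borel" by simp
  have area: "(\<integral>\<^sup>+u\<in>ball 0 \<rho>. 1 \<partial>(lborel::complex measure)) = ennreal (pi * \<rho>\<^sup>2)"
    using \<rho> by (simp add: emeasure_ball unit_ball_vol_2)
  have "ennreal ((1 - \<rho>)\<^sup>2 / 16 * (pi * \<rho>\<^sup>2) * s) = ennreal ((1 - \<rho>)\<^sup>2 / 16 * s) * ennreal (pi * \<rho>\<^sup>2)"
    using s by (subst ennreal_mult[symmetric]) (auto simp: mult_ac)
  also have "\<dots> \<le> (\<integral>\<^sup>+w\<in>pseudo_disk a \<rho>. 1 * ennreal (disk_weight \<alpha> w) \<partial>lborel)"
    using disk_swap_comparable_integrals(1)[OF \<alpha> a \<rho>(2) order_refl b one]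
    unfolding pd area s_def .
  finally show "ennreal ((1 - \<rho>)\<^sup>2 / 16 * (pi * \<rho>\<^sup>2) * ((1 - (cmod a)\<^sup>2)\<^sup>2 * disk_weight \<alpha> a))
      \<le> weighted_mass \<alpha> (pseudo_disk a \<rho>)"
    by (simp add: s_def)
  have "(\<integral>\<^sup>+w\<in>pseudo_disk a \<rho>. 1 * ennreal (disk_weight \<alpha> w) \<partial>lborel)
      \<le> ennreal (4 / (1 - \<rho>) ^ 5 * s) * ennreal (pi * \<rho>\<^sup>2)"
    using disk_swap_comparable_integrals(2)[OF \<alpha> a \<rho>(2) order_refl b one]
    unfolding pd area s_def .
  also have "\<dots> = ennreal (4 / (1 - \<rho>) ^ 5 * (pi * \<rho>\<^sup>2) * s)"
    using s \<rho> by (subst ennreal_mult[symmetric]) (auto simp: mult_ac)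
  finally show "weighted_mass \<alpha> (pseudo_disk a \<rho>)
      \<le> ennreal (4 / (1 - \<rho>) ^ 5 * (pi * \<rho>\<^sup>2) * ((1 - (cmod a)\<^sup>2)\<^sup>2 * disk_weight \<alpha> a))"
    by (simp add: s_def)
qed

lemma pseudo_disk_subset: "pseudo_disk a \<rho> \<subseteq> \<bbbD>"
  by (auto simp: pseudo_disk_def)

lemma deriv_disk_swap_on_pseudo_disk:
  assumes a: "a \<in> \<bbbD>" and w: "w \<in> pseudo_disk a \<rho>" and \<rho>: "\<rho> < 1"
  shows "(1 - \<rho>)\<^sup>2 / (1 - (cmod a)\<^sup>2) \<le> cmod (deriv (disk_swap a) w)"
    and "cmod (deriv (disk_swap a) w) \<le> 4 / (1 - (cmod a)\<^sup>2)"
proof -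
  have w': "w \<in> \<bbbD>" "cmod (disk_swap a w) \<le> \<rho>" using w by (auto simp: pseudo_disk_def)
  show "(1 - \<rho>)\<^sup>2 / (1 - (cmod a)\<^sup>2) \<le> cmod (deriv (disk_swap a) w)"
    "cmod (deriv (disk_swap a) w) \<le> 4 / (1 - (cmod a)\<^sup>2)"
    using disk_swap_deriv_bounds(3,4)[OF a disk_swap_in_disk[OF a w'(1)] w'(2) \<rho>]
    by (simp_all add: disk_swap_involution[OF a w'(1)])
qed

context disk_self_map
begin

text \<open>
  On the disk about \<open>a\<close> the derivative of the test function is at least a multiple of \<open>1 / (1 - |a|\<^sup>2)\<close>, so
  the tail estimate for the test function bounds the counting measure of the part of the disk in the
  tail set by a small multiple of the weighted area of the disk.  Off the tail set the counting function
  is at most \<open>M\<close> times the weight on the range, which therefore carries the rest.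
\<close>

lemma range_dense_if_counting_dense:
  assumes utc: "uniform_tail_condition \<phi> \<alpha>" and \<rho>: "0 < \<rho>" "\<rho> < 1" and \<delta>: "0 < \<delta>"
    and dens: "\<And>a. a \<in> \<bbbD> \<Longrightarrow> ennreal \<delta> * weighted_mass \<alpha> (pseudo_disk a \<rho>)
      \<le> (\<integral>\<^sup>+w\<in>pseudo_disk a \<rho>. N w \<partial>lborel)"
  shows "\<exists>\<delta>'>0. \<forall>a\<in>\<bbbD>. ennreal \<delta>' * weighted_mass \<alpha> (pseudo_disk a \<rho>)
      \<le> weighted_mass \<alpha> (\<phi> ` \<bbbD> \<inter> pseudo_disk a \<rho>)"
proof -
  define c where "c = (1 - \<rho>)\<^sup>2 / 16 * (pi * \<rho>\<^sup>2)"
  have c: "0 < c" using \<rho> by (simp add: c_def)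
  define b where "b = (1 - \<rho>) ^ 4"
  have b: "0 < b" using \<rho> by (simp add: b_def)
  \<comment> \<open>Adding one keeps the denominator of the constant below visibly positive.\<close>
  define m where "m = disk_mass \<alpha> + 1"
  have m: "0 < m" "disk_mass \<alpha> \<le> m" using disk_mass_nonneg[of \<alpha>] by (auto simp: m_def)
  \<comment> \<open>With this choice the tail set carries at most half of the assumed density of the counting measure.\<close>
  define \<epsilon> where "\<epsilon> = \<delta> / 2 * c * b / (4 * m)"
  have \<epsilon>: "0 < \<epsilon>" using \<delta> c b m by (simp add: \<epsilon>_def)
  obtain M where M: "0 < M" and tail: "\<And>f. f \<in> dirichlet_space0 \<alpha> \<Longrightarrow>
    (\<integral>\<^sup>+w\<in>tail_set \<phi> \<alpha> M. sqnorm (deriv f w) * N w \<partial>lborel) \<le> ennreal \<epsilon> * weighted_energy \<alpha> f"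
    using tail_energy_small[OF utc \<epsilon>] by blast
  have main: "ennreal (\<delta> / (2 * M)) * weighted_mass \<alpha> (pseudo_disk a \<rho>)
      \<le> weighted_mass \<alpha> (\<phi> ` \<bbbD> \<inter> pseudo_disk a \<rho>)"
    if a: "a \<in> \<bbbD>" for a
  proof -
    let ?\<Delta> = "pseudo_disk a \<rho>" and ?T = "tail_set \<phi> \<alpha> M"
    define W where "W = weighted_mass \<alpha> ?\<Delta>"
    define W' where "W' = weighted_mass \<alpha> (\<phi> ` \<bbbD> \<inter> ?\<Delta>)"
    define s where "s = (1 - (cmod a)\<^sup>2)\<^sup>2 * disk_weight \<alpha> a"
    define t where "t = 1 - (cmod a)\<^sup>2"
    have t: "0 < t" using cmod_sq_lt_1[OF a] by (simp add: t_def)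
    have s: "s = t\<^sup>2 * disk_weight \<alpha> a" "0 < s" using t by (auto simp: s_def t_def)
    have one: "(\<lambda>_::complex. 1::ennreal) \<in> borel_measurable borel" by simp
    have ND: "(\<integral>\<^sup>+w\<in>?\<Delta>. N w \<partial>lborel) \<le> ennreal M * W' + (\<integral>\<^sup>+w\<in>?\<Delta> \<inter> ?T. N w \<partial>lborel)"
      using nn_integral_counting_split[OF one borel_pseudo_disk pseudo_disk_subset, of a \<rho> M]
      by (simp add: W'_def Int_commute)
    have mT: "(\<lambda>w. sqnorm (if w \<in> \<bbbD> then deriv (swap_test_fun a) w else 0) * N w * indicator ?T w) \<in> borel_measurable borel"
      using holomorphic_deriv_sq_measurable(1)[OF holomorphic_swap_test_fun[OF a]]
      by (intro borel_measurable_times_ennreal) auto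
    have "(\<integral>\<^sup>+w\<in>?\<Delta> \<inter> ?T. N w \<partial>lborel)
        \<le> (\<integral>\<^sup>+w. ennreal (t\<^sup>2 / b) * (sqnorm (if w \<in> \<bbbD> then deriv (swap_test_fun a) w else 0) * N w * indicator ?T w) \<partial>lborel)"
    proof (intro nn_integral_mono)
      fix w
      show "N w * indicator (?\<Delta> \<inter> ?T) w \<le> ennreal (t\<^sup>2 / b)
          * (sqnorm (if w \<in> \<bbbD> then deriv (swap_test_fun a) w else 0) * N w * indicator ?T w)"
      proof (cases "w \<in> ?\<Delta> \<inter> ?T")
        case True
        then have w: "w \<in> \<bbbD>" using tail_set_subset by blast
        have "((1 - \<rho>)\<^sup>2 / t)\<^sup>2 \<le> (cmod (deriv (swap_test_fun a) w))\<^sup>2"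
          using deriv_disk_swap_on_pseudo_disk(1)[OF a _ \<rho>(2), of w] True t
          by (intro power_mono) (auto simp: t_def deriv_swap_test_fun[OF a w])
        then have "t\<^sup>2 / b * ((1 - \<rho>)\<^sup>2 / t)\<^sup>2 \<le> t\<^sup>2 / b * (cmod (deriv (swap_test_fun a) w))\<^sup>2"
          using b by (intro mult_left_mono) auto
        moreover have "t\<^sup>2 / b * ((1 - \<rho>)\<^sup>2 / t)\<^sup>2 = 1"
          using t \<rho> by (simp add: b_def power_divide flip: power_mult)
        ultimately have "1 \<le> ennreal (t\<^sup>2 / b * (cmod (deriv (swap_test_fun a) w))\<^sup>2)"
          by (simp only: ennreal_ge_1)
        then have "1 * N w \<le> ennreal (t\<^sup>2 / b * (cmod (deriv (swap_test_fun a) w))\<^sup>2) * N w"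
          by (intro mult_right_mono) auto
        also have "\<dots> = ennreal (t\<^sup>2 / b) * (sqnorm (deriv (swap_test_fun a) w) * N w)"
          using b by (subst ennreal_mult) (auto simp: mult.assoc)
        finally show ?thesis using True w by simp
      qed simp
    qed
    also have "\<dots> = ennreal (t\<^sup>2 / b) * (\<integral>\<^sup>+w\<in>?T. sqnorm (if w \<in> \<bbbD> then deriv (swap_test_fun a) w else 0) * N w \<partial>lborel)"
      using mT by (intro nn_integral_cmult) simp
    also have "(\<integral>\<^sup>+w\<in>?T. sqnorm (if w \<in> \<bbbD> then deriv (swap_test_fun a) w else 0) * N w \<partial>lborel)
        = (\<integral>\<^sup>+w\<in>?T. sqnorm (deriv (swap_test_fun a) w) * N w \<partial>lborel)"
      by (intro nn_integral_cong) (auto simp: indicator_def dest: subsetD[OF tail_set_subset])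
    also have "\<dots> \<le> ennreal \<epsilon> * weighted_energy \<alpha> (swap_test_fun a)"
      by (rule tail[OF swap_test_fun_in_dirichlet_space0[OF \<alpha> a]])
    also have "\<dots> \<le> ennreal \<epsilon> * ennreal (4 * m * disk_weight \<alpha> a)"
      using m by (intro mult_left_mono order_trans[OF weighted_energy_swap_test_fun_bounds(1)[OF \<alpha> a]] ennreal_leI mult_right_mono) auto
    also have "ennreal (t\<^sup>2 / b) * (ennreal \<epsilon> * ennreal (4 * m * disk_weight \<alpha> a)) = ennreal (\<delta> / 2 * (c * s))"
    proof -
      have "t\<^sup>2 / b * (\<epsilon> * (4 * m * disk_weight \<alpha> a)) = \<delta> / 2 * (c * s)"
        using b m by (simp add: \<epsilon>_def s)
      then show ?thesis
        using b \<epsilon> m ennreal_mult3[of "t\<^sup>2 / b" \<epsilon> "4 * m * disk_weight \<alpha> a"] by (simp only:) simp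
    qed
    also have "\<dots> = ennreal (\<delta> / 2) * ennreal (c * s)"
      using \<delta> c s by (intro ennreal_mult) auto
    also have "\<dots> \<le> ennreal (\<delta> / 2) * W"
      unfolding W_def using pseudo_disk_weight_bounds(1)[OF \<alpha> a \<rho>] by (intro mult_left_mono) (auto simp: c_def s_def)
    finally have tailD: "(\<integral>\<^sup>+w\<in>?\<Delta> \<inter> ?T. N w \<partial>lborel) \<le> ennreal (\<delta> / 2) * W"
      by (auto simp: mult_left_mono)
    have "ennreal \<delta> * W \<le> (\<integral>\<^sup>+w\<in>?\<Delta>. N w \<partial>lborel)" unfolding W_def by (rule dens[OF a])
    also note ND
    also have "ennreal M * W' + (\<integral>\<^sup>+w\<in>?\<Delta> \<inter> ?T. N w \<partial>lborel) \<le> ennreal M * W' + ennreal (\<delta> / 2) * W"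
      by (intro add_left_mono tailD)
    finally have le: "ennreal \<delta> * W \<le> ennreal M * W' + ennreal (\<delta> / 2) * W" .
    have "W < \<infinity>" using pseudo_disk_weight_bounds(2)[OF \<alpha> a \<rho>] unfolding W_def by (auto simp: le_less_trans)
    then obtain w where w: "W = ennreal w" "0 \<le> w" by (cases W) auto
    show "ennreal (\<delta> / (2 * M)) * W \<le> W'"
    proof (cases W')
      case (real w')
      have "\<delta> * w \<le> M * w' + \<delta> / 2 * w"
        using le real w \<delta> M by (simp add: ennreal_mult[symmetric] ennreal_plus[symmetric] ennreal_le_iff del: ennreal_plus)
      then have "\<delta> / (2 * M) * w \<le> w'" using M by (simp add: field_simps)
      then show ?thesis using real w \<delta> M by (simp add: ennreal_mult[symmetric] ennreal_leI)
    qed simp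
  qed
  show ?thesis
    by (rule exI[of _ "\<delta> / (2 * M)"]) (use \<delta> M main in auto)
qed

definition counting_energy :: "(complex \<Rightarrow> complex) \<Rightarrow> ennreal"
  where "counting_energy f = (\<integral>\<^sup>+w\<in>\<bbbD>. sqnorm (deriv f w) * N w \<partial>lborel)"

lemma bergman_normsq_deriv:
  assumes f: "f holomorphic_on \<bbbD>" and g: "\<And>z. z \<in> \<bbbD> \<Longrightarrow> g z = deriv f z"
  shows "bergman_normsq \<alpha> g = ennreal ((1 + \<alpha>) / pi) * weighted_energy \<alpha> f"
proof -
  have "bergman_normsq \<alpha> g = (\<integral>\<^sup>+z. sqnorm (deriv f z) \<partial>weighted_area \<alpha>)"
    unfolding bergman_normsq_def by (intro nn_integral_cong) (simp add: g)
  then show ?thesis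
    unfolding weighted_energy_def
    by (simp only: nn_integral_weighted_area[OF holomorphic_deriv_sq_measurable(2)[OF f] \<alpha>(1)])
qed

lemma nn_integral_counting_measure_deriv:
  assumes f: "f holomorphic_on \<bbbD>" and g: "\<And>z. z \<in> \<bbbD> \<Longrightarrow> g z = deriv f z"
  shows "(\<integral>\<^sup>+z. sqnorm (g z) \<partial>counting_measure \<phi> \<alpha>) = ennreal (1 / pi) * counting_energy f"
proof -
  have "(\<integral>\<^sup>+z. sqnorm (g z) \<partial>counting_measure \<phi> \<alpha>)
      = (\<integral>\<^sup>+z. sqnorm (deriv f z) \<partial>counting_measure \<phi> \<alpha>)"
    by (intro nn_integral_cong) (simp add: g counting_measure_def)
  then show ?thesis
    unfolding counting_energy_def
    by (simp only: nn_integral_counting_measure[OF holomorphic_deriv_sq_measurable(2)[OF f]])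
qed

text \<open>
  Differentiation maps the Dirichlet space onto the Bergman space, as the disk is convex and every
  holomorphic function on it has a primitive.
\<close>

lemma reverse_carleson_iff_energy:
  "reverse_carleson \<alpha> (counting_measure \<phi> \<alpha>) \<longleftrightarrow>
    (\<exists>c>0. \<forall>f\<in>dirichlet_space \<alpha>. ennreal c * weighted_energy \<alpha> f \<le> counting_energy f)"
proof
  assume "reverse_carleson \<alpha> (counting_measure \<phi> \<alpha>)"
  then obtain c where c: "c > 0" and rc: "\<And>g. g \<in> bergman_space \<alpha> \<Longrightarrow>
      ennreal c * bergman_normsq \<alpha> g \<le> (\<integral>\<^sup>+ z. sqnorm (g z) \<partial>counting_measure \<phi> \<alpha>)"
    unfolding reverse_carleson_def by blast
  have "ennreal (c * (1 + \<alpha>)) * weighted_energy \<alpha> f \<le> counting_energy f" if fD: "f \<in> dirichlet_space \<alpha>" for f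
  proof -
    have f: "f holomorphic_on \<bbbD>" using fD by (simp add: dirichlet_space_def)
    define g where "g = restrict (deriv f) \<bbbD>"
    have g: "g z = deriv f z" if "z \<in> \<bbbD>" for z using that by (simp add: g_def)
    have "g holomorphic_on \<bbbD>"
      by (rule holomorphic_transform[of "deriv f"]) (auto simp: g intro!: holomorphic_deriv f)
    moreover have "bergman_normsq \<alpha> g < \<infinity>"
      using weighted_energy_finite[OF fD \<alpha>(1)] bergman_normsq_deriv[OF f g] by (simp add: ennreal_mult_less_top)
    ultimately have "g \<in> bergman_space \<alpha>" by (simp add: bergman_space_def g_def)
    from rc[OF this] have "ennreal c * (ennreal ((1 + \<alpha>) / pi) * weighted_energy \<alpha> f) \<le> ennreal (1 / pi) * counting_energy f"
      by (simp only: bergman_normsq_deriv[OF f g] nn_integral_counting_measure_deriv[OF f g])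
    then have "ennreal pi * (ennreal c * (ennreal ((1 + \<alpha>) / pi) * weighted_energy \<alpha> f)) \<le> ennreal pi * (ennreal (1 / pi) * counting_energy f)"
      by (intro mult_left_mono) auto
    moreover have "ennreal pi * (ennreal (1 / pi) * counting_energy f) = counting_energy f"
      by (subst ennreal_mult_collect) auto
    moreover have "ennreal pi * (ennreal c * (ennreal ((1 + \<alpha>) / pi) * weighted_energy \<alpha> f)) = ennreal (c * (1 + \<alpha>)) * weighted_energy \<alpha> f"
    proof -
      have nn: "0 \<le> c" "0 \<le> (1 + \<alpha>) / pi" "0 \<le> pi" "0 \<le> c * ((1 + \<alpha>) / pi)" using c \<alpha> by auto
      have "pi * (c * ((1 + \<alpha>) / pi)) = c * (1 + \<alpha>)" by simp
      then show ?thesis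
        by (simp only: ennreal_mult_collect[OF nn(1,2)] ennreal_mult_collect[OF nn(3,4)])
    qed
    ultimately show ?thesis by simp
  qed
  then show "\<exists>c>0. \<forall>f\<in>dirichlet_space \<alpha>. ennreal c * weighted_energy \<alpha> f \<le> counting_energy f"
    using c \<alpha> by (intro exI[of _ "c * (1 + \<alpha>)"]) auto
next
  assume "\<exists>c>0. \<forall>f\<in>dirichlet_space \<alpha>. ennreal c * weighted_energy \<alpha> f \<le> counting_energy f"
  then obtain c where c: "c > 0" and le: "\<And>f. f \<in> dirichlet_space \<alpha> \<Longrightarrow> ennreal c * weighted_energy \<alpha> f \<le> counting_energy f"
    by blast
  have "ennreal (c / (1 + \<alpha>)) * bergman_normsq \<alpha> g \<le> (\<integral>\<^sup>+ z. sqnorm (g z) \<partial>counting_measure \<phi> \<alpha>)"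
    if "g \<in> bergman_space \<alpha>" for g
  proof -
    have g: "g holomorphic_on \<bbbD>" "bergman_normsq \<alpha> g < \<infinity>" using that by (auto simp: bergman_space_def)
    obtain h where h: "\<And>z. z \<in> \<bbbD> \<Longrightarrow> (h has_field_derivative g z) (at z within \<bbbD>)"
      using holomorphic_convex_primitive'[OF convex_ball open_ball g(1)] by blast
    have hd: "(h has_field_derivative g z) (at z)" if "z \<in> \<bbbD>" for z
      using h[OF that] that by (simp add: at_within_open[OF that])
    define f where "f = restrict h \<bbbD>"
    have hh: "h holomorphic_on \<bbbD>"
      unfolding holomorphic_on_def field_differentiable_def using h by blast
    have f: "f holomorphic_on \<bbbD>"
      by (rule holomorphic_transform[OF hh]) (simp add: f_def)
    have gf: "g z = deriv f z" if "z \<in> \<bbbD>" for z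
      using deriv_eq_on_disk[of f h, OF _ that] DERIV_imp_deriv[OF hd[OF that]] by (simp add: f_def)
    note n = bergman_normsq_deriv[OF f gf]
    have "ennreal ((1 + \<alpha>) / pi) * weighted_energy \<alpha> f < \<infinity>"
      using g(2) by (simp only: n)
    then have "dirichlet_normsq \<alpha> f < \<infinity>"
      unfolding dirichlet_normsq_eq_energy[OF f \<alpha>(1)] by simp
    then have "f \<in> dirichlet_space \<alpha>" using f by (simp add: dirichlet_space_def f_def)
    from le[OF this] have "ennreal (1 / pi) * (ennreal c * weighted_energy \<alpha> f) \<le> ennreal (1 / pi) * counting_energy f"
      by (intro mult_left_mono) auto
    moreover have "ennreal (c / (1 + \<alpha>)) * (ennreal ((1 + \<alpha>) / pi) * weighted_energy \<alpha> f) = ennreal (1 / pi) * (ennreal c * weighted_energy \<alpha> f)"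
    proof -
      have nn: "0 \<le> c / (1 + \<alpha>)" "0 \<le> (1 + \<alpha>) / pi" "0 \<le> 1 / pi" "0 \<le> c" using c \<alpha> by auto
      have "1 + \<alpha> \<noteq> 0" using \<alpha> by simp
      then have "c / (1 + \<alpha>) * ((1 + \<alpha>) / pi) = 1 / pi * c" by simp
      then show ?thesis
        by (simp only: ennreal_mult_collect[OF nn(1,2)] ennreal_mult_collect[OF nn(3,4)])
    qed
    ultimately show ?thesis
      by (simp only: n nn_integral_counting_measure_deriv[OF f gf])
  qed
  then show "reverse_carleson \<alpha> (counting_measure \<phi> \<alpha>)"
    unfolding reverse_carleson_def using c \<alpha> sets_counting_measure
    by (intro conjI exI[of _ "c / (1 + \<alpha>)"]) auto
qed

text \<open>
  The measure with density the weight is finite, and the sets \<open>1 - 1/n \<le> |u| < 1\<close> decrease to the empty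
  set.
\<close>

lemma disk_mass_near_boundary_small:
  assumes "0 < \<eta>"
  shows "\<exists>\<rho>>0. \<rho> < 1 \<and> weighted_mass \<alpha> (\<bbbD> - ball 0 \<rho>) \<le> ennreal \<eta>"
proof -
  define \<nu> where "\<nu> = density lborel (\<lambda>u::complex. ennreal (disk_weight \<alpha> u) * indicator \<bbbD> u)"
  define r where "r = (\<lambda>n::nat. 1 - 1 / real (Suc (Suc n)))"
  have r: "0 < r n" "r n < 1" for n by (auto simp: r_def)
  define A where "A = (\<lambda>n. \<bbbD> - ball (0::complex) (r n))"
  have A: "A n \<in> sets borel" for n by (simp add: A_def)
  have em: "emeasure \<nu> (A n) = weighted_mass \<alpha> (\<bbbD> - ball 0 (r n))" for n
  proof -
    have "emeasure \<nu> (A n) = (\<integral>\<^sup>+u. ennreal (disk_weight \<alpha> u) * indicator \<bbbD> u * indicator (A n) u \<partial>lborel)"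
      unfolding \<nu>_def using A by (intro emeasure_density) (auto intro!: borel_measurable_times_ennreal)
    also have "\<dots> = weighted_mass \<alpha> (\<bbbD> - ball 0 (r n))"
      by (intro nn_integral_cong) (auto simp: A_def indicator_def)
    finally show ?thesis .
  qed
  have "(\<lambda>n. emeasure \<nu> (A n)) \<longlonglongrightarrow> emeasure \<nu> (\<Inter>n. A n)"
  proof (rule Lim_emeasure_decseq)
    show "range A \<subseteq> sets \<nu>" using A by (auto simp: \<nu>_def)
    show "decseq A"
    proof (rule decseq_SucI)
      fix n
      have "r n \<le> r (Suc n)" by (auto simp: r_def intro!: divide_left_mono)
      then show "A (Suc n) \<subseteq> A n" by (auto simp: A_def)
    qed
    show "emeasure \<nu> (A n) \<noteq> \<infinity>" for n
    proof -
      have "emeasure \<nu> (A n) \<le> weighted_mass \<alpha> \<bbbD>"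
        unfolding em by (intro nn_integral_mono) (auto simp: indicator_def)
      then show ?thesis using disk_weight_finite_mass[OF \<alpha>] by (auto simp: top_unique)
    qed
  qed
  moreover have "(\<Inter>n. A n) = {}"
  proof (rule ccontr)
    assume "(\<Inter>n. A n) \<noteq> {}"
    then obtain u where u: "\<And>n. u \<in> A n" by auto
    then have "0 < 1 - cmod u" using u[of 0] by (auto simp: A_def)
    then obtain n where n: "1 / real (Suc n) < 1 - cmod u" using nat_approx_posE by metis
    have "1 / real (Suc (Suc n)) \<le> 1 / real (Suc n)" by (intro divide_left_mono) auto
    with n u[of n] show False by (auto simp: A_def r_def)
  qed
  ultimately have "(\<lambda>n. emeasure \<nu> (A n)) \<longlonglongrightarrow> 0" by simp
  then have "\<forall>\<^sub>F n in sequentially. emeasure \<nu> (A n) < ennreal \<eta>"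
    using assms by (intro order_tendstoD(2)) auto
  then obtain n where "emeasure \<nu> (A n) < ennreal \<eta>"
    using eventually_happens'[OF sequentially_bot] by blast
  then show ?thesis using r[of n] em[of n] by (intro exI[of _ "r n"]) auto
qed

text \<open>
  For the test function at \<open>a\<close>, the energy outside the disk of radius \<open>\<rho>\<close> about \<open>a\<close> is at most a multiple
  of the weight at \<open>a\<close> times the weighted area of \<open>\<rho> \<le> |u| < 1\<close>.  For \<open>\<rho>\<close> close to \<open>1\<close>, the outside of the
  disk contributes at most a quarter of \<open>c E(f\<^sub>a)\<close> off the tail set and at most another quarter on it, so
  half of \<open>c E(f\<^sub>a)\<close> comes from the disk, where the squared derivative is at most \<open>16 / (1 - |a|\<^sup>2)\<^sup>2\<close>.
\<close>

lemma counting_dense_if_energy_bounded_below: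
  assumes utc: "uniform_tail_condition \<phi> \<alpha>" and c: "0 < c"
    and lower: "\<And>f. f \<in> dirichlet_space \<alpha> \<Longrightarrow> ennreal c * weighted_energy \<alpha> f \<le> counting_energy f"
  shows "\<exists>\<delta>>0. \<exists>\<rho>>0. \<rho> < 1 \<and> (\<forall>a\<in>\<bbbD>. ennreal \<delta> * weighted_mass \<alpha> (pseudo_disk a \<rho>)
      \<le> (\<integral>\<^sup>+w\<in>pseudo_disk a \<rho>. N w \<partial>lborel))"
proof -
  obtain M where M: "0 < M" and tail: "\<And>f. f \<in> dirichlet_space0 \<alpha> \<Longrightarrow>
    (\<integral>\<^sup>+w\<in>tail_set \<phi> \<alpha> M. sqnorm (deriv f w) * N w \<partial>lborel) \<le> ennreal (c / 4) * weighted_energy \<alpha> f"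
    using tail_energy_small[OF utc, of "c / 4"] c by auto
  \<comment> \<open>Solves \<open>M * 4 * \<eta> = (c / 4) * (pi / 16)\<close>, where \<open>pi / 16\<close> is the constant in the lower energy bound.\<close>
  define \<eta> where "\<eta> = c * pi / (256 * M)"
  have \<eta>: "0 < \<eta>" using c M by (simp add: \<eta>_def)
  obtain \<rho> where \<rho>: "0 < \<rho>" "\<rho> < 1"
    and small: "weighted_mass \<alpha> (\<bbbD> - ball 0 \<rho>) \<le> ennreal \<eta>"
    using disk_mass_near_boundary_small[OF \<eta>] by blast
  define C where "C = 4 / (1 - \<rho>) ^ 5 * (pi * \<rho>\<^sup>2)"
  have C: "0 < C" using \<rho> by (simp add: C_def)
  define \<delta> where "\<delta> = c * pi / (512 * C)"
  have \<delta>: "0 < \<delta>" using c C by (simp add: \<delta>_def)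
  have main: "ennreal \<delta> * weighted_mass \<alpha> (pseudo_disk a \<rho>)
      \<le> (\<integral>\<^sup>+w\<in>pseudo_disk a \<rho>. N w \<partial>lborel)" if a: "a \<in> \<bbbD>" for a
  proof -
    let ?\<Delta> = "pseudo_disk a \<rho>" and ?T = "tail_set \<phi> \<alpha> M"
    define t where "t = 1 - (cmod a)\<^sup>2"
    have t: "0 < t" using cmod_sq_lt_1[OF a] by (simp add: t_def)
    define f where "f = swap_test_fun a"
    have f: "f holomorphic_on \<bbbD>" "f \<in> dirichlet_space0 \<alpha>" "f \<in> dirichlet_space \<alpha>"
      using holomorphic_swap_test_fun[OF a] swap_test_fun_in_dirichlet_space0[OF \<alpha> a]
      by (auto simp: f_def dirichlet_space0_def)
    have df: "deriv f w = deriv (disk_swap a) w" if "w \<in> \<bbbD>" for w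
      unfolding f_def by (rule deriv_swap_test_fun[OF a that])
    define F where "F = (\<lambda>w. sqnorm (if w \<in> \<bbbD> then deriv f w else 0))"
    have F: "F \<in> borel_measurable borel"
      unfolding F_def by (rule holomorphic_deriv_sq_measurable(1)[OF f(1)])
    note [measurable] = F
    define E where "E = weighted_energy \<alpha> f"
    have E_lo: "ennreal (pi / 16 * disk_weight \<alpha> a) \<le> E"
      unfolding E_def f_def by (rule weighted_energy_swap_test_fun_bounds(2)[OF \<alpha> a])
    have E_fin: "E < \<infinity>" unfolding E_def by (rule weighted_energy_finite[OF f(3) \<alpha>(1)])
    define X where "X = (\<integral>\<^sup>+w\<in>?\<Delta>. F w * N w \<partial>lborel)"
    define A where "A = \<bbbD> - ?\<Delta>"
    have A: "A \<in> sets borel" "A \<subseteq> \<bbbD>" by (auto simp: A_def)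
    have Aim: "A = disk_swap a ` (\<bbbD> - ball 0 \<rho>)"
    proof -
      have "disk_swap a ` (\<bbbD> - ball 0 \<rho>) = disk_swap a ` \<bbbD> - disk_swap a ` ball 0 \<rho>"
        using \<rho> by (intro inj_on_image_set_diff[OF inj_on_disk_swap[OF a]]) auto
      then show ?thesis
        using \<rho> by (simp add: A_def disk_swap_image_disk[OF a] pseudo_disk_eq_image[OF a])
    qed
    have "counting_energy f = (\<integral>\<^sup>+w. F w * N w * indicator ?\<Delta> w + F w * N w * indicator A w \<partial>lborel)"
      unfolding counting_energy_def using pseudo_disk_subset
      by (intro nn_integral_cong) (auto simp: F_def A_def indicator_def)
    also have "\<dots> = X + (\<integral>\<^sup>+w\<in>A. F w * N w \<partial>lborel)"
      unfolding X_def using A(1) by (intro nn_integral_add) auto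
    finally have split: "counting_energy f = X + (\<integral>\<^sup>+w\<in>A. F w * N w \<partial>lborel)" .
    have "(\<integral>\<^sup>+w\<in>A. F w * N w \<partial>lborel)
      \<le> ennreal M * (\<integral>\<^sup>+w\<in>A \<inter> \<phi> ` \<bbbD>. F w * ennreal (disk_weight \<alpha> w) \<partial>lborel)
      + (\<integral>\<^sup>+w\<in>A \<inter> ?T. F w * N w \<partial>lborel)"
      by (rule nn_integral_counting_split[OF F A])
    also have "\<dots> \<le> ennreal (c / 4) * E + ennreal (c / 4) * E"
    proof (rule add_mono)
      have "(\<integral>\<^sup>+w\<in>A \<inter> ?T. F w * N w \<partial>lborel) \<le> (\<integral>\<^sup>+w\<in>?T. sqnorm (deriv f w) * N w \<partial>lborel)"
        by (intro nn_integral_mono) (auto simp: F_def indicator_def)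
      also have "\<dots> \<le> ennreal (c / 4) * E" unfolding E_def by (rule tail[OF f(2)])
      finally show "(\<integral>\<^sup>+w\<in>A \<inter> ?T. F w * N w \<partial>lborel) \<le> ennreal (c / 4) * E" .
      have "(\<integral>\<^sup>+w\<in>A \<inter> \<phi> ` \<bbbD>. F w * ennreal (disk_weight \<alpha> w) \<partial>lborel)
          \<le> (\<integral>\<^sup>+w\<in>A. sqnorm (deriv (disk_swap a) w) * ennreal (disk_weight \<alpha> w) \<partial>lborel)"
        by (intro nn_integral_mono) (auto simp: F_def df indicator_def)
      also have "\<dots> \<le> ennreal (4 * disk_weight \<alpha> a) * weighted_mass \<alpha> (\<bbbD> - ball 0 \<rho>)"
        unfolding Aim by (rule swap_energy_le_mass[OF \<alpha> a]) auto
      also have "\<dots> \<le> ennreal (4 * disk_weight \<alpha> a) * ennreal \<eta>"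
        by (intro mult_left_mono small) simp
      finally have "ennreal M * (\<integral>\<^sup>+w\<in>A \<inter> \<phi> ` \<bbbD>. F w * ennreal (disk_weight \<alpha> w) \<partial>lborel)
          \<le> ennreal M * (ennreal (4 * disk_weight \<alpha> a) * ennreal \<eta>)"
        by (intro mult_left_mono) auto
      also have "\<dots> = ennreal (M * (4 * disk_weight \<alpha> a * \<eta>))"
        using M \<eta> by (intro ennreal_mult3) auto
      also have "M * (4 * disk_weight \<alpha> a * \<eta>) = c / 4 * (pi / 16 * disk_weight \<alpha> a)"
        using M by (simp add: \<eta>_def)
      also have "ennreal (c / 4 * (pi / 16 * disk_weight \<alpha> a)) = ennreal (c / 4) * ennreal (pi / 16 * disk_weight \<alpha> a)"
        using c by (intro ennreal_mult) auto
      also have "\<dots> \<le> ennreal (c / 4) * E" by (intro mult_left_mono E_lo) simp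
      finally show "ennreal M * (\<integral>\<^sup>+w\<in>A \<inter> \<phi> ` \<bbbD>. F w * ennreal (disk_weight \<alpha> w) \<partial>lborel) \<le> ennreal (c / 4) * E" .
    qed
    finally have out: "(\<integral>\<^sup>+w\<in>A. F w * N w \<partial>lborel) \<le> ennreal (c / 4) * E + ennreal (c / 4) * E" .
    have "ennreal c * E \<le> X + (\<integral>\<^sup>+w\<in>A. F w * N w \<partial>lborel)"
      using lower[OF f(3)] by (simp only: E_def split)
    also have "\<dots> \<le> X + (ennreal (c / 4) * E + ennreal (c / 4) * E)"
      by (intro add_left_mono out)
    finally have le: "ennreal c * E \<le> X + (ennreal (c / 4) * E + ennreal (c / 4) * E)" .
    obtain e where e: "E = ennreal e" "0 \<le> e" using E_fin by (cases E) auto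
    have half: "ennreal (c / 2) * E \<le> X"
    proof (cases X)
      case (real x)
      have "c * e \<le> x + (c / 4 * e + c / 4 * e)"
        using le real e c by (simp add: ennreal_mult[symmetric] ennreal_plus[symmetric] ennreal_le_iff del: ennreal_plus)
      then have "c / 2 * e \<le> x" by simp
      then show ?thesis using real e c by (simp add: ennreal_mult[symmetric] ennreal_leI)
    qed simp
    have NX: "X \<le> ennreal (16 / t\<^sup>2) * (\<integral>\<^sup>+w\<in>?\<Delta>. N w \<partial>lborel)"
    proof -
      have "X \<le> (\<integral>\<^sup>+w. ennreal (16 / t\<^sup>2) * (N w * indicator ?\<Delta> w) \<partial>lborel)"
        unfolding X_def
      proof (intro nn_integral_mono)
        fix w
        show "F w * N w * indicator ?\<Delta> w \<le> ennreal (16 / t\<^sup>2) * (N w * indicator ?\<Delta> w)"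
        proof (cases "w \<in> ?\<Delta>")
          case True
          then have w: "w \<in> \<bbbD>" using pseudo_disk_subset by blast
          have "(cmod (deriv f w))\<^sup>2 \<le> (4 / t)\<^sup>2"
            unfolding df[OF w] t_def using deriv_disk_swap_on_pseudo_disk(2)[OF a True \<rho>(2)] by (intro power_mono) auto
          then have "F w \<le> ennreal (16 / t\<^sup>2)"
            using w by (simp add: F_def power_divide ennreal_leI)
          then show ?thesis using True by (simp add: mult_right_mono)
        qed simp
      qed
      also have "\<dots> = ennreal (16 / t\<^sup>2) * (\<integral>\<^sup>+w\<in>?\<Delta>. N w \<partial>lborel)"
        by (intro nn_integral_cmult) measurable
      finally show ?thesis .
    qed
    have "ennreal \<delta> * weighted_mass \<alpha> ?\<Delta>
        \<le> ennreal \<delta> * ennreal (C * (t\<^sup>2 * disk_weight \<alpha> a))"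
      using pseudo_disk_weight_bounds(2)[OF \<alpha> a \<rho>] by (intro mult_left_mono) (auto simp: C_def t_def)
    also have "\<dots> = ennreal (t\<^sup>2 / 16 * (c / 2 * (pi / 16 * disk_weight \<alpha> a)))"
    proof -
      have "\<delta> * (C * (t\<^sup>2 * disk_weight \<alpha> a)) = t\<^sup>2 / 16 * (c / 2 * (pi / 16 * disk_weight \<alpha> a))"
        using C by (simp add: \<delta>_def)
      moreover have "ennreal \<delta> * ennreal (C * (t\<^sup>2 * disk_weight \<alpha> a)) = ennreal (\<delta> * (C * (t\<^sup>2 * disk_weight \<alpha> a)))"
        using \<delta> C by (intro ennreal_mult[symmetric]) auto
      ultimately show ?thesis by (simp only:)
    qed
    also have "\<dots> = ennreal (t\<^sup>2 / 16) * (ennreal (c / 2) * ennreal (pi / 16 * disk_weight \<alpha> a))"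
      using c by (intro ennreal_mult3[symmetric]) auto
    also have "\<dots> \<le> ennreal (t\<^sup>2 / 16) * (ennreal (c / 2) * E)"
      by (intro mult_left_mono E_lo) auto
    also have "\<dots> \<le> ennreal (t\<^sup>2 / 16) * (ennreal (16 / t\<^sup>2) * (\<integral>\<^sup>+w\<in>?\<Delta>. N w \<partial>lborel))"
      using half NX by (intro mult_left_mono) auto
    also have "\<dots> = (\<integral>\<^sup>+w\<in>?\<Delta>. N w \<partial>lborel)"
      using t by (subst ennreal_mult_collect) auto
    finally show ?thesis .
  qed
  show ?thesis
    using \<delta> \<rho> main by blast
qed

lemma energy_bounded_below_if_range_dense:
  assumes \<rho>: "0 < \<rho>" "\<rho> < 1" and \<delta>: "0 < \<delta>"
    and dens: "\<And>a. a \<in> \<bbbD> \<Longrightarrow> ennreal \<delta> * weighted_mass \<alpha> (pseudo_disk a \<rho>)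
      \<le> weighted_mass \<alpha> (\<phi> ` \<bbbD> \<inter> pseudo_disk a \<rho>)"
  shows "\<exists>c>0. \<forall>f\<in>dirichlet_space \<alpha>. ennreal c * weighted_energy \<alpha> f \<le> counting_energy f"
proof -
  have G: "\<phi> ` \<bbbD> \<in> sets borel" using open_range by simp
  obtain c where c: "0 < c" and dom:
    "\<And>g. g holomorphic_on \<bbbD> \<Longrightarrow>
      (\<integral>\<^sup>+w\<in>\<bbbD>. sqnorm (g w) * ennreal (disk_weight \<alpha> w) \<partial>lborel) < \<infinity> \<Longrightarrow>
      ennreal c * (\<integral>\<^sup>+w\<in>\<bbbD>. sqnorm (g w) * ennreal (disk_weight \<alpha> w) \<partial>lborel)
      \<le> (\<integral>\<^sup>+w\<in>\<phi> ` \<bbbD>. sqnorm (g w) * ennreal (disk_weight \<alpha> w) \<partial>lborel)"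
    using dominating_set_if_hyperbolically_dense[OF \<alpha> \<rho> \<delta> G into dens] by blast
  have "ennreal c * weighted_energy \<alpha> f \<le> counting_energy f" if fD: "f \<in> dirichlet_space \<alpha>" for f
  proof -
    have f: "f holomorphic_on \<bbbD>" using fD by (simp add: dirichlet_space_def)
    have "ennreal c * weighted_energy \<alpha> f
        \<le> (\<integral>\<^sup>+w\<in>\<phi> ` \<bbbD>. sqnorm (deriv f w) * ennreal (disk_weight \<alpha> w) \<partial>lborel)"
      unfolding weighted_energy_def
      by (rule dom) (use weighted_energy_finite[OF fD \<alpha>(1)] in \<open>auto simp: weighted_energy_def intro!: holomorphic_deriv f\<close>)
    also have "\<dots> \<le> counting_energy f"
      unfolding counting_energy_def
    proof (intro nn_integral_mono)
      fix w
      show "sqnorm (deriv f w) * ennreal (disk_weight \<alpha> w) * indicator (\<phi> ` \<bbbD>) w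
          \<le> sqnorm (deriv f w) * N w * indicator \<bbbD> w"
      proof (cases "w \<in> \<phi> ` \<bbbD>")
        case True
        then have "w \<in> \<bbbD>" using into by blast
        then show ?thesis using True counting_fun_ge_weight[OF True] by (simp add: mult_left_mono)
      qed simp
    qed
    finally show ?thesis .
  qed
  with c show ?thesis by blast
qed

end

section \<open>Completeness of the Dirichlet space and the composition operator\<close>

lemma dirichlet_dist_sq:
  assumes "f \<in> dirichlet_space \<alpha>" "g \<in> dirichlet_space \<alpha>"
  shows "dirichlet_normsq \<alpha> (\<lambda>z. f z - g z) = ennreal ((dirichlet_dist \<alpha> f g)\<^sup>2)"
  using dirichlet_normsq_diff_finite[OF assms] by (simp add: dirichlet_dist_def dirichlet_norm_def)

lemma dirichlet_dist_nonneg: "0 \<le> dirichlet_dist \<alpha> f g"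
  by (simp add: dirichlet_dist_def dirichlet_norm_def)

lemma dirichlet_dist_le_iff:
  assumes "f \<in> dirichlet_space \<alpha>" "g \<in> dirichlet_space \<alpha>" "0 \<le> e"
  shows "dirichlet_dist \<alpha> f g \<le> e \<longleftrightarrow> dirichlet_normsq \<alpha> (\<lambda>z. f z - g z) \<le> ennreal (e\<^sup>2)"
  unfolding dirichlet_dist_sq[OF assms(1,2)]
  using assms(3) dirichlet_dist_nonneg[of \<alpha> f g] by (simp add: ennreal_le_iff)

text \<open>
  Fatou's lemma.  The bound is applied as \<open>E(k n) \<le> C - |k n 0|\<^sup>2\<close> up to normalisation, so that the limit
  inferior is not taken of a sum.
\<close>

lemma dirichlet_normsq_lower_semicontinuous:
  assumes k: "\<And>n. k n holomorphic_on \<bbbD>" and h: "h holomorphic_on \<bbbD>"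
    and lim0: "(\<lambda>n. k n 0) \<longlonglongrightarrow> h 0"
    and limd: "\<And>z. z \<in> \<bbbD> \<Longrightarrow> (\<lambda>n. deriv (k n) z) \<longlonglongrightarrow> deriv h z"
    and bound: "\<And>n. dirichlet_normsq \<alpha> (k n) \<le> ennreal C" and C: "0 \<le> C"
  shows "dirichlet_normsq \<alpha> h \<le> ennreal C"
proof -
  define a where "a = (\<lambda>n. (cmod (k n 0))\<^sup>2)"
  define I where "I = (\<lambda>n. \<integral>\<^sup>+ z. sqnorm (deriv (k n) z) \<partial>weighted_area \<alpha>)"
  have b: "ennreal (a n) + I n \<le> ennreal C" for n
    using bound[of n] by (simp add: dirichlet_normsq_def a_def I_def)
  have aC: "a n \<le> C" and IC: "I n \<le> ennreal (C - a n)" for n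
  proof -
    have "ennreal (a n) \<le> ennreal (a n) + I n" by simp
    also note b
    finally show "a n \<le> C" using C by (simp add: ennreal_le_iff)
    then show "I n \<le> ennreal (C - a n)"
      using b[of n] C by (cases "I n")
        (auto simp: a_def ennreal_plus[symmetric] ennreal_le_iff top_unique simp del: ennreal_plus intro!: ennreal_leI)
  qed
  have lima: "a \<longlonglongrightarrow> (cmod (h 0))\<^sup>2"
    unfolding a_def by (intro tendsto_intros lim0)
  have hC: "(cmod (h 0))\<^sup>2 \<le> C"
    using LIMSEQ_le_const2[OF lima] aC by blast
  have "(\<integral>\<^sup>+ z. sqnorm (deriv h z) \<partial>weighted_area \<alpha>)
      = (\<integral>\<^sup>+ z. liminf (\<lambda>n. sqnorm (deriv (k n) z)) \<partial>weighted_area \<alpha>)"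
  proof (intro nn_integral_cong)
    fix z assume "z \<in> space (weighted_area \<alpha>)"
    then have "(\<lambda>n. sqnorm (deriv (k n) z)) \<longlonglongrightarrow> sqnorm (deriv h z)"
      by (intro tendsto_ennrealI tendsto_intros limd) simp
    then show "sqnorm (deriv h z) = liminf (\<lambda>n. sqnorm (deriv (k n) z))"
      by (intro lim_imp_Liminf[symmetric]) auto
  qed
  also have "\<dots> \<le> liminf I"
    unfolding I_def by (intro nn_integral_liminf measurable_deriv_sq k)
  also have "\<dots> \<le> liminf (\<lambda>n. ennreal (C - a n))"
    by (intro Liminf_mono always_eventually allI IC)
  also have "\<dots> = ennreal (C - (cmod (h 0))\<^sup>2)"
    by (intro lim_imp_Liminf tendsto_ennrealI tendsto_intros lima) auto
  finally have "dirichlet_normsq \<alpha> h \<le> sqnorm (h 0) + ennreal (C - (cmod (h 0))\<^sup>2)"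
    unfolding dirichlet_normsq_def by (rule add_left_mono)
  also have "\<dots> = ennreal C"
    using hC by (simp add: ennreal_plus[symmetric] del: ennreal_plus)
  finally show ?thesis .
qed

text \<open>
  The weight is at least one as \<open>\<alpha> < 0\<close>, so the derivatives are bounded in \<open>L\<^sup>2\<close> and hence uniformly on
  compact sets, and integrating along radii bounds the functions themselves.  Montel's
  theorem then gives a subsequence converging with its derivatives, and Fatou's lemma bounds the limit.
\<close>

lemma dirichlet_bounded_has_convergent_subsequence:
  assumes \<alpha>: "-1 < \<alpha>" "\<alpha> < 0" and f: "\<And>n. f n \<in> dirichlet_space \<alpha>"
    and bound: "\<And>n. dirichlet_normsq \<alpha> (f n) \<le> ennreal C" and C: "0 \<le> C"
  shows "\<exists>g r. g \<in> dirichlet_space \<alpha> \<and> strict_mono (r :: nat \<Rightarrow> nat)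
    \<and> (\<forall>z\<in>\<bbbD>. (\<lambda>n. f (r n) z) \<longlonglongrightarrow> g z) \<and> (\<forall>z\<in>\<bbbD>. (\<lambda>n. deriv (f (r n)) z) \<longlonglongrightarrow> deriv g z)
    \<and> dirichlet_normsq \<alpha> g \<le> ennreal C"
proof -
  have fh: "f n holomorphic_on \<bbbD>" for n using f by (simp add: dirichlet_space_def)
  define C' where "C' = pi / (1 + \<alpha>) * C"
  have C': "0 \<le> C'" using \<alpha> C by (simp add: C'_def)
  have L2: "(\<integral>\<^sup>+w\<in>\<bbbD>. sqnorm (deriv (f n) w) \<partial>lborel) \<le> ennreal C'" for n
  proof -
    have "(\<integral>\<^sup>+w\<in>\<bbbD>. sqnorm (deriv (f n) w) \<partial>lborel) \<le> weighted_energy \<alpha> (f n)"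
      unfolding weighted_energy_def
    proof (intro nn_integral_mono)
      fix w
      have "1 \<le> disk_weight \<alpha> w" if "w \<in> \<bbbD>"
      proof -
        have "0 < 1 - (cmod w)\<^sup>2" using that abs_square_less_1[of "cmod w"] by simp
        then have "(1 - (cmod w)\<^sup>2) powr 0 \<le> disk_weight \<alpha> w" using \<alpha> by (intro powr_mono') auto
        then show ?thesis using \<open>0 < 1 - (cmod w)\<^sup>2\<close> by simp
      qed
      then have "sqnorm (deriv (f n) w) * 1 \<le> sqnorm (deriv (f n) w) * ennreal (disk_weight \<alpha> w)" if "w \<in> \<bbbD>"
        using that by (intro mult_left_mono) (auto simp: ennreal_ge_1)
      then show "sqnorm (deriv (f n) w) * indicator \<bbbD> w
          \<le> sqnorm (deriv (f n) w) * ennreal (disk_weight \<alpha> w) * indicator \<bbbD> w"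
        by (cases "w \<in> \<bbbD>") auto
    qed
    also have "\<dots> = ennreal (pi / (1 + \<alpha>)) * (ennreal ((1 + \<alpha>) / pi) * weighted_energy \<alpha> (f n))"
      using \<alpha> by (subst ennreal_mult_collect) auto
    also have "\<dots> \<le> ennreal (pi / (1 + \<alpha>)) * ennreal C"
    proof (intro mult_left_mono)
      have "ennreal ((1 + \<alpha>) / pi) * weighted_energy \<alpha> (f n) \<le> dirichlet_normsq \<alpha> (f n)"
        unfolding dirichlet_normsq_eq_energy[OF fh \<alpha>(1)] by simp
      then show "ennreal ((1 + \<alpha>) / pi) * weighted_energy \<alpha> (f n) \<le> ennreal C" using bound order_trans by blast
    qed simp
    also have "\<dots> = ennreal C'"
      unfolding C'_def using \<alpha> C by (intro ennreal_mult[symmetric]) auto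
    finally show ?thesis .
  qed
  have f0: "cmod (f n 0) \<le> sqrt C" for n
  proof -
    have "sqnorm (f n 0) \<le> dirichlet_normsq \<alpha> (f n)" by (simp add: dirichlet_normsq_def)
    then have "sqnorm (f n 0) \<le> ennreal C" using bound order_trans by blast
    then have "(cmod (f n 0))\<^sup>2 \<le> C" using C by (simp add: ennreal_le_iff)
    then show ?thesis by (rule real_le_rsqrt)
  qed
  have bd: "\<exists>B. \<forall>h\<in>range f. \<forall>z\<in>K. cmod (h z) \<le> B" if K: "compact K" "K \<subseteq> \<bbbD>" for K
  proof -
    obtain s where s: "0 \<le> s" "s < 1" "K \<subseteq> cball 0 s"
    proof (cases "K = {}")
      case True
      then show thesis using that[of 0] by simp
    next
      case False
      then obtain w where w: "w \<in> K" "\<And>z. z \<in> K \<Longrightarrow> cmod z \<le> cmod w"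
        using continuous_attains_sup[OF K(1), of cmod] continuous_on_norm_id by blast
      then have "cmod w < 1" using K by auto
      moreover have "K \<subseteq> cball 0 (cmod w)" using w(2) by auto
      ultimately show thesis using that[of "cmod w"] by simp
    qed
    have sub: "cball (0::complex) s \<subseteq> \<bbbD>" using s by auto
    obtain B where B: "\<And>h C z. h holomorphic_on \<bbbD> \<Longrightarrow> 0 \<le> C \<Longrightarrow>
        (\<integral>\<^sup>+w\<in>\<bbbD>. sqnorm (h w) \<partial>lborel) \<le> ennreal C \<Longrightarrow> z \<in> cball 0 s \<Longrightarrow> (cmod (h z))\<^sup>2 \<le> B * C"
      using L2_bounded_uniformly_bounded_on_compact[OF open_ball compact_cball sub] by blast
    have "cmod (f n z) \<le> sqrt C + sqrt (B * C')" if z: "z \<in> K" for n z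
    proof -
      have "cmod (f n z - f n 0) \<le> sqrt (B * C') * cmod (z - 0)"
      proof (rule field_differentiable_bound[where S = "cball 0 s" and f' = "deriv (f n)"])
        fix u assume u: "u \<in> cball (0::complex) s"
        then have uD: "u \<in> \<bbbD>" using s by auto
        show "(f n has_field_derivative deriv (f n) u) (at u within cball 0 s)"
          using holomorphic_derivI[OF fh open_ball uD] by (rule has_field_derivative_at_within)
        show "cmod (deriv (f n) u) \<le> sqrt (B * C')"
          by (intro real_le_rsqrt B[OF _ C' L2 u] holomorphic_deriv fh open_ball)
      qed (use z s in auto)
      also have "\<dots> \<le> sqrt (B * C') * 1"
      proof (intro mult_left_mono)
        show "cmod (z - 0) \<le> 1" using z s by auto
        have "0 \<le> B * C'"
          using B[OF holomorphic_deriv[OF fh open_ball] C' L2, of 0] s order_trans[OF zero_le_power2] by auto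
        then show "0 \<le> sqrt (B * C')" by simp
      qed
      finally show ?thesis using f0[of n] norm_triangle_sub[of "f n z" "f n 0"] by simp
    qed
    then show ?thesis by blast
  qed
  have "\<exists>g0 r. g0 holomorphic_on \<bbbD> \<and> strict_mono (r :: nat \<Rightarrow> nat) \<and> (\<forall>z\<in>\<bbbD>. (\<lambda>n. f (r n) z) \<longlonglongrightarrow> g0 z)
     \<and> (\<forall>K. compact K \<longrightarrow> K \<subseteq> \<bbbD> \<longrightarrow> uniform_limit K (\<lambda>n. f (r n)) g0 sequentially)"
  proof (rule Montel[OF open_ball, of "range f" 0 1 f])
    fix g r
    assume "g holomorphic_on \<bbbD>" "strict_mono (r :: nat \<Rightarrow> nat)"
      "\<And>x. x \<in> \<bbbD> \<Longrightarrow> ((\<lambda>n. f (r n) x) \<longlongrightarrow> g x) sequentially"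
      "\<And>K. \<lbrakk>compact K; K \<subseteq> \<bbbD>\<rbrakk> \<Longrightarrow> uniform_limit K (f \<circ> r) g sequentially"
    then show ?thesis
      by (intro exI[of _ g] exI[of _ r]) (simp add: o_def)
  next
    fix h assume "h \<in> range f"
    then show "h holomorphic_on \<bbbD>" using fh by blast
  qed (use bd in auto)
  then obtain g0 r where g0: "g0 holomorphic_on \<bbbD>" and r: "strict_mono (r :: nat \<Rightarrow> nat)"
    and lim: "\<forall>z\<in>\<bbbD>. (\<lambda>n. f (r n) z) \<longlonglongrightarrow> g0 z"
    and ul: "\<forall>K. compact K \<longrightarrow> K \<subseteq> \<bbbD> \<longrightarrow> uniform_limit K (\<lambda>n. f (r n)) g0 sequentially"
    by blast
  define g where "g = restrict g0 \<bbbD>"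
  have g: "g holomorphic_on \<bbbD>" by (rule holomorphic_transform[OF g0]) (simp add: g_def)
  have limd: "(\<lambda>n. deriv (f (r n)) z) \<longlonglongrightarrow> deriv g z" if z: "z \<in> \<bbbD>" for z
  proof -
    obtain t where t: "t > 0" "cball z t \<subseteq> \<bbbD>" using z open_contains_cball[of \<bbbD>] by (metis open_ball)
    have "uniform_limit (ball z t) (\<lambda>n. f (r n)) g0 sequentially"
      by (rule uniform_limit_on_subset[OF ul[rule_format, OF compact_cball t(2)] ball_subset_cball])
    moreover have "f n holomorphic_on ball z t" for n
      using t(2) ball_subset_cball by (intro holomorphic_on_subset[OF fh]) blast
    ultimately have "(\<lambda>n. deriv (f (r n)) z) \<longlonglongrightarrow> deriv g0 z"
      using t(1) by (intro deriv_complex_uniform_limit[where A = "ball z t"]) auto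
    moreover have "deriv g z = deriv g0 z" by (rule deriv_eq_on_disk[OF _ z]) (simp add: g_def)
    ultimately show ?thesis by simp
  qed
  have limg: "(\<lambda>n. f (r n) z) \<longlonglongrightarrow> g z" if "z \<in> \<bbbD>" for z
    using lim that by (simp add: g_def)
  have gC: "dirichlet_normsq \<alpha> g \<le> ennreal C"
    by (rule dirichlet_normsq_lower_semicontinuous[of "\<lambda>n. f (r n)", OF fh g limg limd bound C]) auto
  then have "dirichlet_normsq \<alpha> g < \<infinity>" by (auto simp: le_less_trans)
  then have "g \<in> dirichlet_space \<alpha>" using g by (simp add: dirichlet_space_def g_def)
  then show ?thesis using r limg limd gC by blast
qed

lemma zero_in_dirichlet_space: "restrict (\<lambda>_. 0) \<bbbD> \<in> dirichlet_space \<alpha>"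
proof -
  have "dirichlet_normsq \<alpha> (restrict (\<lambda>_. 0) \<bbbD>) = dirichlet_normsq \<alpha> (\<lambda>_. 0)"
    by (rule dirichlet_normsq_cong) simp
  also have "\<dots> = 0" by (simp add: dirichlet_normsq_def)
  finally have "dirichlet_normsq \<alpha> (restrict (\<lambda>_. 0) \<bbbD>) = 0" .
  moreover have "restrict (\<lambda>_. 0) \<bbbD> holomorphic_on \<bbbD>"
    by (rule holomorphic_transform[of "\<lambda>_. 0"]) auto
  ultimately show ?thesis by (simp add: dirichlet_space_def)
qed

lemma dirichlet_dist_zero: "dirichlet_dist \<alpha> f (restrict (\<lambda>_. 0) \<bbbD>) = dirichlet_norm \<alpha> f"
proof -
  have "dirichlet_normsq \<alpha> (\<lambda>z. f z - restrict (\<lambda>_. 0) \<bbbD> z) = dirichlet_normsq \<alpha> f"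
    by (rule dirichlet_normsq_cong) simp
  then show ?thesis by (simp add: dirichlet_dist_def dirichlet_norm_def)
qed

lemma dirichlet_dist_limit_le:
  assumes f: "\<And>n. f n \<in> dirichlet_space \<alpha>" and g: "g \<in> dirichlet_space \<alpha>" and h: "h \<in> dirichlet_space \<alpha>"
    and lim: "\<And>z. z \<in> \<bbbD> \<Longrightarrow> (\<lambda>n. f n z) \<longlonglongrightarrow> g z" "\<And>z. z \<in> \<bbbD> \<Longrightarrow> (\<lambda>n. deriv (f n) z) \<longlonglongrightarrow> deriv g z"
    and e: "0 \<le> e" "\<And>n. dirichlet_dist \<alpha> (f n) h \<le> e"
  shows "dirichlet_dist \<alpha> g h \<le> e"
proof -
  have fh: "f n holomorphic_on \<bbbD>" and gh: "g holomorphic_on \<bbbD>" and hh: "h holomorphic_on \<bbbD>" for n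
    using f g h by (auto simp: dirichlet_space_def)
  have d: "deriv (\<lambda>z. k z - h z) z = deriv k z - deriv h z" if "k holomorphic_on \<bbbD>" "z \<in> \<bbbD>" for k z
    using that hh by (intro deriv_diff) (auto intro: holomorphic_on_imp_differentiable_at)
  have "dirichlet_normsq \<alpha> (\<lambda>z. g z - h z) \<le> ennreal (e\<^sup>2)"
  proof (rule dirichlet_normsq_lower_semicontinuous[of "\<lambda>n z. f n z - h z"])
    show "(\<lambda>n. f n 0 - h 0) \<longlonglongrightarrow> g 0 - h 0" by (intro tendsto_intros lim) simp
    show "(\<lambda>n. deriv (\<lambda>z. f n z - h z) z) \<longlonglongrightarrow> deriv (\<lambda>z. g z - h z) z" if "z \<in> \<bbbD>" for z
      unfolding d[OF fh that] d[OF gh that] by (intro tendsto_intros lim that)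
    show "dirichlet_normsq \<alpha> (\<lambda>z. f n z - h z) \<le> ennreal (e\<^sup>2)" for n
      using e dirichlet_dist_le_iff[OF f h e(1)] by blast
  qed (auto intro!: holomorphic_intros fh gh hh)
  then show ?thesis using dirichlet_dist_le_iff[OF g h e(1)] by blast
qed

text \<open>
  A Cauchy sequence is bounded, so a subsequence converges pointwise with its derivatives.  Lower
  semicontinuity of the distance to a fixed later term shows that the limit is also the limit in norm of
  the whole sequence.
\<close>

lemma mcomplete_dirichlet:
  assumes \<alpha>: "-1 < \<alpha>" "\<alpha> < 0"
  shows "Metric_space.mcomplete (dirichlet_space \<alpha>) (dirichlet_dist \<alpha>)"
proof -
  interpret D: Metric_space "dirichlet_space \<alpha>" "dirichlet_dist \<alpha>"
    by (rule Metric_space_dirichlet[OF \<alpha>(1)])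
  show ?thesis
    unfolding D.mcomplete_def
  proof (intro allI impI)
    fix \<sigma> assume C: "D.MCauchy \<sigma>"
    then have \<sigma>: "\<sigma> n \<in> dirichlet_space \<alpha>" for n by (auto simp: D.MCauchy_def)
    have cau: "\<exists>N. \<forall>m n. N \<le> m \<longrightarrow> N \<le> n \<longrightarrow> dirichlet_dist \<alpha> (\<sigma> m) (\<sigma> n) < e" if "e > 0" for e
      using C that unfolding D.MCauchy_def by blast
    obtain N where N: "\<And>n. N \<le> n \<Longrightarrow> dirichlet_dist \<alpha> (\<sigma> n) (\<sigma> N) < 1"
      using cau[of 1] by auto
    define z0 where "z0 = restrict (\<lambda>_. 0::complex) \<bbbD>"
    define C where "C = 1 + dirichlet_dist \<alpha> (\<sigma> N) z0"
    have z0: "z0 \<in> dirichlet_space \<alpha>" unfolding z0_def by (rule zero_in_dirichlet_space)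
    have bound: "dirichlet_normsq \<alpha> (\<sigma> (n + N)) \<le> ennreal (C\<^sup>2)" for n
    proof -
      have "dirichlet_dist \<alpha> (\<sigma> (n + N)) z0 \<le> dirichlet_dist \<alpha> (\<sigma> (n + N)) (\<sigma> N) + dirichlet_dist \<alpha> (\<sigma> N) z0"
        by (rule D.triangle[OF \<sigma> \<sigma> z0])
      also have "\<dots> \<le> C" using N[of "n + N"] by (simp add: C_def)
      finally have "dirichlet_norm \<alpha> (\<sigma> (n + N)) \<le> C" by (simp add: z0_def dirichlet_dist_zero)
      then show ?thesis
        unfolding dirichlet_norm_sq[OF \<sigma>] by (intro ennreal_leI power_mono) (auto simp: dirichlet_norm_def)
    qed
    obtain g r where g: "g \<in> dirichlet_space \<alpha>" and r: "strict_mono (r :: nat \<Rightarrow> nat)"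
      and lim: "\<forall>z\<in>\<bbbD>. (\<lambda>n. \<sigma> (r n + N) z) \<longlonglongrightarrow> g z" "\<forall>z\<in>\<bbbD>. (\<lambda>n. deriv (\<sigma> (r n + N)) z) \<longlonglongrightarrow> deriv g z"
      using dirichlet_bounded_has_convergent_subsequence[OF \<alpha>, of "\<lambda>n. \<sigma> (n + N)" "C\<^sup>2"] \<sigma> bound by auto
    have "\<forall>\<^sub>F m in sequentially. \<sigma> m \<in> dirichlet_space \<alpha> \<and> dirichlet_dist \<alpha> (\<sigma> m) g < e" if e: "e > 0" for e
    proof -
      obtain N' where N': "\<And>m n. N' \<le> m \<Longrightarrow> N' \<le> n \<Longrightarrow> dirichlet_dist \<alpha> (\<sigma> m) (\<sigma> n) < e / 2"
        using cau[of "e / 2"] e by auto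
      have "dirichlet_dist \<alpha> g (\<sigma> m) \<le> e / 2" if m: "N' \<le> m" for m
      proof (rule dirichlet_dist_limit_le[of "\<lambda>n. \<sigma> (r (n + N') + N)"])
        show "(\<lambda>n. \<sigma> (r (n + N') + N) z) \<longlonglongrightarrow> g z" if "z \<in> \<bbbD>" for z
          using lim(1) that by (intro LIMSEQ_ignore_initial_segment[of "\<lambda>n. \<sigma> (r n + N) z"]) auto
        show "(\<lambda>n. deriv (\<sigma> (r (n + N') + N)) z) \<longlonglongrightarrow> deriv g z" if "z \<in> \<bbbD>" for z
          using lim(2) that by (intro LIMSEQ_ignore_initial_segment[of "\<lambda>n. deriv (\<sigma> (r n + N)) z"]) auto
        show "dirichlet_dist \<alpha> (\<sigma> (r (n + N') + N)) (\<sigma> m) \<le> e / 2" for n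
        proof -
          have "N' \<le> r (n + N') + N" using seq_suble[OF r, of "n + N'"] by simp
          then show ?thesis using N'[OF _ m] less_imp_le by blast
        qed
      qed (use \<sigma> g e in auto)
      then have "\<sigma> m \<in> dirichlet_space \<alpha> \<and> dirichlet_dist \<alpha> (\<sigma> m) g < e" if "N' \<le> m" for m
        using \<sigma> e that D.commute[of "\<sigma> m" g] by (metis field_sum_of_halves le_less_trans less_add_same_cancel1 half_gt_zero)
      then show ?thesis unfolding eventually_sequentially by blast
    qed
    then show "\<exists>x. limitin D.mtopology \<sigma> x sequentially"
      unfolding D.limitin_metric using g by blast
  qed
qed

context disk_self_map
begin

abbreviation C\<^sub>\<phi> where "C\<^sub>\<phi> \<equiv> composition_op \<phi>"

lemma composition_op_apply: "z \<in> \<bbbD> \<Longrightarrow> C\<^sub>\<phi> f z = f (\<phi> z)"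
  by (simp add: composition_op_def compose_def)

lemma in_disk: "z \<in> \<bbbD> \<Longrightarrow> \<phi> z \<in> \<bbbD>"
  using into by blast

lemma holomorphic_composition_op:
  assumes "f holomorphic_on \<bbbD>"
  shows "C\<^sub>\<phi> f holomorphic_on \<bbbD>"
proof (rule holomorphic_transform)
  show "f \<circ> \<phi> holomorphic_on \<bbbD>" using hol assms into by (rule holomorphic_on_compose_gen)
qed (simp add: composition_op_apply)

lemma deriv_composition_op:
  assumes f: "f holomorphic_on \<bbbD>" and z: "z \<in> \<bbbD>"
  shows "deriv (C\<^sub>\<phi> f) z = deriv f (\<phi> z) * deriv \<phi> z"
proof -
  have "deriv (C\<^sub>\<phi> f) z = deriv (f \<circ> \<phi>) z"
    by (rule deriv_eq_on_disk[OF _ z]) (simp add: composition_op_apply)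
  also have "\<dots> = deriv f (\<phi> z) * deriv \<phi> z"
    using f hol z in_disk[OF z] by (intro deriv_chain) (auto intro: holomorphic_on_imp_differentiable_at)
  finally show ?thesis .
qed

text \<open>
  The chain rule and the area formula for \<open>\<phi>\<close>.
\<close>

lemma weighted_energy_composition_op:
  assumes f: "f holomorphic_on \<bbbD>"
  shows "weighted_energy \<alpha> (C\<^sub>\<phi> f) = counting_energy f"
proof -
  define F where "F = (\<lambda>w. sqnorm (if w \<in> \<bbbD> then deriv f w else 0))"
  have F: "F \<in> borel_measurable borel"
    unfolding F_def by (rule holomorphic_deriv_sq_measurable(1)[OF f])
  have "weighted_energy \<alpha> (C\<^sub>\<phi> f)
      = (\<integral>\<^sup>+z\<in>\<bbbD>. F (\<phi> z) * ennreal (disk_weight \<alpha> z) * sqnorm (deriv \<phi> z) \<partial>lborel)"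
    unfolding weighted_energy_def
  proof (intro nn_integral_cong)
    fix z
    show "sqnorm (deriv (C\<^sub>\<phi> f) z) * ennreal (disk_weight \<alpha> z) * indicator \<bbbD> z
      = F (\<phi> z) * ennreal (disk_weight \<alpha> z) * sqnorm (deriv \<phi> z) * indicator \<bbbD> z"
      using in_disk[of z] by (cases "z \<in> \<bbbD>")
        (auto simp: F_def deriv_composition_op[OF f] norm_mult power_mult_distrib ennreal_mult mult_ac)
  qed
  also have "\<dots> = (\<integral>\<^sup>+w. F w * preimage_sum \<bbbD> \<phi> (disk_weight \<alpha>) w \<partial>lborel)"
    by (rule nn_integral_area_formula[OF open_ball connected_ball hol nonconst continuous_on_disk_weight _ F]) simp
  also have "\<dots> = counting_energy f"
    unfolding counting_energy_def counting_fun_eq_preimage_sum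
    by (intro nn_integral_cong) (auto simp: F_def indicator_def)
  finally show ?thesis .
qed

lemma dirichlet_normsq_composition_op:
  assumes f: "f holomorphic_on \<bbbD>"
  shows "dirichlet_normsq \<alpha> (C\<^sub>\<phi> f) = sqnorm (f 0) + ennreal ((1 + \<alpha>) / pi) * counting_energy f"
  unfolding dirichlet_normsq_eq_energy[OF holomorphic_composition_op[OF f] \<alpha>(1)]
    weighted_energy_composition_op[OF f]
  by (simp add: composition_op_apply fix0)

lemma counting_energy_bounded:
  assumes utc: "uniform_tail_condition \<phi> \<alpha>"
  shows "\<exists>K>0. \<forall>f\<in>dirichlet_space \<alpha>. counting_energy f \<le> ennreal K * weighted_energy \<alpha> f"
proof -
  obtain M where M: "0 < M" and tail: "\<And>f. f \<in> dirichlet_space0 \<alpha> \<Longrightarrow>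
    (\<integral>\<^sup>+w\<in>tail_set \<phi> \<alpha> M. sqnorm (deriv f w) * N w \<partial>lborel) \<le> ennreal 1 * weighted_energy \<alpha> f"
    using tail_energy_small[OF utc zero_less_one] by blast
  have "counting_energy f \<le> ennreal (M + 1) * weighted_energy \<alpha> f" if fD: "f \<in> dirichlet_space \<alpha>" for f
  proof -
    have f: "f holomorphic_on \<bbbD>" using fD by (simp add: dirichlet_space_def)
    obtain h where h: "h \<in> dirichlet_space0 \<alpha>" and dh: "\<And>z. z \<in> \<bbbD> \<Longrightarrow> deriv h z = deriv f z"
      and eh: "weighted_energy \<alpha> h = weighted_energy \<alpha> f"
      using recentre_in_dirichlet_space0[OF fD \<alpha>(1)] by blast
    note th = tail[OF h]
    define F where "F = (\<lambda>w. sqnorm (if w \<in> \<bbbD> then deriv f w else 0))"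
    have F: "F \<in> borel_measurable borel"
      unfolding F_def by (rule holomorphic_deriv_sq_measurable(1)[OF f])
    have "counting_energy f = (\<integral>\<^sup>+w\<in>\<bbbD>. F w * N w \<partial>lborel)"
      unfolding counting_energy_def by (intro nn_integral_cong) (auto simp: F_def indicator_def)
    also have "\<dots> \<le> ennreal M * (\<integral>\<^sup>+w\<in>\<bbbD> \<inter> \<phi> ` \<bbbD>. F w * ennreal (disk_weight \<alpha> w) \<partial>lborel)
      + (\<integral>\<^sup>+w\<in>\<bbbD> \<inter> tail_set \<phi> \<alpha> M. F w * N w \<partial>lborel)"
      by (rule nn_integral_counting_split[OF F borel_disk subset_refl])
    also have "\<dots> \<le> ennreal M * weighted_energy \<alpha> f + ennreal 1 * weighted_energy \<alpha> f"
    proof (intro add_mono mult_left_mono)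
      show "(\<integral>\<^sup>+w\<in>\<bbbD> \<inter> \<phi> ` \<bbbD>. F w * ennreal (disk_weight \<alpha> w) \<partial>lborel) \<le> weighted_energy \<alpha> f"
        unfolding weighted_energy_def by (intro nn_integral_mono) (auto simp: F_def indicator_def)
      have "(\<integral>\<^sup>+w\<in>\<bbbD> \<inter> tail_set \<phi> \<alpha> M. F w * N w \<partial>lborel)
          \<le> (\<integral>\<^sup>+w\<in>tail_set \<phi> \<alpha> M. sqnorm (deriv h w) * N w \<partial>lborel)"
        by (intro nn_integral_mono) (auto simp: F_def indicator_def dh)
      then show "(\<integral>\<^sup>+w\<in>\<bbbD> \<inter> tail_set \<phi> \<alpha> M. F w * N w \<partial>lborel) \<le> ennreal 1 * weighted_energy \<alpha> f"
        using th unfolding eh by (rule order_trans)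
    qed simp
    also have "\<dots> = ennreal (M + 1) * weighted_energy \<alpha> f"
      using M by (simp add: distrib_right)
    finally show ?thesis .
  qed
  then show ?thesis using M by (intro exI[of _ "M + 1"]) auto
qed

end

section \<open>Closed range and lower bounds\<close>

lemma diff_in_dirichlet_space:
  assumes f: "f \<in> dirichlet_space \<alpha>" and g: "g \<in> dirichlet_space \<alpha>"
  shows "restrict (\<lambda>z. f z - g z) \<bbbD> \<in> dirichlet_space \<alpha>"
proof -
  have "(\<lambda>z. f z - g z) holomorphic_on \<bbbD>"
    using f g by (auto simp: dirichlet_space_def intro!: holomorphic_intros)
  then have "restrict (\<lambda>z. f z - g z) \<bbbD> holomorphic_on \<bbbD>"
    by (rule holomorphic_transform) simp
  moreover have "dirichlet_normsq \<alpha> (restrict (\<lambda>z. f z - g z) \<bbbD>) = dirichlet_normsq \<alpha> (\<lambda>z. f z - g z)"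
    by (rule dirichlet_normsq_cong) simp
  ultimately show ?thesis
    using dirichlet_normsq_diff_finite[OF f g] by (simp add: dirichlet_space_def)
qed

lemma dirichlet_dist_eq_norm_diff:
  "dirichlet_dist \<alpha> f g = dirichlet_norm \<alpha> (restrict (\<lambda>z. f z - g z) \<bbbD>)"
proof -
  have "dirichlet_normsq \<alpha> (\<lambda>z. f z - g z) = dirichlet_normsq \<alpha> (restrict (\<lambda>z. f z - g z) \<bbbD>)"
    by (rule dirichlet_normsq_cong) simp
  then show ?thesis by (simp add: dirichlet_dist_def dirichlet_norm_def)
qed

lemma dirichlet_norm_scale:
  assumes "f \<in> dirichlet_space \<alpha>" "0 \<le> s"
  shows "dirichlet_norm \<alpha> (restrict (\<lambda>z. of_real s * f z) \<bbbD>) = s * dirichlet_norm \<alpha> f"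
proof -
  have f: "f holomorphic_on \<bbbD>" using assms by (simp add: dirichlet_space_def)
  have "dirichlet_normsq \<alpha> (restrict (\<lambda>z. of_real s * f z) \<bbbD>) = ennreal (s\<^sup>2) * dirichlet_normsq \<alpha> f"
    using dirichlet_normsq_cong[of "restrict (\<lambda>z. of_real s * f z) \<bbbD>"] dirichlet_normsq_scale[OF f] by simp
  then show ?thesis
    using assms(2) by (simp add: dirichlet_norm_def enn2real_mult real_sqrt_mult)
qed

lemma dirichlet_norm_nonneg: "0 \<le> dirichlet_norm \<alpha> f"
  by (simp add: dirichlet_norm_def)

context disk_self_map
begin

lemma composition_op_in_dirichlet_space:
  assumes utc: "uniform_tail_condition \<phi> \<alpha>" and fD: "f \<in> dirichlet_space \<alpha>"
  shows "C\<^sub>\<phi> f \<in> dirichlet_space \<alpha>"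
proof -
  have f: "f holomorphic_on \<bbbD>" using fD by (simp add: dirichlet_space_def)
  obtain K where K: "0 < K" "\<And>f. f \<in> dirichlet_space \<alpha> \<Longrightarrow> counting_energy f \<le> ennreal K * weighted_energy \<alpha> f"
    using counting_energy_bounded[OF utc] by blast
  have "counting_energy f \<le> ennreal K * weighted_energy \<alpha> f" by (rule K(2)[OF fD])
  also have "\<dots> < \<infinity>" using weighted_energy_finite[OF fD \<alpha>(1)] by (simp add: ennreal_mult_less_top)
  finally have "dirichlet_normsq \<alpha> (C\<^sub>\<phi> f) < \<infinity>"
    unfolding dirichlet_normsq_composition_op[OF f] by (simp add: ennreal_mult_less_top)
  then show ?thesis
    using holomorphic_composition_op[OF f] by (simp add: dirichlet_space_def composition_op_def compose_extensional)
qed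

lemma dirichlet_dist_composition_op:
  "dirichlet_dist \<alpha> (C\<^sub>\<phi> f) (C\<^sub>\<phi> g) = dirichlet_norm \<alpha> (C\<^sub>\<phi> (restrict (\<lambda>z. f z - g z) \<bbbD>))"
proof -
  have "dirichlet_normsq \<alpha> (\<lambda>z. C\<^sub>\<phi> f z - C\<^sub>\<phi> g z) = dirichlet_normsq \<alpha> (C\<^sub>\<phi> (restrict (\<lambda>z. f z - g z) \<bbbD>))"
    by (rule dirichlet_normsq_cong) (simp add: composition_op_apply in_disk[simplified])
  then show ?thesis by (simp add: dirichlet_dist_def dirichlet_norm_def)
qed

lemma composition_op_norm_le:
  assumes utc: "uniform_tail_condition \<phi> \<alpha>"
  shows "\<exists>B>0. \<forall>f\<in>dirichlet_space \<alpha>. dirichlet_norm \<alpha> (C\<^sub>\<phi> f) \<le> B * dirichlet_norm \<alpha> f"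
proof -
  obtain K where K: "0 < K" "\<And>f. f \<in> dirichlet_space \<alpha> \<Longrightarrow> counting_energy f \<le> ennreal K * weighted_energy \<alpha> f"
    using counting_energy_bounded[OF utc] by blast
  have "dirichlet_norm \<alpha> (C\<^sub>\<phi> f) \<le> sqrt (1 + K) * dirichlet_norm \<alpha> f" if fD: "f \<in> dirichlet_space \<alpha>" for f
  proof -
    have f: "f holomorphic_on \<bbbD>" using fD by (simp add: dirichlet_space_def)
    have "dirichlet_normsq \<alpha> (C\<^sub>\<phi> f) \<le> sqnorm (f 0) + ennreal ((1 + \<alpha>) / pi) * (ennreal K * weighted_energy \<alpha> f)"
      unfolding dirichlet_normsq_composition_op[OF f] by (intro add_left_mono mult_left_mono K(2) fD) simp
    also have "\<dots> = 1 * sqnorm (f 0) + ennreal K * (ennreal ((1 + \<alpha>) / pi) * weighted_energy \<alpha> f)"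
      by (simp add: mult_ac)
    also have "\<dots> \<le> ennreal (1 + K) * sqnorm (f 0) + ennreal (1 + K) * (ennreal ((1 + \<alpha>) / pi) * weighted_energy \<alpha> f)"
      using K(1) by (intro add_mono mult_right_mono) (auto simp: ennreal_ge_1 intro: ennreal_leI simp del: ennreal_plus)
    also have "\<dots> = ennreal (1 + K) * dirichlet_normsq \<alpha> f"
      unfolding dirichlet_normsq_eq_energy[OF f \<alpha>(1)] by (simp only: distrib_left)
    finally have "ennreal ((dirichlet_norm \<alpha> (C\<^sub>\<phi> f))\<^sup>2) \<le> ennreal ((1 + K) * (dirichlet_norm \<alpha> f)\<^sup>2)"
      using K(1) unfolding dirichlet_norm_sq[OF fD] dirichlet_norm_sq[OF composition_op_in_dirichlet_space[OF utc fD]]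
      by (simp add: ennreal_mult)
    then have "(dirichlet_norm \<alpha> (C\<^sub>\<phi> f))\<^sup>2 \<le> (1 + K) * (dirichlet_norm \<alpha> f)\<^sup>2"
      using K(1) by (subst (asm) ennreal_le_iff) auto
    then have "sqrt ((dirichlet_norm \<alpha> (C\<^sub>\<phi> f))\<^sup>2) \<le> sqrt ((1 + K) * (dirichlet_norm \<alpha> f)\<^sup>2)"
      by (rule real_sqrt_le_mono)
    then show ?thesis by (simp add: real_sqrt_mult dirichlet_norm_nonneg)
  qed
  then show ?thesis using K(1) by (intro exI[of _ "sqrt (1 + K)"]) auto
qed

text \<open>
  The composition operator preserves \<open>f(0)\<close>, so a lower bound for the norm concerns only the energies,
  after recentring \<open>f\<close> in one direction and lowering the constant to at most one in the other.
\<close>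

lemma norm_bounded_below_iff_energy_bounded_below:
  assumes utc: "uniform_tail_condition \<phi> \<alpha>"
  shows "(\<exists>b>0. \<forall>f\<in>dirichlet_space \<alpha>. b * dirichlet_norm \<alpha> f \<le> dirichlet_norm \<alpha> (C\<^sub>\<phi> f))
    \<longleftrightarrow> (\<exists>c>0. \<forall>f\<in>dirichlet_space \<alpha>. ennreal c * weighted_energy \<alpha> f \<le> counting_energy f)"
proof
  assume "\<exists>b>0. \<forall>f\<in>dirichlet_space \<alpha>. b * dirichlet_norm \<alpha> f \<le> dirichlet_norm \<alpha> (C\<^sub>\<phi> f)"
  then obtain b where b: "0 < b" "\<And>f. f \<in> dirichlet_space \<alpha> \<Longrightarrow> b * dirichlet_norm \<alpha> f \<le> dirichlet_norm \<alpha> (C\<^sub>\<phi> f)"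
    by blast
  have "ennreal (b\<^sup>2) * weighted_energy \<alpha> f \<le> counting_energy f" if fD: "f \<in> dirichlet_space \<alpha>" for f
  proof -
    have f: "f holomorphic_on \<bbbD>" using fD by (simp add: dirichlet_space_def)
    obtain h where h0D: "h \<in> dirichlet_space0 \<alpha>" and dh: "\<And>z. z \<in> \<bbbD> \<Longrightarrow> deriv h z = deriv f z"
      and eh: "weighted_energy \<alpha> h = weighted_energy \<alpha> f"
      using recentre_in_dirichlet_space0[OF fD \<alpha>(1)] by blast
    then have hD: "h \<in> dirichlet_space \<alpha>" and h: "h holomorphic_on \<bbbD>" and h0: "h 0 = 0"
      by (auto simp: dirichlet_space0_def dirichlet_space_def)
    have ch: "counting_energy h = counting_energy f"
      unfolding counting_energy_def by (intro nn_integral_cong) (auto simp: indicator_def dh)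
    have nh: "dirichlet_normsq \<alpha> h = ennreal ((1 + \<alpha>) / pi) * weighted_energy \<alpha> f"
      "dirichlet_normsq \<alpha> (C\<^sub>\<phi> h) = ennreal ((1 + \<alpha>) / pi) * counting_energy f"
      by (simp_all add: dirichlet_normsq_eq_energy[OF h \<alpha>(1)] dirichlet_normsq_composition_op[OF h] h0 eh ch)
    have "(b * dirichlet_norm \<alpha> h)\<^sup>2 \<le> (dirichlet_norm \<alpha> (C\<^sub>\<phi> h))\<^sup>2"
      using b(1) by (intro power_mono b(2) hD) (simp add: dirichlet_norm_nonneg)
    then have "ennreal (b\<^sup>2) * dirichlet_normsq \<alpha> h \<le> dirichlet_normsq \<alpha> (C\<^sub>\<phi> h)"
      unfolding dirichlet_norm_sq[OF hD] dirichlet_norm_sq[OF composition_op_in_dirichlet_space[OF utc hD]]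
      by (simp add: ennreal_mult[symmetric] power_mult_distrib ennreal_leI)
    then have "ennreal (pi / (1 + \<alpha>)) * (ennreal (b\<^sup>2) * (ennreal ((1 + \<alpha>) / pi) * weighted_energy \<alpha> f))
        \<le> ennreal (pi / (1 + \<alpha>)) * (ennreal ((1 + \<alpha>) / pi) * counting_energy f)"
      unfolding nh by (intro mult_left_mono) auto
    moreover have "ennreal (pi / (1 + \<alpha>)) * (ennreal ((1 + \<alpha>) / pi) * x) = x" for x
      using \<alpha> by (subst ennreal_mult_collect) auto
    moreover have "ennreal (b\<^sup>2) * (ennreal ((1 + \<alpha>) / pi) * weighted_energy \<alpha> f) = ennreal ((1 + \<alpha>) / pi) * (ennreal (b\<^sup>2) * weighted_energy \<alpha> f)"
      by (rule mult.left_commute)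
    ultimately show ?thesis by (simp only:)
  qed
  then show "\<exists>c>0. \<forall>f\<in>dirichlet_space \<alpha>. ennreal c * weighted_energy \<alpha> f \<le> counting_energy f"
    using b(1) by (intro exI[of _ "b\<^sup>2"]) auto
next
  assume "\<exists>c>0. \<forall>f\<in>dirichlet_space \<alpha>. ennreal c * weighted_energy \<alpha> f \<le> counting_energy f"
  then obtain c where c: "0 < c" "\<And>f. f \<in> dirichlet_space \<alpha> \<Longrightarrow> ennreal c * weighted_energy \<alpha> f \<le> counting_energy f"
    by blast
  define m where "m = min 1 c"
  have m: "0 < m" "m \<le> 1" "m \<le> c" using c by (auto simp: m_def)
  have "sqrt m * dirichlet_norm \<alpha> f \<le> dirichlet_norm \<alpha> (C\<^sub>\<phi> f)" if fD: "f \<in> dirichlet_space \<alpha>" for f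
  proof -
    have f: "f holomorphic_on \<bbbD>" using fD by (simp add: dirichlet_space_def)
    have "ennreal m * dirichlet_normsq \<alpha> f = ennreal m * sqnorm (f 0) + ennreal ((1 + \<alpha>) / pi) * (ennreal m * weighted_energy \<alpha> f)"
      unfolding dirichlet_normsq_eq_energy[OF f \<alpha>(1)] by (simp add: distrib_left mult.left_commute)
    also have "\<dots> \<le> 1 * sqnorm (f 0) + ennreal ((1 + \<alpha>) / pi) * counting_energy f"
    proof (intro add_mono mult_right_mono mult_left_mono)
      show "ennreal m \<le> 1" using m by simp
      have "ennreal m * weighted_energy \<alpha> f \<le> ennreal c * weighted_energy \<alpha> f"
        using m by (intro mult_right_mono ennreal_leI) auto
      then show "ennreal m * weighted_energy \<alpha> f \<le> counting_energy f" using c(2)[OF fD] by (rule order_trans)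
    qed auto
    also have "\<dots> = dirichlet_normsq \<alpha> (C\<^sub>\<phi> f)" by (simp add: dirichlet_normsq_composition_op[OF f])
    finally have "ennreal (m * (dirichlet_norm \<alpha> f)\<^sup>2) \<le> ennreal ((dirichlet_norm \<alpha> (C\<^sub>\<phi> f))\<^sup>2)"
      using m unfolding dirichlet_norm_sq[OF fD] dirichlet_norm_sq[OF composition_op_in_dirichlet_space[OF utc fD]]
      by (simp add: ennreal_mult)
    then have "m * (dirichlet_norm \<alpha> f)\<^sup>2 \<le> (dirichlet_norm \<alpha> (C\<^sub>\<phi> f))\<^sup>2"
      by (subst (asm) ennreal_le_iff) auto
    then have "sqrt (m * (dirichlet_norm \<alpha> f)\<^sup>2) \<le> sqrt ((dirichlet_norm \<alpha> (C\<^sub>\<phi> f))\<^sup>2)"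
      by (rule real_sqrt_le_mono)
    then show ?thesis by (simp add: real_sqrt_mult dirichlet_norm_nonneg)
  qed
  then show "\<exists>b>0. \<forall>f\<in>dirichlet_space \<alpha>. b * dirichlet_norm \<alpha> f \<le> dirichlet_norm \<alpha> (C\<^sub>\<phi> f)"
    using m(1) by (intro exI[of _ "sqrt m"]) auto
qed

lemma inj_on_composition_op: "inj_on C\<^sub>\<phi> (dirichlet_space \<alpha>)"
proof (rule inj_onI)
  fix f g assume f: "f \<in> dirichlet_space \<alpha>" and g: "g \<in> dirichlet_space \<alpha>" and eq: "C\<^sub>\<phi> f = C\<^sub>\<phi> g"
  have "f w = g w" if "w \<in> \<phi> ` \<bbbD>" for w
    using that eq composition_op_apply by (metis imageE)
  note on_range = this
  have ne: "\<phi> ` \<bbbD> \<noteq> {}" by simp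
  have h: "f holomorphic_on \<bbbD>" "g holomorphic_on \<bbbD>"
    using f g by (simp_all add: dirichlet_space_def)
  have "f z = g z" if "z \<in> \<bbbD>" for z
    by (rule analytic_continuation_open[OF open_range open_ball ne connected_ball into h on_range that])
  then show "f = g"
    using f g by (intro extensionalityI[of f \<bbbD> g]) (auto simp: dirichlet_space_def)
qed

lemma closed_range_if_norm_bounded_below:
  assumes utc: "uniform_tail_condition \<phi> \<alpha>" and b: "0 < b"
    and below: "\<And>f. f \<in> dirichlet_space \<alpha> \<Longrightarrow> b * dirichlet_norm \<alpha> f \<le> dirichlet_norm \<alpha> (C\<^sub>\<phi> f)"
  shows "has_closed_range \<phi> \<alpha>"
proof -
  interpret D: Metric_space "dirichlet_space \<alpha>" "dirichlet_dist \<alpha>"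
    by (rule Metric_space_dirichlet[OF \<alpha>(1)])
  let ?d = "dirichlet_dist \<alpha>"
  obtain B where B: "0 < B" "\<And>f. f \<in> dirichlet_space \<alpha> \<Longrightarrow> dirichlet_norm \<alpha> (C\<^sub>\<phi> f) \<le> B * dirichlet_norm \<alpha> f"
    using composition_op_norm_le[OF utc] by blast
  have lo: "b * ?d f g \<le> ?d (C\<^sub>\<phi> f) (C\<^sub>\<phi> g)" and up: "?d (C\<^sub>\<phi> f) (C\<^sub>\<phi> g) \<le> B * ?d f g"
    if "f \<in> dirichlet_space \<alpha>" "g \<in> dirichlet_space \<alpha>" for f g
    unfolding dirichlet_dist_composition_op unfolding dirichlet_dist_eq_norm_diff
    by (rule below B(2), rule diff_in_dirichlet_space[OF that])+
  have CD: "C\<^sub>\<phi> f \<in> dirichlet_space \<alpha>" if "f \<in> dirichlet_space \<alpha>" for f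
    by (rule composition_op_in_dirichlet_space[OF utc that])
  show ?thesis
    unfolding has_closed_range_def D.metric_closedin_iff_sequentially_closed
  proof (intro conjI allI impI)
    show CX: "C\<^sub>\<phi> ` dirichlet_space \<alpha> \<subseteq> dirichlet_space \<alpha>" using CD by blast
    fix \<sigma> l assume \<sigma>l: "range \<sigma> \<subseteq> C\<^sub>\<phi> ` dirichlet_space \<alpha> \<and> limitin D.mtopology \<sigma> l sequentially"
    then have "\<forall>n. \<exists>f. f \<in> dirichlet_space \<alpha> \<and> \<sigma> n = C\<^sub>\<phi> f" by blast
    then obtain f where f: "\<And>n. f n \<in> dirichlet_space \<alpha>" "\<And>n. \<sigma> n = C\<^sub>\<phi> (f n)"
      by metis
    have "D.MCauchy \<sigma>"
    proof (rule D.convergent_imp_MCauchy)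
      show "range \<sigma> \<subseteq> dirichlet_space \<alpha>" using conjunct1[OF \<sigma>l] CX by (rule order_trans)
      show "limitin D.mtopology \<sigma> l sequentially" by (rule conjunct2[OF \<sigma>l])
    qed
    then have cau: "\<exists>n0. \<forall>m n. n0 \<le> m \<longrightarrow> n0 \<le> n \<longrightarrow> ?d (\<sigma> m) (\<sigma> n) < e" if "0 < e" for e
      using that unfolding D.MCauchy_def by blast
    have "D.MCauchy f"
      unfolding D.MCauchy_def
    proof (intro conjI allI impI)
      show "range f \<subseteq> dirichlet_space \<alpha>" using f by blast
      fix e :: real assume e: "0 < e"
      then obtain n0 where n0: "\<And>m n. n0 \<le> m \<Longrightarrow> n0 \<le> n \<Longrightarrow> ?d (\<sigma> m) (\<sigma> n) < b * e"
        using cau[of "b * e"] b by auto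
      have "?d (f m) (f n) < e" if "n0 \<le> m" "n0 \<le> n" for m n
      proof -
        have "b * ?d (f m) (f n) < b * e"
          using lo[OF f(1) f(1), of m n] n0[OF that] by (simp add: f(2))
        then show ?thesis using b by simp
      qed
      then show "\<exists>n0. \<forall>m n. n0 \<le> m \<longrightarrow> n0 \<le> n \<longrightarrow> ?d (f m) (f n) < e" by blast
    qed
    then obtain g where g: "limitin D.mtopology f g sequentially"
      using mcomplete_dirichlet[OF \<alpha>] unfolding D.mcomplete_def by blast
    then have gD: "g \<in> dirichlet_space \<alpha>"
      and glim: "\<And>e. 0 < e \<Longrightarrow> \<forall>\<^sub>F n in sequentially. f n \<in> dirichlet_space \<alpha> \<and> ?d (f n) g < e"
      unfolding D.limitin_metric by blast+
    have "limitin D.mtopology \<sigma> (C\<^sub>\<phi> g) sequentially"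
      unfolding D.limitin_metric
    proof (intro conjI allI impI)
      show "C\<^sub>\<phi> g \<in> dirichlet_space \<alpha>" by (rule CD[OF gD])
      fix e :: real assume e: "0 < e"
      then have "\<forall>\<^sub>F n in sequentially. f n \<in> dirichlet_space \<alpha> \<and> ?d (f n) g < e / B"
        using B(1) by (intro glim) simp
      then show "\<forall>\<^sub>F n in sequentially. \<sigma> n \<in> dirichlet_space \<alpha> \<and> ?d (\<sigma> n) (C\<^sub>\<phi> g) < e"
      proof eventually_elim
        case (elim n)
        then have "B * ?d (f n) g < e" using B(1) by (simp add: field_simps)
        then show ?case using up[OF f(1) gD, of n] CD[OF f(1)] by (simp add: f(2))
      qed
    qed
    then have "l = C\<^sub>\<phi> g"
      by (rule D.limitin_metric_unique[OF conjunct2[OF \<sigma>l] _ sequentially_bot])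
    then show "l \<in> C\<^sub>\<phi> ` dirichlet_space \<alpha>" using gD by blast
  qed
qed

text \<open>
  The range is complete and is the union over \<open>n\<close> of the images \<open>F n\<close> of the balls of radius \<open>n\<close>.  Each
  \<open>F n\<close> is closed: if \<open>f k\<close> lies in the ball and the images converge to \<open>l\<close>, then a subsequence of \<open>f k\<close>
  converges pointwise with its derivatives to some \<open>g\<close> in the ball, and lower semicontinuity shows that
  the image of \<open>g\<close> is \<open>l\<close>.  By Baire's theorem some \<open>F n\<close> contains a ball of the range, about the image
  of some \<open>f0\<close>.  If the image of \<open>h\<close> is small, the image of \<open>f0 - h\<close> is in that ball, so by injectivity
  \<open>f0 - h\<close> has norm at most \<open>n\<close> and \<open>h\<close> has norm at most \<open>2 n\<close>.  Scaling gives the lower bound.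
\<close>

lemma norm_bounded_below_if_closed_range:
  assumes utc: "uniform_tail_condition \<phi> \<alpha>" and closed: "has_closed_range \<phi> \<alpha>"
  shows "\<exists>b>0. \<forall>f\<in>dirichlet_space \<alpha>. b * dirichlet_norm \<alpha> f \<le> dirichlet_norm \<alpha> (C\<^sub>\<phi> f)"
proof -
  let ?d = "dirichlet_dist \<alpha>" and ?X = "dirichlet_space \<alpha>"
  define R where "R = C\<^sub>\<phi> ` ?X"
  interpret D: Metric_space ?X ?d
    by (rule Metric_space_dirichlet[OF \<alpha>(1)])
  have CD: "C\<^sub>\<phi> f \<in> ?X" if "f \<in> ?X" for f
    by (rule composition_op_in_dirichlet_space[OF utc that])
  interpret S: Submetric ?X ?d R
    by unfold_locales (use CD in \<open>auto simp: R_def\<close>)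
  have clR: "closedin D.mtopology R" using closed by (simp add: has_closed_range_def R_def)
  have comp: "S.sub.mcomplete"
    by (rule S.closedin_mcomplete_imp_mcomplete[OF clR mcomplete_dirichlet[OF \<alpha>]])
  define F where "F = (\<lambda>n::nat. C\<^sub>\<phi> ` {f \<in> ?X. dirichlet_norm \<alpha> f \<le> real n})"
  have clF: "closedin S.sub.mtopology (F n)" for n
    unfolding S.sub.metric_closedin_iff_sequentially_closed
  proof (intro conjI allI impI)
    show "F n \<subseteq> R" by (auto simp: F_def R_def)
    fix \<sigma> l assume \<sigma>l: "range \<sigma> \<subseteq> F n \<and> limitin S.sub.mtopology \<sigma> l sequentially"
    then have lR: "l \<in> R" and lim: "\<And>e. 0 < e \<Longrightarrow> \<forall>\<^sub>F k in sequentially. \<sigma> k \<in> R \<and> ?d (\<sigma> k) l < e"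
      unfolding S.sub.limitin_metric by blast+
    have lD: "l \<in> ?X" using lR CD by (auto simp: R_def)
    have "\<forall>k. \<exists>f. f \<in> ?X \<and> dirichlet_norm \<alpha> f \<le> real n \<and> \<sigma> k = C\<^sub>\<phi> f"
      using \<sigma>l unfolding F_def by blast
    then obtain f where f: "\<And>k. f k \<in> ?X" "\<And>k. dirichlet_norm \<alpha> (f k) \<le> real n" "\<And>k. \<sigma> k = C\<^sub>\<phi> (f k)"
      by metis
    have fb: "dirichlet_normsq \<alpha> (f k) \<le> ennreal ((real n)\<^sup>2)" for k
      unfolding dirichlet_norm_sq[OF f(1)] by (intro ennreal_leI power_mono f(2) dirichlet_norm_nonneg)
    obtain g r where g: "g \<in> ?X" and r: "strict_mono (r :: nat \<Rightarrow> nat)"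
      and limg: "\<forall>z\<in>\<bbbD>. (\<lambda>k. f (r k) z) \<longlonglongrightarrow> g z" "\<forall>z\<in>\<bbbD>. (\<lambda>k. deriv (f (r k)) z) \<longlonglongrightarrow> deriv g z"
      and gb: "dirichlet_normsq \<alpha> g \<le> ennreal ((real n)\<^sup>2)"
      using dirichlet_bounded_has_convergent_subsequence[of \<alpha> f "(real n)\<^sup>2", OF \<alpha> f(1) fb] by auto
    have hol_f: "f k holomorphic_on \<bbbD>" for k using f(1) by (simp add: dirichlet_space_def)
    have hol_g: "g holomorphic_on \<bbbD>" using g by (simp add: dirichlet_space_def)
    have "?d (C\<^sub>\<phi> g) l \<le> e" if e: "0 < e" for e
    proof -
      obtain k0 where k0: "\<And>k. k0 \<le> k \<Longrightarrow> ?d (\<sigma> k) l < e"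
        using lim[OF e] unfolding eventually_sequentially by blast
      show ?thesis
      proof (rule dirichlet_dist_limit_le[of "\<lambda>k. \<sigma> (r (k + k0))"])
        show "\<sigma> (r (k + k0)) \<in> ?X" for k using CD f by simp
        show "(\<lambda>k. \<sigma> (r (k + k0)) z) \<longlonglongrightarrow> C\<^sub>\<phi> g z" if z: "z \<in> \<bbbD>" for z
          unfolding f(3) composition_op_apply[OF z]
          using limg(1) in_disk[OF z] by (intro LIMSEQ_ignore_initial_segment[of "\<lambda>k. f (r k) (\<phi> z)"]) auto
        show "(\<lambda>k. deriv (\<sigma> (r (k + k0))) z) \<longlonglongrightarrow> deriv (C\<^sub>\<phi> g) z" if z: "z \<in> \<bbbD>" for z
          unfolding f(3) deriv_composition_op[OF hol_f z] deriv_composition_op[OF hol_g z]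
          using limg(2) in_disk[OF z]
          by (intro tendsto_mult tendsto_const LIMSEQ_ignore_initial_segment[of "\<lambda>k. deriv (f (r k)) (\<phi> z)"]) auto
        show "?d (\<sigma> (r (k + k0))) l \<le> e" for k
        proof -
          have "k0 \<le> r (k + k0)" using seq_suble[OF r, of "k + k0"] by simp
          then show ?thesis using k0 less_imp_le by blast
        qed
      qed (use CD g lD e in auto)
    qed
    then have "?d (C\<^sub>\<phi> g) l \<le> 0" by (rule field_le_epsilon) simp
    then have "C\<^sub>\<phi> g = l"
      using D.zero[OF CD[OF g] lD] dirichlet_dist_nonneg[of \<alpha> "C\<^sub>\<phi> g" l] by simp
    moreover have "dirichlet_norm \<alpha> g \<le> real n"
    proof -
      have "(dirichlet_norm \<alpha> g)\<^sup>2 \<le> (real n)\<^sup>2"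
        using gb unfolding dirichlet_norm_sq[OF g] by (simp add: ennreal_le_iff)
      then show ?thesis by (rule power2_le_imp_le) simp
    qed
    ultimately show "l \<in> F n" using g by (auto simp: F_def)
  qed
  have UF: "\<Union>(range F) = R"
  proof (intro equalityI subsetI)
    fix h assume "h \<in> R"
    then obtain f where f: "f \<in> ?X" "h = C\<^sub>\<phi> f" by (auto simp: R_def)
    then have "h \<in> F (nat \<lceil>dirichlet_norm \<alpha> f\<rceil>)"
      unfolding F_def by (intro image_eqI[of _ _ f]) (auto simp: real_nat_ceiling_ge)
    then show "h \<in> \<Union>(range F)" by blast
  qed (auto simp: F_def R_def)
  have "\<exists>n. S.sub.mtopology interior_of F n \<noteq> {}"
  proof (rule ccontr)
    assume "\<not> ?thesis"
    then have "S.sub.mtopology interior_of \<Union>(range F) = {}"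
      using clF by (intro S.sub.metric_Baire_category_alt[OF comp]) auto
    moreover have "S.sub.mtopology interior_of R = R"
      using interior_of_topspace[of S.sub.mtopology] by simp
    moreover have "R \<noteq> {}" using zero_in_dirichlet_space by (auto simp: R_def)
    ultimately show False unfolding UF by simp
  qed
  then obtain n p where p: "p \<in> S.sub.mtopology interior_of F n" by blast
  then obtain \<epsilon> where \<epsilon>: "0 < \<epsilon>" "S.sub.mball p \<epsilon> \<subseteq> S.sub.mtopology interior_of F n"
    using openin_interior_of[of S.sub.mtopology "F n"] unfolding S.sub.openin_mtopology by blast
  have pF: "p \<in> F n" by (rule subsetD[OF interior_of_subset p])
  have ballF: "S.sub.mball p \<epsilon> \<subseteq> F n" by (rule order_trans[OF \<epsilon>(2) interior_of_subset])
  obtain f0 where f0: "f0 \<in> ?X" "dirichlet_norm \<alpha> f0 \<le> real n" "p = C\<^sub>\<phi> f0"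
    using pF by (auto simp: F_def)
  have pR: "p \<in> R" using f0 by (auto simp: R_def)
  have small: "dirichlet_norm \<alpha> h \<le> 2 * real n" if h: "h \<in> ?X" "dirichlet_norm \<alpha> (C\<^sub>\<phi> h) < \<epsilon>" for h
  proof -
    define f where "f = restrict (\<lambda>z. f0 z - h z) \<bbbD>"
    have f: "f \<in> ?X" unfolding f_def by (rule diff_in_dirichlet_space[OF f0(1) h(1)])
    have hf: "restrict (\<lambda>z. f0 z - f z) \<bbbD> = h"
      using h(1) by (intro extensionalityI[of _ \<bbbD>]) (auto simp: f_def dirichlet_space_def)
    have "?d p (C\<^sub>\<phi> f) < \<epsilon>"
      unfolding f0(3) dirichlet_dist_composition_op hf by (rule h(2))
    moreover have "C\<^sub>\<phi> f \<in> R" using f by (simp add: R_def)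
    ultimately have "C\<^sub>\<phi> f \<in> S.sub.mball p \<epsilon>" using pR by simp
    then have "C\<^sub>\<phi> f \<in> F n" using ballF by blast
    then obtain f1 where f1: "f1 \<in> ?X" "dirichlet_norm \<alpha> f1 \<le> real n" "C\<^sub>\<phi> f = C\<^sub>\<phi> f1"
      by (auto simp: F_def)
    then have "f = f1" using inj_on_composition_op f by (auto dest: inj_onD)
    then have fn: "dirichlet_norm \<alpha> f \<le> real n" using f1 by simp
    define z0 where "z0 = restrict (\<lambda>_. 0::complex) \<bbbD>"
    have z0: "z0 \<in> ?X" unfolding z0_def by (rule zero_in_dirichlet_space)
    have "dirichlet_norm \<alpha> h = ?d f0 f" unfolding dirichlet_dist_eq_norm_diff hf ..
    also have "\<dots> \<le> ?d f0 z0 + ?d z0 f" by (rule D.triangle[OF f0(1) z0 f])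
    also have "\<dots> = dirichlet_norm \<alpha> f0 + dirichlet_norm \<alpha> f"
      unfolding D.commute[of z0 f] by (simp add: z0_def dirichlet_dist_zero)
    also have "\<dots> \<le> 2 * real n" using fn f0(2) by simp
    finally show ?thesis .
  qed
  \<comment> \<open>Strictly larger than the bound for elements with small image, also for \<open>n = 0\<close>.\<close>
  define L where "L = 2 * real n + 1"
  have L: "0 < L" by (simp add: L_def)
  have "\<epsilon> / (2 * L) * dirichlet_norm \<alpha> f \<le> dirichlet_norm \<alpha> (C\<^sub>\<phi> f)" if fD: "f \<in> ?X" for f
  proof (rule ccontr)
    assume contr: "\<not> ?thesis"
    define s where "s = L / dirichlet_norm \<alpha> f"
    have nf: "0 < dirichlet_norm \<alpha> f"
      using contr dirichlet_norm_nonneg[of \<alpha> f] dirichlet_norm_nonneg[of \<alpha> "C\<^sub>\<phi> f"]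
      by (cases "dirichlet_norm \<alpha> f = 0") auto
    have s: "0 < s" using L nf by (simp add: s_def)
    define h where "h = restrict (\<lambda>z. of_real s * f z) \<bbbD>"
    have h: "h \<in> ?X" unfolding h_def by (rule scale_in_dirichlet_space[OF fD])
    have nh: "dirichlet_norm \<alpha> h = L"
      unfolding h_def using dirichlet_norm_scale[OF fD, of s] s nf by (simp add: s_def)
    have "dirichlet_norm \<alpha> (C\<^sub>\<phi> h) = dirichlet_norm \<alpha> (restrict (\<lambda>z. of_real s * C\<^sub>\<phi> f z) \<bbbD>)"
    proof -
      have "C\<^sub>\<phi> h = restrict (\<lambda>z. of_real s * C\<^sub>\<phi> f z) \<bbbD>"
        by (intro extensionalityI[of _ \<bbbD>])
          (auto simp: composition_op_def compose_def h_def in_disk[simplified])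
      then show ?thesis by simp
    qed
    also have "\<dots> = s * dirichlet_norm \<alpha> (C\<^sub>\<phi> f)"
      using dirichlet_norm_scale[OF CD[OF fD], of s] s by simp
    also have "\<dots> < s * (\<epsilon> / (2 * L) * dirichlet_norm \<alpha> f)"
      using contr s by (intro mult_strict_left_mono) auto
    also have "\<dots> = \<epsilon> / 2" using L nf by (simp add: s_def)
    also have "\<dots> < \<epsilon>" using \<epsilon>(1) by simp
    finally have "dirichlet_norm \<alpha> h \<le> 2 * real n" by (rule small[OF h])
    then show False unfolding nh L_def by simp
  qed
  then show ?thesis using \<epsilon>(1) L by (intro exI[of _ "\<epsilon> / (2 * L)"]) auto
qed

end

section \<open>The equivalences\<close>

text \<open>
  All conditions are compared with the existence of \<open>c > 0\<close> such that the counting energy is at least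
  \<open>c\<close> times the energy, after the normalising constants of the measures are cancelled.
\<close>

theorem theorem2p22:
  fixes \<alpha> :: real and \<phi> :: "complex \<Rightarrow> complex"
  assumes "-1 < \<alpha>" and "\<alpha> < 0"
    and "\<phi> holomorphic_on \<bbbD>" and "\<phi> ` \<bbbD> \<subseteq> \<bbbD>" and "\<not> \<phi> constant_on \<bbbD>" and "\<phi> 0 = 0"
    and "uniform_tail_condition \<phi> \<alpha>"
  shows
    "(has_closed_range \<phi> \<alpha> \<longleftrightarrow>
       (\<exists>\<delta>>0. \<exists>r>0. \<forall>z\<in>\<bbbD>.
          emeasure (counting_measure \<phi> \<alpha>) (bergman_disk z r)
            \<ge> ennreal \<delta> * emeasure (weighted_area \<alpha>) (bergman_disk z r)))
   \<and> (has_closed_range \<phi> \<alpha> \<longleftrightarrow>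
       (\<exists>\<delta>>0. \<exists>r>0. \<forall>z\<in>\<bbbD>.
          emeasure (weighted_area \<alpha>) (\<phi> ` \<bbbD> \<inter> bergman_disk z r)
            \<ge> ennreal \<delta> * emeasure (weighted_area \<alpha>) (bergman_disk z r)))
   \<and> (has_closed_range \<phi> \<alpha> \<longleftrightarrow> reverse_carleson \<alpha> (counting_measure \<phi> \<alpha>))"
    (is "(?cl \<longleftrightarrow> ?ii) \<and> (?cl \<longleftrightarrow> ?iii) \<and> (?cl \<longleftrightarrow> ?iv)")
proof -
  interpret disk_self_map \<alpha> \<phi>
    by unfold_locales (use assms in auto)
  note utc = assms(7)
  define E where "E \<longleftrightarrow> (\<exists>c>0. \<forall>f\<in>dirichlet_space \<alpha>. ennreal c * weighted_energy \<alpha> f \<le> counting_energy f)"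
  let ?W = "\<lambda>A. \<integral>\<^sup>+w\<in>A. ennreal (disk_weight \<alpha> w) \<partial>lborel"
  have cl: "?cl \<longleftrightarrow> E"
    unfolding E_def norm_bounded_below_iff_energy_bounded_below[OF utc, symmetric]
    using norm_bounded_below_if_closed_range[OF utc] closed_range_if_norm_bounded_below[OF utc] by blast
  have iv: "?iv \<longleftrightarrow> E"
    unfolding E_def by (rule reverse_carleson_iff_energy)
  have wa: "emeasure (weighted_area \<alpha>) A = ennreal ((1 + \<alpha>) / pi) * ?W A" if "A \<in> sets borel" "A \<subseteq> \<bbbD>" for A
    by (rule emeasure_weighted_area[OF that \<alpha>(1)])
  have pb: "pseudo_disk z \<rho> \<in> sets borel" "pseudo_disk z \<rho> \<subseteq> \<bbbD>" for z \<rho>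
    using pseudo_disk_subset by auto
  have rb: "\<phi> ` \<bbbD> \<inter> pseudo_disk z \<rho> \<in> sets borel" "\<phi> ` \<bbbD> \<inter> pseudo_disk z \<rho> \<subseteq> \<bbbD>" for z \<rho>
    using open_range pseudo_disk_subset by auto
  have p1: "0 < 1 + \<alpha>" "0 \<le> (1 + \<alpha>) / pi" using \<alpha> by auto
  have cancel_pi: "ennreal (1 / pi) * x \<le> ennreal (1 / pi) * y \<longleftrightarrow> x \<le> y" for x y
  proof
    assume "ennreal (1 / pi) * x \<le> ennreal (1 / pi) * y"
    then have "ennreal pi * (ennreal (1 / pi) * x) \<le> ennreal pi * (ennreal (1 / pi) * y)"
      by (rule mult_left_mono) simp
    then show "x \<le> y" by (subst (asm) (1 2) ennreal_mult_collect) auto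
  qed (auto intro: mult_left_mono)
  have cond_ii: "ennreal \<delta> * emeasure (weighted_area \<alpha>) (bergman_disk z r) \<le> emeasure (counting_measure \<phi> \<alpha>) (bergman_disk z r)
      \<longleftrightarrow> ennreal (\<delta> * (1 + \<alpha>)) * ?W (pseudo_disk z (tanh r)) \<le> (\<integral>\<^sup>+w\<in>pseudo_disk z (tanh r). N w \<partial>lborel)"
    if "z \<in> \<bbbD>" "0 < \<delta>" for z r \<delta>
  proof -
    have "ennreal \<delta> * (ennreal ((1 + \<alpha>) / pi) * ?W (pseudo_disk z (tanh r)))
        = ennreal (1 / pi) * (ennreal (\<delta> * (1 + \<alpha>)) * ?W (pseudo_disk z (tanh r)))"
    proof -
      have nn: "0 \<le> \<delta>" "0 \<le> 1 / pi" "0 \<le> \<delta> * (1 + \<alpha>)" using that p1 by auto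
      have "\<delta> * ((1 + \<alpha>) / pi) = 1 / pi * (\<delta> * (1 + \<alpha>))" by simp
      then show ?thesis
        by (simp only: ennreal_mult_collect[OF nn(1) p1(2)] ennreal_mult_collect[OF nn(2,3)])
    qed
    then show ?thesis
      unfolding bergman_disk_eq_pseudo_disk[OF that(1)] wa[OF pb] emeasure_counting_measure[OF pb]
      by (simp only: cancel_pi)
  qed
  have cond_iii: "ennreal \<delta> * emeasure (weighted_area \<alpha>) (bergman_disk z r) \<le> emeasure (weighted_area \<alpha>) (\<phi> ` \<bbbD> \<inter> bergman_disk z r)
      \<longleftrightarrow> ennreal \<delta> * ?W (pseudo_disk z (tanh r)) \<le> ?W (\<phi> ` \<bbbD> \<inter> pseudo_disk z (tanh r))"
    if "z \<in> \<bbbD>" for z r \<delta>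
  proof -
    have "ennreal ((1 + \<alpha>) / pi) * x \<le> ennreal ((1 + \<alpha>) / pi) * y \<longleftrightarrow> x \<le> y" for x y
    proof
      assume "ennreal ((1 + \<alpha>) / pi) * x \<le> ennreal ((1 + \<alpha>) / pi) * y"
      then have "ennreal (pi / (1 + \<alpha>)) * (ennreal ((1 + \<alpha>) / pi) * x) \<le> ennreal (pi / (1 + \<alpha>)) * (ennreal ((1 + \<alpha>) / pi) * y)"
        by (rule mult_left_mono) simp
      then show "x \<le> y" using p1 by (subst (asm) (1 2) ennreal_mult_collect) auto
    qed (auto intro: mult_left_mono)
    then show ?thesis
      unfolding bergman_disk_eq_pseudo_disk[OF that(1)] wa[OF pb] wa[OF rb] mult.left_commute[of "ennreal \<delta>"]
      by simp
  qed
  have tanh01: "0 < tanh r" "tanh r < 1" if "0 < r" for r :: real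
    using that tanh_real_lt_1 by auto
  have ii_iii: "?iii" if asm: "?ii"
  proof -
    obtain \<delta> r where \<delta>: "0 < \<delta>" "0 < r" and
      dens: "\<And>z. z \<in> \<bbbD> \<Longrightarrow> ennreal \<delta> * emeasure (weighted_area \<alpha>) (bergman_disk z r) \<le> emeasure (counting_measure \<phi> \<alpha>) (bergman_disk z r)"
      using asm by blast
    have "\<exists>\<delta>'>0. \<forall>a\<in>\<bbbD>. ennreal \<delta>' * ?W (pseudo_disk a (tanh r)) \<le> ?W (\<phi> ` \<bbbD> \<inter> pseudo_disk a (tanh r))"
    proof (rule range_dense_if_counting_dense[OF utc tanh01[OF \<delta>(2)]])
      show "0 < \<delta> * (1 + \<alpha>)" using \<delta> p1 by simp
      show "ennreal (\<delta> * (1 + \<alpha>)) * ?W (pseudo_disk a (tanh r)) \<le> (\<integral>\<^sup>+w\<in>pseudo_disk a (tanh r). N w \<partial>lborel)"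
        if "a \<in> \<bbbD>" for a using dens[OF that] cond_ii[OF that \<delta>(1)] by blast
    qed
    then show "?iii" using cond_iii \<delta>(2) by blast
  qed
  have iii_E: "E" if asm: "?iii"
  proof -
    obtain \<delta> r where \<delta>: "0 < \<delta>" "0 < r" and
      dens: "\<And>z. z \<in> \<bbbD> \<Longrightarrow> ennreal \<delta> * emeasure (weighted_area \<alpha>) (bergman_disk z r) \<le> emeasure (weighted_area \<alpha>) (\<phi> ` \<bbbD> \<inter> bergman_disk z r)"
      using asm by blast
    show E
      unfolding E_def
      by (rule energy_bounded_below_if_range_dense[OF tanh01[OF \<delta>(2)] \<delta>(1)]) (use dens cond_iii in blast)
  qed
  have E_ii: "?ii" if asm: "E"
  proof -
    obtain c where c: "0 < c" "\<And>f. f \<in> dirichlet_space \<alpha> \<Longrightarrow> ennreal c * weighted_energy \<alpha> f \<le> counting_energy f"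
      using asm unfolding E_def by blast
    obtain \<delta> \<rho> where \<delta>: "0 < \<delta>" and \<rho>: "0 < \<rho>" "\<rho> < 1" and
      dens: "\<And>a. a \<in> \<bbbD> \<Longrightarrow> ennreal \<delta> * ?W (pseudo_disk a \<rho>) \<le> (\<integral>\<^sup>+w\<in>pseudo_disk a \<rho>. N w \<partial>lborel)"
      using counting_dense_if_energy_bounded_below[OF utc c] by blast
    define r where "r = artanh \<rho>"
    have tr: "tanh r = \<rho>" unfolding r_def using \<rho> by (intro tanh_artanh) auto
    have r: "0 < r" using \<rho>(1) tr by (metis tanh_real_pos_iff)
    define \<delta>' where "\<delta>' = \<delta> / (1 + \<alpha>)"
    have \<delta>': "0 < \<delta>'" "\<delta>' * (1 + \<alpha>) = \<delta>" using \<delta> p1 by (auto simp: \<delta>'_def)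
    have "ennreal \<delta>' * emeasure (weighted_area \<alpha>) (bergman_disk z r) \<le> emeasure (counting_measure \<phi> \<alpha>) (bergman_disk z r)"
      if "z \<in> \<bbbD>" for z
      unfolding cond_ii[OF that \<delta>'(1)] \<delta>'(2) tr by (rule dens[OF that])
    then show "?ii" using \<delta>'(1) r by blast
  qed
  show ?thesis using cl iv ii_iii iii_E E_ii by blast
qed

end
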